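(* Let $\vec G=(G_i)_{i\ge 1}$ be a sequence of independent standard Gaussian random variables and let $d\ge 1$ be an integer. The set $$\{P(\vec G): P \text{ is a polynomial of degree at most } d\}$$ is closed for the topology of convergence in distribution; that is, if $F_n=P_n(\vec G)$ with $\deg P_n\le d$ for all $n$ and $(F_n)$ converges in law to a probability measure $\mu$, then there is a polynomial $P$ of degree at most $d$ such that $\mu$ is the law of $P(\vec G)$.
   Context: Polynomials may involve countably many variables: $\{P(\vec G):\deg P\le d\}$ denotes the $L^2(\mathbf P)$-closure of the linear space of all ordinary polynomials of total degree at most $d$ in finitely many of the $G_i$ (equivalently, the sum of the Wiener chaoses of order at most $d$). *)

theory Defs
  imports "HOL-Probability.Probability" "HOL-Library.Poly_Mapping"
begin

text \<open>A real polynomial in countably many indeterminates is a finitely supported map from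
  monomials to coefficients, where a monomial is a finitely supported map from indices of
  indeterminates to exponents. Hence each polynomial involves only finitely many indeterminates.\<close>

type_synonym real_mpoly = "(nat \<Rightarrow>\<^sub>0 nat) \<Rightarrow>\<^sub>0 real"

definition monom_degree :: "(nat \<Rightarrow>\<^sub>0 nat) \<Rightarrow> nat" where
  "monom_degree m = (\<Sum>i\<in>Poly_Mapping.keys m. Poly_Mapping.lookup m i)"

text \<open>The zero polynomial gets total degree 0; since only the condition of having degree at
  most \<open>d\<close> is used, this agrees with the convention that its degree is minus infinity.\<close>

definition total_degree :: "real_mpoly \<Rightarrow> nat" where
  "total_degree p = Max (insert 0 (monom_degree ` Poly_Mapping.keys p))"

definition eval_mpoly :: "real_mpoly \<Rightarrow> (nat \<Rightarrow> real) \<Rightarrow> real" where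
  "eval_mpoly p x = (\<Sum>m\<in>Poly_Mapping.keys p.
     Poly_Mapping.lookup p m * (\<Prod>i\<in>Poly_Mapping.keys m. x i ^ Poly_Mapping.lookup m i))"

definition square_integrable :: "'a measure \<Rightarrow> ('a \<Rightarrow> real) \<Rightarrow> bool" where
  "square_integrable M f \<longleftrightarrow> f \<in> borel_measurable M \<and> integrable M (\<lambda>\<omega>. (f \<omega>)\<^sup>2)"

text \<open>Elements of the closure are honest functions; with each function, the set contains all its
  measurable almost-everywhere modifications.\<close>

definition L2_closure :: "'a measure \<Rightarrow> ('a \<Rightarrow> real) set \<Rightarrow> ('a \<Rightarrow> real) set" where
  "L2_closure M S = {F. square_integrable M F \<and>
     (\<forall>\<epsilon>>0. \<exists>H\<in>S. square_integrable M H \<and> sqrt (\<integral>\<omega>. (F \<omega> - H \<omega>)\<^sup>2 \<partial>M) < \<epsilon>)}"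

definition polynomials_in ::
    "'a measure \<Rightarrow> (nat \<Rightarrow> 'a \<Rightarrow> real) \<Rightarrow> nat \<Rightarrow> ('a \<Rightarrow> real) set" where
  "polynomials_in M G d =
     L2_closure M {\<lambda>\<omega>. eval_mpoly p (\<lambda>i. G i \<omega>) | p. total_degree p \<le> d}"

end

theory Submission
  imports Defs
begin

text \<open>
  By hypercontractivity, convergence in law of polynomials of degree at most \<open>d\<close> forces
  boundedness in \<open>L\<^sup>2\<close>. Along an ultrafilter, consider the Hilbert space \<open>V\<^sub>d\<close> of
  \<open>L\<^sup>2\<close>-bounded sequences of polynomials of degree at most \<open>d\<close>; products map
  \<open>V\<^sub>a \<times> V\<^sub>b\<close> to \<open>V\<^sub>a\<^sub>+\<^sub>b\<close>. Call an element of \<open>V\<^sub>q\<close> irreducible if it is orthogonal to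
  \<open>V\<^sub>q\<^sub>-\<^sub>1\<close> and to all products \<open>V\<^sub>a V\<^sub>b\<close> with \<open>a, b \<ge> 1\<close> and \<open>a + b = q\<close>. By induction on the
  degree and orthogonal projection, the algebra generated by irreducible elements is dense in
  \<open>V\<^sub>d\<close>, with degrees respected. Irreducibility of \<open>Z\<close> means that the proper flattenings of its
  kernel have vanishing operator norm, so contraction with the kernel is asymptotically a
  derivation. Hence the joint moments of irreducible elements obey Isserlis' recursion: they are
  jointly Gaussian in the limit. A sequence in \<open>V\<^sub>d\<close> is therefore approximated by polynomials of
  degree at most \<open>d\<close> in asymptotically Gaussian variables, and replacing these by genuine
  Gaussian variables gives an \<open>L\<^sup>2\<close>-Cauchy sequence whose limit has the required law.
\<close>

section \<open>Polynomial functions and Gaussian integration by parts\<close>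

text \<open>The number \<open>N\<close> of variables may grow along the sequence, so every estimate
  must depend on degrees and second moments only; this is why derivatives are always summed over all
  coordinates and never counted. The ultrafilter makes all limits of bounded sequences exist at
  once, although infinitely many irreducible elements may be needed and no subsequence would serve
  all of them by finite extraction. Isserlis' recursion closes because the factor contracted first
  is one of maximal degree: its kernel paired with a factor of at most the same degree gives a
  constant. All approximants are written in one countable family whose limiting Gram matrix is
  realised by genuine Gaussian variables, so that L2 distances between approximants survive the
  replacement. Moments do not determine the law of a general polynomial in Gaussians, hence laws are
  transferred through the Gaussian vector itself.\<close>

inductive polyfun :: "nat \<Rightarrow> nat \<Rightarrow> ((nat \<Rightarrow> real) \<Rightarrow> real) \<Rightarrow> bool" for N where
  const: "polyfun N d (\<lambda>x. c)"
| add: "polyfun N d f \<Longrightarrow> polyfun N d g \<Longrightarrow> polyfun N d (\<lambda>x. f x + g x)"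
| var_mult: "i < N \<Longrightarrow> polyfun N d f \<Longrightarrow> polyfun N (Suc d) (\<lambda>x. x i * f x)"

lemma polyfun_Suc: "polyfun N d f \<Longrightarrow> polyfun N (Suc d) f"
  by (induction rule: polyfun.induct) (auto intro: polyfun.intros)

lemma polyfun_mono: "polyfun N d f \<Longrightarrow> d \<le> d' \<Longrightarrow> polyfun N d' f"
  by (rule dec_induct[of d d' "\<lambda>k. polyfun N k f"]) (auto intro: polyfun_Suc)

lemma polyfun_cmult: "polyfun N d f \<Longrightarrow> polyfun N d (\<lambda>x. c * f x)"
proof (induction rule: polyfun.induct)
  case (add d f g)
  then show ?case by (simp add: distrib_left polyfun.add)
next
  case (var_mult i d f)
  have "(\<lambda>x. c * (x i * f x)) = (\<lambda>x. x i * (c * f x))" by (simp add: fun_eq_iff)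
  with var_mult show ?case by (metis polyfun.var_mult)
qed (auto intro: polyfun.intros)

lemma polyfun_uminus: "polyfun N d f \<Longrightarrow> polyfun N d (\<lambda>x. - f x)"
  using polyfun_cmult[of N d f "-1"] by simp

lemma polyfun_diff: "polyfun N d f \<Longrightarrow> polyfun N d g \<Longrightarrow> polyfun N d (\<lambda>x. f x - g x)"
  using polyfun.add[OF _ polyfun_uminus, of N d f g] by simp

lemma polyfun_mult:
  "polyfun N a f \<Longrightarrow> polyfun N b g \<Longrightarrow> polyfun N (a + b) (\<lambda>x. f x * g x)"
proof (induction rule: polyfun.induct)
  case (const d c)
  then show ?case by (intro polyfun_mono[OF polyfun_cmult]) auto
next
  case (add d f f')
  then show ?case by (simp add: distrib_right polyfun.add)
next
  case (var_mult i d f)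
  then show ?case by (simp add: mult.assoc polyfun.var_mult)
qed

lemma polyfun_var: "i < N \<Longrightarrow> polyfun N 1 (\<lambda>x. x i)"
  using polyfun.var_mult[OF _ polyfun.const[of N 0 1], of i] by simp

lemma polyfun_sum: "(\<And>i. i \<in> I \<Longrightarrow> polyfun N d (f i)) \<Longrightarrow> polyfun N d (\<lambda>x. \<Sum>i\<in>I. f i x)"
  by (induction I rule: infinite_finite_induct) (auto intro: polyfun.intros)

lemma polyfun_power: "polyfun N d f \<Longrightarrow> polyfun N (k * d) (\<lambda>x. f x ^ k)"
  by (induction k) (auto intro: polyfun.const polyfun_mult)

lemma polyfun_power2: "polyfun N d f \<Longrightarrow> polyfun N (d + d) (\<lambda>x. (f x)\<^sup>2)"
  by (simp add: power2_eq_square polyfun_mult)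

lemma polyfun_prod_list:
  "(\<And>f. f \<in> set fs \<Longrightarrow> polyfun N d f) \<Longrightarrow> polyfun N (length fs * d) (\<lambda>x. \<Prod>f\<leftarrow>fs. f x)"
  by (induction fs) (auto intro: polyfun.const polyfun_mult)

lemma polyfun_mono_vars: "polyfun N d f \<Longrightarrow> N \<le> N' \<Longrightarrow> polyfun N' d f"
  by (induction rule: polyfun.induct) (auto intro: polyfun.intros)

lemma polyfun_0: "polyfun N 0 f \<Longrightarrow> \<exists>c. f = (\<lambda>x. c)"
  by (induction "0::nat" f rule: polyfun.induct) auto

lemma polyfun_comp:
  assumes "polyfun K d f" "\<And>i. i < K \<Longrightarrow> polyfun N e (\<sigma> i)"
  shows "polyfun N (d * e) (\<lambda>x. f (\<lambda>i. \<sigma> i x))"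
  using assms(1)
proof (induction rule: polyfun.induct)
  case (var_mult i d f)
  then show ?case using polyfun_mult[OF assms(2)] by simp
qed (auto intro: polyfun.intros)

lemma polyfun_cong:
  assumes "polyfun N d f" "\<And>i. i < N \<Longrightarrow> x i = y i"
  shows "f x = f y"
  using assms(1) by (induction rule: polyfun.induct) (auto simp: assms(2))

lemma continuous_on_polyfun:
  assumes "polyfun N d f" "\<And>i. continuous_on A (\<lambda>x. \<sigma> x i)"
  shows "continuous_on A (\<lambda>x. f (\<sigma> x))"
  using assms(1) by (induction rule: polyfun.induct) (auto intro!: continuous_intros assms(2))

lemma measurable_polyfun:
  assumes "polyfun N d f" "\<And>i. (\<lambda>\<omega>. g \<omega> i) \<in> borel_measurable M"
  shows "(\<lambda>\<omega>. f (g \<omega>)) \<in> borel_measurable M"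
  using assms(1) by (induction rule: polyfun.induct) (auto intro!: borel_measurable_times borel_measurable_add assms(2))

text \<open>\<open>polyfun\<close> carries no coefficients, so the derivative is the analytic one
  along a coordinate; \<open>polyfun_differentiable\<close> makes the value of the total function
  \<open>deriv\<close> meaningful.\<close>

definition pdiff :: "nat \<Rightarrow> ((nat \<Rightarrow> real) \<Rightarrow> real) \<Rightarrow> (nat \<Rightarrow> real) \<Rightarrow> real" where
  "pdiff i f x = deriv (\<lambda>t. f (x(i := t))) (x i)"

lemma polyfun_differentiable:
  "polyfun N d f \<Longrightarrow> (\<lambda>t. f (x(i := t))) field_differentiable (at s)"
proof (induction rule: polyfun.induct)
  case (var_mult j d f)
  have "(\<lambda>t. (x(i := t)) j) field_differentiable (at s)"
    by (cases "i = j") (auto intro: derivative_intros)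
  then show ?case using var_mult by (intro field_differentiable_mult)
qed (auto intro: derivative_intros)

lemma polyfun_DERIV:
  assumes "polyfun N d f"
  shows "((\<lambda>t. f (x(i := t))) has_field_derivative pdiff i f x) (at (x i))"
  unfolding pdiff_def
  using polyfun_differentiable[OF assms] by (simp add: DERIV_deriv_iff_field_differentiable)

lemma pdiff_eqI: "((\<lambda>t. f (x(i := t))) has_field_derivative D) (at (x i)) \<Longrightarrow> pdiff i f x = D"
  unfolding pdiff_def by (rule DERIV_imp_deriv)

lemma pdiff_const [simp]: "pdiff i (\<lambda>x. c) = (\<lambda>x. 0)"
  by (auto simp: fun_eq_iff pdiff_def)

lemma pdiff_add:
  "polyfun N d f \<Longrightarrow> polyfun N e g \<Longrightarrow> pdiff i (\<lambda>x. f x + g x) = (\<lambda>x. pdiff i f x + pdiff i g x)"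
  by (intro ext pdiff_eqI DERIV_add) (auto intro: polyfun_DERIV)

lemma pdiff_mult:
  "polyfun N d f \<Longrightarrow> polyfun N e g \<Longrightarrow>
    pdiff i (\<lambda>x. f x * g x) = (\<lambda>x. pdiff i f x * g x + f x * pdiff i g x)"
proof (intro ext pdiff_eqI, goal_cases)
  case (1 x)
  show ?case using DERIV_mult[OF polyfun_DERIV[OF 1(1), of x i] polyfun_DERIV[OF 1(2), of x i]]
    by (simp add: algebra_simps)
qed

lemma pdiff_var: "pdiff i (\<lambda>x. x j) = (\<lambda>x. if i = j then 1 else 0)"
proof (intro ext pdiff_eqI)
  fix x :: "nat \<Rightarrow> real"
  show "((\<lambda>t. (x(i := t)) j) has_real_derivative (if i = j then 1 else 0)) (at (x i))"
    by (cases "i = j") auto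
qed

lemma pdiff_cmult:
  "polyfun N d f \<Longrightarrow> pdiff i (\<lambda>x. c * f x) = (\<lambda>x. c * pdiff i f x)"
  using pdiff_mult[OF polyfun.const[of N 0 c]] by simp

lemma pdiff_var_mult:
  "j < N \<Longrightarrow> polyfun N d f \<Longrightarrow>
    pdiff i (\<lambda>x. x j * f x) = (\<lambda>x. (if i = j then f x else 0) + x j * pdiff i f x)"
  using pdiff_mult[OF polyfun_var[of j N], of d f i] by (simp add: pdiff_var fun_eq_iff)

lemma polyfun_pdiff: "polyfun N d f \<Longrightarrow> polyfun N (d - 1) (pdiff i f)"
proof (induction rule: polyfun.induct)
  case (add d f g)
  then show ?case by (simp add: pdiff_add polyfun.add)
next
  case (var_mult j d f)
  \<comment> \<open>At \<open>d = 0\<close> the truncated \<open>d - 1\<close> is 0 and multiplying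
    by \<open>x j\<close> would give degree 1; there \<open>f\<close> is constant and the derivative
    vanishes.\<close>
  have "polyfun N d (\<lambda>x. x j * pdiff i f x)"
  proof (cases d)
    case 0
    then obtain c where "f = (\<lambda>x. c)" using var_mult polyfun_0 by blast
    then have "pdiff i f = (\<lambda>_. 0)" by simp
    then show ?thesis using polyfun.const[of N d 0] by simp
  next
    case (Suc d')
    then show ?thesis using var_mult polyfun.var_mult by simp
  qed
  moreover have "polyfun N d (\<lambda>x. if i = j then f x else 0)"
    using var_mult by (cases "i = j") (auto intro: polyfun.const)
  ultimately show ?case using var_mult by (simp add: pdiff_var_mult polyfun.add)
qed (simp add: polyfun.const)

lemma polyfun_pdiff': "polyfun N d f \<Longrightarrow> polyfun N d (pdiff i f)"
  by (rule polyfun_mono[OF polyfun_pdiff]) auto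

lemma pdiff_0: "polyfun N 0 f \<Longrightarrow> pdiff i f = (\<lambda>x. 0)"
  by (drule polyfun_0) auto

lemma pdiff_commute: "polyfun N d f \<Longrightarrow> pdiff i (pdiff j f) = pdiff j (pdiff i f)"
proof (induction rule: polyfun.induct)
  case (add d f g)
  then show ?case
    by (simp add: pdiff_add[of N d f d g] pdiff_add[OF polyfun_pdiff' polyfun_pdiff'])
next
  case (var_mult k d f)
  have a: "pdiff l (\<lambda>x. if b then f x else 0) = (\<lambda>x. if b then pdiff l f x else 0)" for l b
    by (cases b) auto
  have p: "polyfun N (Suc d) (\<lambda>x. x k * pdiff l f x)" for l
    using var_mult by (auto intro: polyfun.var_mult polyfun_pdiff')
  have q: "polyfun N d (\<lambda>x. if b then f x else 0)" for b
    using var_mult by (cases b) (auto intro: polyfun.const)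
  show ?case
    using var_mult
    by (auto simp: fun_eq_iff pdiff_var_mult pdiff_add[OF q p] a pdiff_var_mult[OF _ polyfun_pdiff'])
qed simp

section \<open>Gaussian integration by parts, reduced to monomials\<close>

definition monomial_fun :: "nat \<Rightarrow> (nat \<Rightarrow> nat) \<Rightarrow> (nat \<Rightarrow> real) \<Rightarrow> real" where
  "monomial_fun N m x = (\<Prod>j<N. x j ^ m j)"

lemma monomial_fun_var_mult:
  "i < N \<Longrightarrow> x i * monomial_fun N m x = monomial_fun N (m(i := Suc (m i))) x"
  unfolding monomial_fun_def by (simp add: prod.remove[of "{..<N}" i])

lemma polyfun_monomial_fun: "polyfun N (\<Sum>j<N. m j) (monomial_fun N m)"
proof -
  have "polyfun N (\<Sum>j<K. m j) (\<lambda>x. \<Prod>j<K. x j ^ m j)" if "K \<le> N" for K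
    using that
  proof (induction K)
    case (Suc K)
    then show ?case
      using polyfun_mult[of N _ _ "m K", OF _ polyfun_power[OF polyfun_var[of K N], of "m K", simplified]]
      by simp
  qed (simp add: polyfun.const)
  then show ?thesis unfolding monomial_fun_def[abs_def] by simp
qed

lemma pdiff_monomial_fun:
  assumes "i < N"
  shows "pdiff i (monomial_fun N m) x = real (m i) * x i ^ (m i - 1) * (\<Prod>j\<in>{..<N} - {i}. x j ^ m j)"
proof (rule pdiff_eqI)
  have "(\<lambda>t. monomial_fun N m (x(i := t))) = (\<lambda>t. t ^ m i * (\<Prod>j\<in>{..<N} - {i}. x j ^ m j))"
    using assms by (auto simp: monomial_fun_def fun_eq_iff prod.remove[of "{..<N}" i])
  then show "((\<lambda>t. monomial_fun N m (x(i := t))) has_real_derivative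
     real (m i) * x i ^ (m i - 1) * (\<Prod>j\<in>{..<N} - {i}. x j ^ m j)) (at (x i))"
    by (auto intro!: derivative_eq_intros)
qed

locale gaussian_seq = prob_space M for M :: "'a measure" +
  fixes G :: "nat \<Rightarrow> 'a \<Rightarrow> real"
  assumes indep_G: "indep_vars (\<lambda>_. borel) G UNIV"
    and G_normal: "\<And>i. distributed M lborel (G i) std_normal_density"
begin

definition Ex :: "((nat \<Rightarrow> real) \<Rightarrow> real) \<Rightarrow> real" where
  "Ex f = (\<integral>\<omega>. f (\<lambda>i. G i \<omega>) \<partial>M)"

lemma G_measurable [measurable]: "G i \<in> borel_measurable M"
  using G_normal[of i] by (auto simp: distributed_def)

lemma polyfun_G_measurable: "polyfun N d f \<Longrightarrow> (\<lambda>\<omega>. f (\<lambda>i. G i \<omega>)) \<in> borel_measurable M"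
  by (erule measurable_polyfun) simp

lemma integrable_G_power: "integrable M (\<lambda>\<omega>. G i \<omega> ^ k)"
  using distributed_integrable[OF G_normal, of "\<lambda>x. x ^ k" i] integrable_std_normal_moment[of k]
  by simp

lemma integral_G_power: "(\<integral>\<omega>. G i \<omega> ^ k \<partial>M) = (\<integral>x. std_normal_density x * x ^ k \<partial>lborel)"
  using distributed_integral[OF G_normal, of "\<lambda>x. x ^ k" i] by simp

text \<open>The one-dimensional Stein identity on powers. At \<open>k = 0\<close> the truncated
  exponent is harmless because of the factor \<open>k\<close>.\<close>

lemma integral_G_power_Suc:
  "(\<integral>\<omega>. G i \<omega> ^ Suc k \<partial>M) = real k * (\<integral>\<omega>. G i \<omega> ^ (k - 1) \<partial>M)"
proof (cases "even k")
  case True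
  then obtain j where j: "k = 2 * j" by blast
  show ?thesis
  proof (cases j)
    case 0
    then show ?thesis using j integral_std_normal_moment_odd[of 0] integral_G_power[of i 1] by simp
  next
    case (Suc j')
    then have k: "k - 1 = 2 * j' + 1" "Suc k = 2 * j + 1" using j by auto
    show ?thesis unfolding integral_G_power k integral_std_normal_moment_odd by simp
  qed
next
  case False
  then obtain j where j: "k = 2 * j + 1" by (auto elim: oddE)
  then have k: "k - 1 = 2 * j" "Suc k = 2 * Suc j" by auto
  show ?thesis unfolding integral_G_power k integral_std_normal_moment_even
    by (simp add: j divide_simps) 
qed

text \<open>All even powers are treated at once, since the product case bounds
  \<open>(a * b) ^ (2 * k)\<close> by powers with doubled exponent and needs the hypothesis at
  \<open>2 * k\<close>.\<close>

lemma integrable_polyfun_even_power: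
  "polyfun N d f \<Longrightarrow> integrable M (\<lambda>\<omega>. f (\<lambda>i. G i \<omega>) ^ (2 * k))"
proof (induction arbitrary: k rule: polyfun.induct)
  case (add d f g)
  let ?f = "\<lambda>\<omega>. f (\<lambda>i. G i \<omega>)" and ?g = "\<lambda>\<omega>. g (\<lambda>i. G i \<omega>)"
  have [measurable]: "?f \<in> borel_measurable M" "?g \<in> borel_measurable M"
    using add by (auto intro: polyfun_G_measurable)
  have *: "(a + b) ^ (2 * k) \<le> 4 ^ k * (a ^ (2 * k) + b ^ (2 * k))" for a b :: real
  proof -
    have "\<bar>a + b\<bar> \<le> 2 * max \<bar>a\<bar> \<bar>b\<bar>" by linarith
    then have "\<bar>a + b\<bar> ^ (2 * k) \<le> (2 * max \<bar>a\<bar> \<bar>b\<bar>) ^ (2 * k)" by (intro power_mono) auto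
    also have "\<dots> = 4 ^ k * (max \<bar>a\<bar> \<bar>b\<bar>) ^ (2 * k)" by (simp add: power_mult_distrib power_mult)
    also have "(max \<bar>a\<bar> \<bar>b\<bar>) ^ (2 * k) \<le> \<bar>a\<bar> ^ (2 * k) + \<bar>b\<bar> ^ (2 * k)"
      by (cases "\<bar>a\<bar> \<le> \<bar>b\<bar>") (auto simp: max_def)
    finally show ?thesis by (simp add: power_mult power_even_abs)
  qed
  show ?case
  proof (rule Bochner_Integration.integrable_bound)
    show "integrable M (\<lambda>\<omega>. 4 ^ k * (?f \<omega> ^ (2 * k) + ?g \<omega> ^ (2 * k)))"
      using add by simp
    show "AE \<omega> in M. norm ((?f \<omega> + ?g \<omega>) ^ (2 * k)) \<le> norm (4 ^ k * (?f \<omega> ^ (2 * k) + ?g \<omega> ^ (2 * k)))"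
      using * by (intro AE_I2) (simp add: power_mult abs_of_nonneg)
  qed simp
next
  case (var_mult j d f)
  let ?f = "\<lambda>\<omega>. f (\<lambda>i. G i \<omega>)"
  have [measurable]: "?f \<in> borel_measurable M"
    using var_mult by (auto intro: polyfun_G_measurable)
  have *: "(a * b) ^ (2 * k) \<le> a ^ (2 * (2 * k)) + b ^ (2 * (2 * k))" for a b :: real
  proof -
    have "2 * (a ^ (2 * k) * b ^ (2 * k)) \<le> (a ^ (2 * k))\<^sup>2 + (b ^ (2 * k))\<^sup>2"
      using sum_squares_bound[of "a ^ (2 * k)" "b ^ (2 * k)"] by (simp add: mult.assoc)
    moreover have "0 \<le> a ^ (2 * k) * b ^ (2 * k)" by (simp add: power_mult)
    ultimately show ?thesis by (simp add: power_mult_distrib power_mult[symmetric] mult.commute)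
  qed
  show ?case
  proof (rule Bochner_Integration.integrable_bound)
    show "integrable M (\<lambda>\<omega>. G j \<omega> ^ (2 * (2 * k)) + ?f \<omega> ^ (2 * (2 * k)))"
      by (intro Bochner_Integration.integrable_add integrable_G_power var_mult)
    show "AE \<omega> in M. norm ((G j \<omega> * ?f \<omega>) ^ (2 * k)) \<le> norm (G j \<omega> ^ (2 * (2 * k)) + ?f \<omega> ^ (2 * (2 * k)))"
      using * by (intro AE_I2) (simp add: power_mult abs_of_nonneg)
  qed simp
qed simp

lemma integrable_polyfun: "polyfun N d f \<Longrightarrow> integrable M (\<lambda>\<omega>. f (\<lambda>i. G i \<omega>))"
  by (rule square_integrable_imp_integrable[OF polyfun_G_measurable])
    (use integrable_polyfun_even_power[of N d f 1] in simp_all)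

lemma Ex_const [simp]: "Ex (\<lambda>x. c) = c"
  by (simp add: Ex_def prob_space)

lemma Ex_add: "polyfun N d f \<Longrightarrow> polyfun N e g \<Longrightarrow> Ex (\<lambda>x. f x + g x) = Ex f + Ex g"
  unfolding Ex_def by (intro Bochner_Integration.integral_add) (auto intro: integrable_polyfun)

lemma Ex_diff: "polyfun N d f \<Longrightarrow> polyfun N e g \<Longrightarrow> Ex (\<lambda>x. f x - g x) = Ex f - Ex g"
  unfolding Ex_def by (intro Bochner_Integration.integral_diff) (auto intro: integrable_polyfun)

lemma Ex_cmult: "Ex (\<lambda>x. c * f x) = c * Ex f"
  unfolding Ex_def by simp

lemma Ex_sum: "(\<And>i. i \<in> I \<Longrightarrow> polyfun N (d i) (f i)) \<Longrightarrow> Ex (\<lambda>x. \<Sum>i\<in>I. f i x) = (\<Sum>i\<in>I. Ex (f i))"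
  unfolding Ex_def by (intro Bochner_Integration.integral_sum) (auto intro: integrable_polyfun)

lemma Ex_nonneg: "(\<And>x. 0 \<le> f x) \<Longrightarrow> 0 \<le> Ex f"
  unfolding Ex_def by (intro integral_nonneg_AE) auto

lemma Ex_mono: "polyfun N d f \<Longrightarrow> polyfun N e g \<Longrightarrow> (\<And>x. f x \<le> g x) \<Longrightarrow> Ex f \<le> Ex g"
  unfolding Ex_def by (intro integral_mono) (auto intro: integrable_polyfun)

text \<open>Independence factors the expectation of a monomial; multiplication by \<open>x i\<close>
  affects only the factor of index \<open>i\<close>, where the one-dimensional recursion
  applies.\<close>

lemma Ex_var_mult_monomial_fun:
  assumes "i < N"
  shows "Ex (\<lambda>x. x i * monomial_fun N m x) = Ex (pdiff i (monomial_fun N m))"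
proof -
  have prod: "Ex (monomial_fun N k) = (\<Prod>j<N. \<integral>\<omega>. G j \<omega> ^ k j \<partial>M)" for k
    unfolding Ex_def monomial_fun_def
  proof (rule indep_vars_lebesgue_integral)
    have "indep_vars (\<lambda>_. borel) (\<lambda>j. (\<lambda>y. y ^ k j) \<circ> G j) {..<N}"
      by (rule indep_vars_compose[OF indep_vars_subset[OF indep_G]]) auto
    then show "indep_vars (\<lambda>_. borel) (\<lambda>j \<omega>. G j \<omega> ^ k j) {..<N}" by (simp add: comp_def)
  qed (auto intro: integrable_G_power)
  have pd: "pdiff i (monomial_fun N m) = (\<lambda>x. real (m i) * monomial_fun N (m(i := m i - 1)) x)"
    using assms
    by (auto simp: pdiff_monomial_fun fun_eq_iff monomial_fun_def prod.remove[of "{..<N}" i])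
  have "(\<Prod>j\<in>{..<N} - {i}. \<integral>\<omega>. G j \<omega> ^ (m(i := v)) j \<partial>M) = (\<Prod>j\<in>{..<N} - {i}. \<integral>\<omega>. G j \<omega> ^ m j \<partial>M)" for v
    by (intro prod.cong) auto
  then show ?thesis
    using assms integral_G_power_Suc[of i "m i"]
    by (simp add: monomial_fun_var_mult prod pd Ex_cmult prod.remove[of "{..<N}" i])
qed

theorem gaussian_ibp:
  assumes "i < N" "polyfun N d f"
  shows "Ex (\<lambda>x. x i * f x) = Ex (pdiff i f)"
proof -
  \<comment> \<open>The monomial prefix absorbs the coordinates peeled off in the multiplicative
    case, so only monomials remain; exponents 0 give the claim.\<close>
  have "Ex (\<lambda>x. x i * (monomial_fun N m x * f x)) = Ex (pdiff i (\<lambda>x. monomial_fun N m x * f x))" for m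
    using assms(2)
  proof (induction arbitrary: m rule: polyfun.induct)
    case (const d c)
    have "Ex (\<lambda>x. c * (x i * monomial_fun N m x)) = Ex (\<lambda>x. c * pdiff i (monomial_fun N m) x)"
      by (simp only: Ex_cmult Ex_var_mult_monomial_fun[OF assms(1)])
    then show ?case
      by (simp add: pdiff_cmult[OF polyfun_monomial_fun] mult.commute[of _ c] mult.left_commute)
  next
    case (add d f g)
    let ?m = "monomial_fun N m"
    note mm = polyfun_mult[OF polyfun_monomial_fun[of N m]]
    have "Ex (\<lambda>x. x i * (?m x * (f x + g x))) = Ex (\<lambda>x. x i * (?m x * f x) + x i * (?m x * g x))"
      by (simp add: algebra_simps)
    also have "\<dots> = Ex (\<lambda>x. x i * (?m x * f x)) + Ex (\<lambda>x. x i * (?m x * g x))"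
      using add by (intro Ex_add[OF polyfun.var_mult[OF assms(1) mm] polyfun.var_mult[OF assms(1) mm]])
    also have "\<dots> = Ex (pdiff i (\<lambda>x. ?m x * f x)) + Ex (pdiff i (\<lambda>x. ?m x * g x))"
      by (simp add: add)
    also have "\<dots> = Ex (\<lambda>x. pdiff i (\<lambda>x. ?m x * f x) x + pdiff i (\<lambda>x. ?m x * g x) x)"
      using add by (intro Ex_add[symmetric, OF polyfun_pdiff[OF mm] polyfun_pdiff[OF mm]])
    also have "(\<lambda>x. pdiff i (\<lambda>x. ?m x * f x) x + pdiff i (\<lambda>x. ?m x * g x) x) =
        pdiff i (\<lambda>x. ?m x * (f x + g x))"
      using pdiff_add[OF mm mm, of d f d g i] add by (simp add: distrib_left)
    finally show ?case .
  next
    case (var_mult j d f)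
    have "monomial_fun N m x * (x j * f x) = monomial_fun N (m(j := Suc (m j))) x * f x" for x
      using monomial_fun_var_mult[OF var_mult(1), of x m] by (metis mult.assoc mult.commute)
    then show ?case using var_mult by presburger
  qed
  from this[of "\<lambda>_. 0"] show ?thesis by (simp add: monomial_fun_def)
qed

end

section \<open>Chaos decomposition and hypercontractivity\<close>

text \<open>With the degree forgotten, the side conditions of differentiation and integration follow
  from closure rules without computing degree bounds.\<close>

definition pfun :: "nat \<Rightarrow> ((nat \<Rightarrow> real) \<Rightarrow> real) \<Rightarrow> bool" where
  "pfun N f \<longleftrightarrow> (\<exists>d. polyfun N d f)"

lemma polyfun_imp_pfun: "polyfun N d f \<Longrightarrow> pfun N f"
  by (auto simp: pfun_def)

lemma pfun_const: "pfun N (\<lambda>x. c)"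
  using polyfun.const unfolding pfun_def by blast

lemma pfun_cmult: "pfun N f \<Longrightarrow> pfun N (\<lambda>x. c * f x)"
  using polyfun_cmult unfolding pfun_def by blast

lemma pfun_mult: "pfun N f \<Longrightarrow> pfun N g \<Longrightarrow> pfun N (\<lambda>x. f x * g x)"
  using polyfun_mult unfolding pfun_def by blast

lemma pfun_add:
  assumes "pfun N f" "pfun N g" shows "pfun N (\<lambda>x. f x + g x)"
proof -
  obtain d e where "polyfun N d f" "polyfun N e g" using assms by (auto simp: pfun_def)
  then have "polyfun N (d + e) (\<lambda>x. f x + g x)"
    by (intro polyfun.add) (auto intro: polyfun_mono)
  then show ?thesis by (rule polyfun_imp_pfun)
qed

lemma pfun_diff:
  assumes "pfun N f" "pfun N g" shows "pfun N (\<lambda>x. f x - g x)"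
  using pfun_add[OF assms(1) pfun_cmult[OF assms(2), of "-1"]] by simp

lemma pfun_uminus: "pfun N f \<Longrightarrow> pfun N (\<lambda>x. - f x)"
  using polyfun_uminus unfolding pfun_def by blast

lemma pfun_power: "pfun N f \<Longrightarrow> pfun N (\<lambda>x. f x ^ k)"
  using polyfun_power unfolding pfun_def by blast

lemma pfun_sum: "(\<And>i. i \<in> I \<Longrightarrow> pfun N (f i)) \<Longrightarrow> pfun N (\<lambda>x. \<Sum>i\<in>I. f i x)"
  by (induction I rule: infinite_finite_induct) (auto intro: pfun_add pfun_const)

lemma pfun_prod_list: "(\<And>f. f \<in> set fs \<Longrightarrow> pfun N f) \<Longrightarrow> pfun N (\<lambda>x. \<Prod>f\<leftarrow>fs. f x)"
  by (induction fs) (auto intro: pfun_const pfun_mult)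

lemma pfun_pdiff: "pfun N f \<Longrightarrow> pfun N (pdiff i f)"
  using polyfun_pdiff unfolding pfun_def by blast

lemma pfun_var: "i < N \<Longrightarrow> pfun N (\<lambda>x. x i)"
  using polyfun_var unfolding pfun_def by blast

lemmas pfun_intros = pfun_const pfun_add pfun_diff pfun_uminus pfun_mult pfun_cmult pfun_power pfun_sum pfun_pdiff
  pfun_var pfun_prod_list

lemma pfun_pdiff_add: "pfun N f \<Longrightarrow> pfun N g \<Longrightarrow> pdiff i (\<lambda>x. f x + g x) = (\<lambda>x. pdiff i f x + pdiff i g x)"
  unfolding pfun_def using pdiff_add by blast

lemma pfun_pdiff_mult:
  "pfun N f \<Longrightarrow> pfun N g \<Longrightarrow> pdiff i (\<lambda>x. f x * g x) = (\<lambda>x. pdiff i f x * g x + f x * pdiff i g x)"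
  unfolding pfun_def using pdiff_mult by blast

lemma pfun_pdiff_cmult: "pfun N f \<Longrightarrow> pdiff i (\<lambda>x. c * f x) = (\<lambda>x. c * pdiff i f x)"
  unfolding pfun_def using pdiff_cmult by blast

lemma pfun_pdiff_commute: "pfun N f \<Longrightarrow> pdiff i (pdiff j f) = pdiff j (pdiff i f)"
  unfolding pfun_def using pdiff_commute by blast

text \<open>Minus the Ornstein--Uhlenbeck generator: the sum over \<open>i\<close> of the
  \<open>i\<close>-th derivative followed by its Gaussian adjoint. Its eigenspaces are the
  chaoses.\<close>

definition number_op :: "nat \<Rightarrow> ((nat \<Rightarrow> real) \<Rightarrow> real) \<Rightarrow> (nat \<Rightarrow> real) \<Rightarrow> real" where
  "number_op N f x = (\<Sum>i<N. x i * pdiff i f x - pdiff i (pdiff i f) x)"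

lemma pfun_number_op: "pfun N f \<Longrightarrow> pfun N (number_op N f)"
  unfolding number_op_def[abs_def] by (intro pfun_intros) auto

lemma number_op_const [simp]: "number_op N (\<lambda>x. c) = (\<lambda>x. 0)"
  by (simp add: number_op_def[abs_def])

lemma number_op_add:
  assumes "pfun N f" "pfun N g"
  shows "number_op N (\<lambda>x. f x + g x) = (\<lambda>x. number_op N f x + number_op N g x)"
  unfolding number_op_def[abs_def]
  unfolding pfun_pdiff_add[OF assms] pfun_pdiff_add[OF pfun_pdiff[OF assms(1)] pfun_pdiff[OF assms(2)]]
    sum.distrib[symmetric]
  by (intro ext sum.cong) (auto simp: algebra_simps)

text \<open>The commutator with multiplication by a coordinate, which drives the induction for the
  Euler identity below.\<close>

lemma number_op_var_mult:
  assumes "j < N" "pfun N f"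
  shows "number_op N (\<lambda>x. x j * f x) = (\<lambda>x. x j * number_op N f x + x j * f x - 2 * pdiff j f x)"
proof
  fix x
  have d: "pdiff i (\<lambda>x. x j * f x) = (\<lambda>x. (if i = j then 1 else 0) * f x + x j * pdiff i f x)" for i
    using pfun_pdiff_mult[OF pfun_var[OF assms(1)] assms(2)] by (simp add: pdiff_var)
  have dd: "pdiff i (pdiff i (\<lambda>x. x j * f x)) =
      (\<lambda>x. (if i = j then 2 else 0) * pdiff i f x + x j * pdiff i (pdiff i f) x)" for i
  proof -
    have "pdiff i (pdiff i (\<lambda>x. x j * f x)) =
      (\<lambda>x. (if i = j then 1 else 0) * pdiff i f x + pdiff i (\<lambda>x. x j * pdiff i f x) x)"
      unfolding d using assms
      by (subst pfun_pdiff_add[of N]) (auto intro!: pfun_intros simp: pfun_pdiff_cmult[of N])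
    also have "pdiff i (\<lambda>x. x j * pdiff i f x) =
        (\<lambda>x. (if i = j then 1 else 0) * pdiff i f x + x j * pdiff i (pdiff i f) x)"
      using pfun_pdiff_mult[OF pfun_var[OF assms(1)] pfun_pdiff[OF assms(2)]] by (simp add: pdiff_var)
    finally show ?thesis by (auto simp: fun_eq_iff)
  qed
  have "number_op N (\<lambda>x. x j * f x) x =
      (\<Sum>i<N. (if i = j then x j * f x - 2 * pdiff j f x else 0) +
        x j * (x i * pdiff i f x - pdiff i (pdiff i f) x))"
    unfolding number_op_def dd unfolding d by (intro sum.cong) (auto simp: algebra_simps)
  also have "\<dots> = (x j * f x - 2 * pdiff j f x) + x j * number_op N f x"
    using assms(1) by (simp add: sum.distrib number_op_def sum_distrib_left)
  finally show "number_op N (\<lambda>x. x j * f x) x = x j * number_op N f x + x j * f x - 2 * pdiff j f x"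
    by simp
qed

text \<open>Euler's identity for homogeneous functions: on the top-degree part, the number operator
  acts as multiplication by the degree.\<close>

lemma number_op_euler:
  "polyfun N d f \<Longrightarrow> polyfun N (d - 1) (\<lambda>x. number_op N f x - real d * f x)"
proof (induction rule: polyfun.induct)
  case (const d c)
  then show ?case by (simp add: polyfun.const)
next
  case (add d f g)
  from polyfun.add[OF add.IH] show ?case
    by (simp add: number_op_add[OF polyfun_imp_pfun[OF add.hyps(1)] polyfun_imp_pfun[OF add.hyps(2)]]
        algebra_simps)
next
  case (var_mult j d f)
  have "polyfun N d (\<lambda>x. x j * (number_op N f x - real d * f x))"
  proof (cases d)
    case 0
    then obtain c where "f = (\<lambda>x. c)" using var_mult polyfun_0 by blast
    then show ?thesis using 0 polyfun.const[of N d 0] by simp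
  next
    case (Suc d')
    then show ?thesis using var_mult by (auto intro: polyfun.var_mult)
  qed
  moreover have "polyfun N d (\<lambda>x. 2 * pdiff j f x)"
    by (intro polyfun_cmult polyfun_pdiff' var_mult)
  ultimately have "polyfun N d (\<lambda>x. x j * (number_op N f x - real d * f x) - 2 * pdiff j f x)"
    by (rule polyfun_diff)
  then show ?case
    by (simp add: number_op_var_mult[OF var_mult(1) polyfun_imp_pfun[OF var_mult(2)]] algebra_simps)
qed

lemma polyfun_number_op: "polyfun N d f \<Longrightarrow> polyfun N d (number_op N f)"
  using polyfun.add[OF polyfun_mono[OF number_op_euler] polyfun_cmult, of N d f d f "real d"] by simp

text \<open>No sign of \<open>c\<close> is assumed: a negative \<open>c\<close> is refuted by a
  large \<open>t\<close>, and \<open>c = 0\<close> forces \<open>b = 0\<close>. Besides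
  Cauchy--Schwarz this serves the near-minimiser argument in the ultraproduct, where
  \<open>a\<close> is a small slack.\<close>

lemma quadratic_nonneg_imp_discriminant:
  fixes a b c :: real
  assumes "\<And>t. 0 \<le> a + 2 * t * b + t\<^sup>2 * c"
  shows "b\<^sup>2 \<le> a * c"
proof (cases "c = 0")
  case True
  have "b = 0"
  proof (rule ccontr)
    assume "b \<noteq> 0"
    then show False using assms[of "- (a + 1) / (2 * b)"] True by (simp add: field_simps)
  qed
  then show ?thesis using True by simp
next
  case False
  have "c \<ge> 0"
  proof (rule ccontr)
    assume c: "\<not> c \<ge> 0"
    \<comment> \<open>Chosen with \<open>t \<ge> 1\<close> and \<open>t * (- c)\<close> larger than
      \<open>\<bar>a\<bar> + 2 * \<bar>b\<bar>\<close>.\<close>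
    define t where "t = 1 + (\<bar>a\<bar> + 2 * \<bar>b\<bar>) / (- c)"
    have "0 \<le> (\<bar>a\<bar> + 2 * \<bar>b\<bar>) / (- c)" using c by (intro divide_nonneg_nonneg) auto
    then have t: "t \<ge> 1" by (simp add: t_def)
    have tc: "t * (- c) = - c + \<bar>a\<bar> + 2 * \<bar>b\<bar>" using c by (simp add: t_def field_simps)
    have "t\<^sup>2 * (- c) = t * (t * (- c))" by (simp add: power2_eq_square)
    also have "\<dots> = t * (- c + \<bar>a\<bar> + 2 * \<bar>b\<bar>)" by (simp only: tc)
    also have "\<dots> \<ge> t * (- c) + \<bar>a\<bar> + 2 * t * \<bar>b\<bar>"
      using t mult_right_mono[OF t, of "\<bar>a\<bar>"] by (simp add: algebra_simps)
    finally have "t\<^sup>2 * (- c) \<ge> t * (- c) + \<bar>a\<bar> + 2 * t * \<bar>b\<bar>" .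
    moreover have "2 * t * b \<le> 2 * t * \<bar>b\<bar>" using t by (intro mult_left_mono) auto
    moreover have "0 < t * (- c)" using t c by (intro mult_pos_pos) auto
    moreover have "a \<le> \<bar>a\<bar>" by simp
    ultimately show False using assms[of t] by (simp add: algebra_simps)
  qed
  with False have "c > 0" by simp
  then show ?thesis using assms[of "- b / c"] by (simp add: field_simps power2_eq_square)
qed

section \<open>Orthogonal projections, chaos decomposition and spectral bounds\<close>

context gaussian_seq
begin

lemma Ex_padd: "pfun N f \<Longrightarrow> pfun N g \<Longrightarrow> Ex (\<lambda>x. f x + g x) = Ex f + Ex g"
  unfolding pfun_def using Ex_add by blast

lemma Ex_pdiff: "pfun N f \<Longrightarrow> pfun N g \<Longrightarrow> Ex (\<lambda>x. f x - g x) = Ex f - Ex g"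
  unfolding pfun_def using Ex_diff by blast

lemma Ex_psum: "(\<And>i. i \<in> I \<Longrightarrow> pfun N (f i)) \<Longrightarrow> Ex (\<lambda>x. \<Sum>i\<in>I. f i x) = (\<Sum>i\<in>I. Ex (f i))"
  unfolding pfun_def using Ex_sum by metis

lemma Ex_pmono: "pfun N f \<Longrightarrow> pfun N g \<Longrightarrow> (\<And>x. f x \<le> g x) \<Longrightarrow> Ex f \<le> Ex g"
  unfolding pfun_def using Ex_mono by metis

lemma Ex_pibp: "i < N \<Longrightarrow> pfun N f \<Longrightarrow> Ex (\<lambda>x. x i * f x) = Ex (pdiff i f)"
  unfolding pfun_def using gaussian_ibp by blast

lemma Ex_square_nonneg [simp]: "0 \<le> Ex (\<lambda>x. (f x)\<^sup>2)"
  by (rule Ex_nonneg) simp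

lemma Ex_cauchy_schwarz:
  assumes "pfun N f" "pfun N g"
  shows "(Ex (\<lambda>x. f x * g x))\<^sup>2 \<le> Ex (\<lambda>x. (f x)\<^sup>2) * Ex (\<lambda>x. (g x)\<^sup>2)"
proof (rule quadratic_nonneg_imp_discriminant)
  fix t :: real
  have "0 \<le> Ex (\<lambda>x. (f x + t * g x)\<^sup>2)" by simp
  also have "(\<lambda>x. (f x + t * g x)\<^sup>2) = (\<lambda>x. (f x)\<^sup>2 + ((2 * t) * (f x * g x) + t\<^sup>2 * (g x)\<^sup>2))"
    by (simp add: power2_sum power_mult_distrib algebra_simps)
  also have "Ex \<dots> = Ex (\<lambda>x. (f x)\<^sup>2) + Ex (\<lambda>x. (2 * t) * (f x * g x) + t\<^sup>2 * (g x)\<^sup>2)"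
    using assms by (intro Ex_padd[of N] pfun_intros)
  also have "Ex (\<lambda>x. (2 * t) * (f x * g x) + t\<^sup>2 * (g x)\<^sup>2) =
      Ex (\<lambda>x. (2 * t) * (f x * g x)) + Ex (\<lambda>x. t\<^sup>2 * (g x)\<^sup>2)"
    using assms by (intro Ex_padd[of N] pfun_intros)
  finally show "0 \<le> Ex (\<lambda>x. (f x)\<^sup>2) + 2 * t * Ex (\<lambda>x. f x * g x) + t\<^sup>2 * Ex (\<lambda>x. (g x)\<^sup>2)"
    by (simp only: Ex_cmult)
qed

lemma Ex_mult_eq_0:
  assumes "pfun N f" "pfun N g" "Ex (\<lambda>x. (f x)\<^sup>2) = 0"
  shows "Ex (\<lambda>x. f x * g x) = 0"
  using Ex_cauchy_schwarz[OF assms(1,2)] assms(3) by simp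

text \<open>The last conjunct says that \<open>h\<close> lies in the span of \<open>S\<close>, up to
  null functions, in the dual form that whatever is orthogonal to \<open>S\<close> is orthogonal to
  \<open>h\<close>. This lets the Gram--Schmidt induction run without linear combinations.\<close>

lemma ex_projection_finite:
  assumes "finite S" "\<And>g. g \<in> S \<Longrightarrow> polyfun N d g" "pfun N f"
  shows "\<exists>h. polyfun N d h \<and> (\<forall>g\<in>S. Ex (\<lambda>x. (f x - h x) * g x) = 0) \<and>
    (\<forall>u. pfun N u \<longrightarrow> (\<forall>g\<in>S. Ex (\<lambda>x. u x * g x) = 0) \<longrightarrow> Ex (\<lambda>x. u x * h x) = 0)"
  using assms
proof (induction S arbitrary: f rule: finite_induct)
  case empty
  show ?case by (rule exI[of _ "\<lambda>x. 0"]) (auto intro: polyfun.const)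
next
  case (insert g S)
  have g: "polyfun N d g" "pfun N g" using insert.prems polyfun_imp_pfun by auto
  obtain p where p: "polyfun N d p" "\<And>s. s \<in> S \<Longrightarrow> Ex (\<lambda>x. (g x - p x) * s x) = 0"
      "\<And>u. pfun N u \<Longrightarrow> (\<And>s. s \<in> S \<Longrightarrow> Ex (\<lambda>x. u x * s x) = 0) \<Longrightarrow> Ex (\<lambda>x. u x * p x) = 0"
    using insert.IH[of g] insert.prems g by auto
  obtain h where h: "polyfun N d h" "\<And>s. s \<in> S \<Longrightarrow> Ex (\<lambda>x. (f x - h x) * s x) = 0"
      "\<And>u. pfun N u \<Longrightarrow> (\<And>s. s \<in> S \<Longrightarrow> Ex (\<lambda>x. u x * s x) = 0) \<Longrightarrow> Ex (\<lambda>x. u x * h x) = 0"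
    using insert.IH[of f] insert.prems by auto
  have S: "s \<in> S \<Longrightarrow> pfun N s" for s using insert.prems polyfun_imp_pfun by blast
  note pf = polyfun_imp_pfun[OF p(1)] polyfun_imp_pfun[OF h(1)] g(2) \<open>pfun N f\<close>
  define g' where "g' = (\<lambda>x. g x - p x)"
  have g': "polyfun N d g'" "pfun N g'"
    using g p polyfun_imp_pfun by (auto simp: g'_def intro!: polyfun_diff pfun_diff)
  \<comment> \<open>If \<open>g'\<close> has zero second moment, division by zero gives
    \<open>t = 0\<close>, and orthogonality to \<open>g'\<close> comes from Cauchy--Schwarz.\<close>
  define t where "t = Ex (\<lambda>x. (f x - h x) * g' x) / Ex (\<lambda>x. (g' x)\<^sup>2)"
  define h' where "h' = (\<lambda>x. h x + t * g' x)"
  have h': "polyfun N d h'" "pfun N h'"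
    using g' h polyfun_imp_pfun by (auto simp: h'_def intro!: polyfun.add polyfun_cmult pfun_intros)
  have sub: "Ex (\<lambda>x. (f x - h' x) * s x) = Ex (\<lambda>x. (f x - h x) * s x) - t * Ex (\<lambda>x. g' x * s x)"
    if "pfun N s" for s
  proof -
    have "Ex (\<lambda>x. (f x - h' x) * s x) = Ex (\<lambda>x. (f x - h x) * s x - t * (g' x * s x))"
      by (simp add: h'_def algebra_simps)
    also have "\<dots> = Ex (\<lambda>x. (f x - h x) * s x) - Ex (\<lambda>x. t * (g' x * s x))"
      using pf g' that by (intro Ex_pdiff[of N] pfun_intros)
    finally show ?thesis by (simp only: Ex_cmult)
  qed
  have orth_S: "Ex (\<lambda>x. (f x - h' x) * s x) = 0" if "s \<in> S" for s
    using sub[OF S[OF that]] h(2)[OF that] p(2)[OF that] by (simp add: g'_def)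
  have "Ex (\<lambda>x. (f x - h' x) * g' x) = 0"
  proof (cases "Ex (\<lambda>x. (g' x)\<^sup>2) = 0")
    case True
    have "Ex (\<lambda>x. g' x * (f x - h' x)) = 0"
      using True g' h' pf by (intro Ex_mult_eq_0[of N] pfun_intros)
    then show ?thesis by (simp add: mult.commute)
  next
    case False
    then show ?thesis using sub[OF g'(2)] by (simp add: t_def power2_eq_square)
  qed
  moreover have "Ex (\<lambda>x. (f x - h' x) * p x) = 0"
    using pf h' by (intro p(3) orth_S pfun_intros)
  moreover have "Ex (\<lambda>x. (f x - h' x) * g' x) = Ex (\<lambda>x. (f x - h' x) * g x) - Ex (\<lambda>x. (f x - h' x) * p x)"
    unfolding g'_def right_diff_distrib using pf h' by (intro Ex_pdiff[of N] pfun_intros)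
  ultimately have orth_g: "Ex (\<lambda>x. (f x - h' x) * g x) = 0" by simp
  have "Ex (\<lambda>x. u x * h' x) = 0"
    if u: "pfun N u" "\<And>s. s \<in> insert g S \<Longrightarrow> Ex (\<lambda>x. u x * s x) = 0" for u
  proof -
    have "Ex (\<lambda>x. u x * h' x) = Ex (\<lambda>x. u x * h x + t * (u x * g x - u x * p x))"
      by (simp add: h'_def g'_def algebra_simps)
    also have "\<dots> = Ex (\<lambda>x. u x * h x) + Ex (\<lambda>x. t * (u x * g x - u x * p x))"
      using pf u by (intro Ex_padd[of N] pfun_intros)
    also have "Ex (\<lambda>x. t * (u x * g x - u x * p x)) = t * (Ex (\<lambda>x. u x * g x) - Ex (\<lambda>x. u x * p x))"
      using pf u by (subst Ex_cmult, subst Ex_pdiff[of N]) (auto intro!: pfun_intros)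
    finally show ?thesis using h(3)[of u] p(3)[of u] u by simp
  qed
  then show ?case using h' orth_S orth_g by (intro exI[of _ h']) auto
qed

text \<open>A monomial prefix again replaces the expansion into monomials; its degree and that of
  the remaining factor share the budget \<open>e\<close>.\<close>

lemma orth_monomials_imp_orth:
  assumes u: "pfun N u" "\<And>m. (\<Sum>j<N. m j) \<le> e \<Longrightarrow> Ex (\<lambda>x. u x * monomial_fun N m x) = 0"
    and "polyfun N e f"
  shows "Ex (\<lambda>x. u x * f x) = 0"
proof -
  have "Ex (\<lambda>x. u x * (monomial_fun N m x * f x)) = 0" if "(\<Sum>j<N. m j) + d \<le> e" "polyfun N d f" for m d
    using that(2,1)
  proof (induction arbitrary: m rule: polyfun.induct)
    case (const d c)
    have "(\<lambda>x. u x * (monomial_fun N m x * c)) = (\<lambda>x. c * (u x * monomial_fun N m x))"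
      by (simp add: fun_eq_iff)
    then show ?case using u(2)[of m] const by (simp add: Ex_cmult)
  next
    case (add d f g)
    have "Ex (\<lambda>x. u x * (monomial_fun N m x * (f x + g x))) =
      Ex (\<lambda>x. u x * (monomial_fun N m x * f x) + u x * (monomial_fun N m x * g x))"
      by (simp add: algebra_simps)
    also have "\<dots> = Ex (\<lambda>x. u x * (monomial_fun N m x * f x)) + Ex (\<lambda>x. u x * (monomial_fun N m x * g x))"
      using add.hyps u(1) polyfun_monomial_fun[of N m]
      by (intro Ex_padd[of N] pfun_mult) (auto intro: polyfun_imp_pfun)
    finally show ?case using add by simp
  next
    case (var_mult j d f)
    have "monomial_fun N m x * (x j * f x) = monomial_fun N (m(j := Suc (m j))) x * f x" for x
      using monomial_fun_var_mult[OF var_mult(1), of x m] by (metis mult.assoc mult.commute)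
    then have "(\<lambda>x. u x * (monomial_fun N m x * (x j * f x))) =
        (\<lambda>x. u x * (monomial_fun N (m(j := Suc (m j))) x * f x))" by presburger
    moreover have "(\<Sum>i<N. (m(j := Suc (m j))) i) = Suc (\<Sum>i<N. m i)"
    proof -
      have "(\<Sum>i\<in>{..<N} - {j}. (m(j := Suc (m j))) i) = (\<Sum>i\<in>{..<N} - {j}. m i)"
        by (intro sum.cong) auto
      then show ?thesis using var_mult(1) by (simp add: sum.remove[of "{..<N}" j])
    qed
    then have "Ex (\<lambda>x. u x * (monomial_fun N (m(j := Suc (m j))) x * f x)) = 0"
      using var_mult.prems by (intro var_mult.IH) linarith
    ultimately show ?case by presburger
  qed
  from this[of "\<lambda>_. 0" e] assms(3) show ?thesis by (simp add: monomial_fun_def)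
qed

lemma ex_projection:
  assumes "pfun N f"
  shows "\<exists>h. polyfun N d h \<and> (\<forall>g. polyfun N d g \<longrightarrow> Ex (\<lambda>x. (f x - h x) * g x) = 0)"
proof -
  define S where "S = monomial_fun N ` {m. (\<Sum>j<N. m j) \<le> d}"
  \<comment> \<open>\<open>monomial_fun N m\<close> depends on \<open>m\<close> only below
    \<open>N\<close>, where the degree bound limits each exponent by \<open>d\<close>; hence
    finitely many functions.\<close>
  have "S \<subseteq> monomial_fun N ` ({..<N} \<rightarrow>\<^sub>E {..d})"
  proof
    fix f assume "f \<in> S"
    then obtain m where m: "f = monomial_fun N m" "(\<Sum>j<N. m j) \<le> d" by (auto simp: S_def)
    have "f = monomial_fun N (restrict m {..<N})" by (auto simp: m monomial_fun_def fun_eq_iff)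
    moreover have "m j \<le> d" if "j < N" for j
      using m(2) member_le_sum[of j "{..<N}" m] that by simp
    then have "restrict m {..<N} \<in> {..<N} \<rightarrow>\<^sub>E {..d}" by auto
    ultimately show "f \<in> monomial_fun N ` ({..<N} \<rightarrow>\<^sub>E {..d})" by blast
  qed
  then have "finite S" by (rule finite_subset) (auto intro: finite_PiE)
  moreover have "polyfun N d g" if "g \<in> S" for g
    using that polyfun_mono[OF polyfun_monomial_fun] by (auto simp: S_def)
  ultimately obtain h where h: "polyfun N d h" "\<forall>g\<in>S. Ex (\<lambda>x. (f x - h x) * g x) = 0"
    using ex_projection_finite[of S N d f] assms by blast
  have "Ex (\<lambda>x. (f x - h x) * g x) = 0" if "polyfun N d g" for g
  proof (rule orth_monomials_imp_orth[OF _ _ that])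
    show "pfun N (\<lambda>x. f x - h x)" using assms polyfun_imp_pfun[OF h(1)] by (rule pfun_diff)
    show "Ex (\<lambda>x. (f x - h x) * monomial_fun N m x) = 0" if "(\<Sum>j<N. m j) \<le> d" for m
      using h(2) that unfolding S_def by blast
  qed
  then show ?thesis using h by blast
qed

text \<open>The homogeneous Wiener chaos of order \<open>q\<close> in the first \<open>N\<close>
  coordinates, described by orthogonality to lower degrees instead of Hermite polynomials.\<close>

definition chaos :: "nat \<Rightarrow> nat \<Rightarrow> ((nat \<Rightarrow> real) \<Rightarrow> real) \<Rightarrow> bool" where
  "chaos N q Z \<longleftrightarrow> polyfun N q Z \<and> (\<forall>k<q. \<forall>h. polyfun N k h \<longrightarrow> Ex (\<lambda>x. Z x * h x) = 0)"

lemma chaos_polyfun: "chaos N q Z \<Longrightarrow> polyfun N q Z"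
  and chaos_pfun: "chaos N q Z \<Longrightarrow> pfun N Z"
  and chaos_orth: "chaos N q Z \<Longrightarrow> polyfun N k h \<Longrightarrow> k < q \<Longrightarrow> Ex (\<lambda>x. Z x * h x) = 0"
  by (auto simp: chaos_def intro: polyfun_imp_pfun)

lemma chaos_decomposition:
  assumes "polyfun N (Suc d) f"
  obtains Z l where "chaos N (Suc d) Z" "polyfun N d l" "f = (\<lambda>x. Z x + l x)"
proof -
  obtain l where l: "polyfun N d l" "\<And>g. polyfun N d g \<Longrightarrow> Ex (\<lambda>x. (f x - l x) * g x) = 0"
    using ex_projection[of N f d] assms polyfun_imp_pfun by blast
  have "chaos N (Suc d) (\<lambda>x. f x - l x)"
    unfolding chaos_def
  proof (intro conjI allI impI)
    show "polyfun N (Suc d) (\<lambda>x. f x - l x)" by (intro polyfun_diff assms polyfun_Suc[OF l(1)])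
  qed (use l polyfun_mono[of N _ _ d] in auto)
  with l show ?thesis by (intro that[of "\<lambda>x. f x - l x" l]) auto
qed

text \<open>Integration by parts in each coordinate. The left side is symmetric in \<open>f\<close>
  and \<open>g\<close>, hence so is the number operator.\<close>

lemma dirichlet_form:
  assumes "pfun N f" "pfun N g"
  shows "(\<Sum>i<N. Ex (\<lambda>x. pdiff i f x * pdiff i g x)) = Ex (\<lambda>x. number_op N f x * g x)"
proof -
  have "Ex (\<lambda>x. number_op N f x * g x) =
      Ex (\<lambda>x. \<Sum>i<N. x i * (pdiff i f x * g x) - pdiff i (pdiff i f) x * g x)"
    by (simp add: number_op_def sum_distrib_right left_diff_distrib mult.assoc)
  also have "\<dots> = (\<Sum>i<N. Ex (\<lambda>x. x i * (pdiff i f x * g x) - pdiff i (pdiff i f) x * g x))"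
    using assms by (intro Ex_psum[of _ N] pfun_intros) auto
  also have "\<dots> = (\<Sum>i<N. Ex (\<lambda>x. pdiff i f x * pdiff i g x))"
  proof (intro sum.cong refl)
    fix i assume i: "i \<in> {..<N}"
    have "Ex (\<lambda>x. x i * (pdiff i f x * g x) - pdiff i (pdiff i f) x * g x) =
        Ex (\<lambda>x. x i * (pdiff i f x * g x)) - Ex (\<lambda>x. pdiff i (pdiff i f) x * g x)"
      using i assms by (intro Ex_pdiff[of N] pfun_intros) auto
    also have "Ex (\<lambda>x. x i * (pdiff i f x * g x)) = Ex (pdiff i (\<lambda>x. pdiff i f x * g x))"
      using i assms by (intro Ex_pibp[of _ N] pfun_intros) auto
    also have "pdiff i (\<lambda>x. pdiff i f x * g x) =
        (\<lambda>x. pdiff i (pdiff i f) x * g x + pdiff i f x * pdiff i g x)"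
      using assms by (intro pfun_pdiff_mult[of N] pfun_intros)
    also have "Ex \<dots> = Ex (\<lambda>x. pdiff i (pdiff i f) x * g x) + Ex (\<lambda>x. pdiff i f x * pdiff i g x)"
      using assms by (intro Ex_padd[of N] pfun_intros)
    finally show "Ex (\<lambda>x. x i * (pdiff i f x * g x) - pdiff i (pdiff i f) x * g x) =
        Ex (\<lambda>x. pdiff i f x * pdiff i g x)" by simp
  qed
  finally show ?thesis by simp
qed

lemma number_op_symmetric:
  assumes "pfun N f" "pfun N g"
  shows "Ex (\<lambda>x. number_op N f x * g x) = Ex (\<lambda>x. f x * number_op N g x)"
  using dirichlet_form[OF assms] dirichlet_form[OF assms(2,1)] by (simp add: mult.commute)

text \<open>By the Euler identity \<open>number_op N Z - q * Z\<close> has degree below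
  \<open>q\<close>. It is orthogonal to itself, because the operator is symmetric and preserves
  degrees while \<open>Z\<close> is orthogonal to lower degrees. So \<open>Z\<close> is an
  eigenvector in L2.\<close>

lemma chaos_eigen:
  assumes "chaos N q Z" "pfun N R"
  shows "(\<Sum>i<N. Ex (\<lambda>x. pdiff i Z x * pdiff i R x)) = real q * Ex (\<lambda>x. Z x * R x)"
proof (cases q)
  case 0
  then obtain c where "Z = (\<lambda>x. c)" using assms polyfun_0 by (auto simp: chaos_def)
  then show ?thesis using 0 by simp
next
  case (Suc p)
  note Z = chaos_pfun[OF assms(1)]
  define u where "u = (\<lambda>x. number_op N Z x - real q * Z x)"
  have u: "polyfun N p u"
    using number_op_euler[OF chaos_polyfun[OF assms(1)]] Suc by (simp add: u_def)
  have up: "pfun N u" using u by (rule polyfun_imp_pfun)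
  have *: "Ex (\<lambda>x. u x * h x) = Ex (\<lambda>x. number_op N Z x * h x) - real q * Ex (\<lambda>x. Z x * h x)"
    if h: "pfun N h" for h
  proof -
    have "Ex (\<lambda>x. u x * h x) = Ex (\<lambda>x. number_op N Z x * h x - real q * (Z x * h x))"
      by (simp add: u_def algebra_simps)
    also have "\<dots> = Ex (\<lambda>x. number_op N Z x * h x) - Ex (\<lambda>x. real q * (Z x * h x))"
      using h Z by (intro Ex_pdiff[of N] pfun_intros pfun_number_op)
    finally show ?thesis by (simp only: Ex_cmult)
  qed
  have "Ex (\<lambda>x. u x * u x) = 0"
    using *[OF up] chaos_orth[OF assms(1) u] chaos_orth[OF assms(1) polyfun_number_op[OF u]] Suc
    by (simp add: number_op_symmetric[OF Z up])
  then have "Ex (\<lambda>x. u x * R x) = 0"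
    using up assms(2) by (intro Ex_mult_eq_0[of N]) (auto simp: power2_eq_square)
  then show ?thesis using *[OF assms(2)] dirichlet_form[OF Z assms(2)] by simp
qed

text \<open>Integration by parts moves the pairing with \<open>h\<close> to pairings of
  \<open>Z\<close> with \<open>x i * h\<close> and with a derivative of \<open>h\<close>; both have
  degree below \<open>q\<close>.\<close>

lemma chaos_pdiff:
  assumes "chaos N q Z" "i < N"
  shows "chaos N (q - 1) (pdiff i Z)"
  unfolding chaos_def
proof (intro conjI allI impI)
  show "polyfun N (q - 1) (pdiff i Z)" by (rule polyfun_pdiff[OF chaos_polyfun[OF assms(1)]])
  fix k h assume k: "k < q - 1" and h: "polyfun N k h"
  note Z = chaos_pfun[OF assms(1)] and hp = polyfun_imp_pfun[OF h]
  have "Ex (\<lambda>x. Z x * (x i * h x)) = Ex (\<lambda>x. x i * (Z x * h x))" by (simp add: mult.left_commute)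
  also have "\<dots> = Ex (pdiff i (\<lambda>x. Z x * h x))"
    using assms Z hp by (intro Ex_pibp[of _ N] pfun_intros) auto
  also have "pdiff i (\<lambda>x. Z x * h x) = (\<lambda>x. pdiff i Z x * h x + Z x * pdiff i h x)"
    using Z hp by (rule pfun_pdiff_mult)
  also have "Ex \<dots> = Ex (\<lambda>x. pdiff i Z x * h x) + Ex (\<lambda>x. Z x * pdiff i h x)"
    using Z hp by (intro Ex_padd[of N] pfun_intros)
  also have "Ex (\<lambda>x. Z x * pdiff i h x) = 0"
    using chaos_orth[OF assms(1) polyfun_pdiff'[OF h]] k by simp
  also have "Ex (\<lambda>x. Z x * (x i * h x)) = 0"
    using chaos_orth[OF assms(1) polyfun.var_mult[OF assms(2) h]] k by simp
  finally show "Ex (\<lambda>x. pdiff i Z x * h x) = 0" by simp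
qed

lemma Ex_square_chaos_decomposition:
  assumes "chaos N (Suc d) Z" "polyfun N d l"
  shows "Ex (\<lambda>x. (Z x + l x)\<^sup>2) = Ex (\<lambda>x. (Z x)\<^sup>2) + Ex (\<lambda>x. (l x)\<^sup>2)"
proof -
  note Z = chaos_pfun[OF assms(1)] and l = polyfun_imp_pfun[OF assms(2)]
  have "Ex (\<lambda>x. (Z x + l x)\<^sup>2) = Ex (\<lambda>x. (Z x)\<^sup>2 + (2 * (Z x * l x) + (l x)\<^sup>2))"
    by (simp add: power2_sum algebra_simps)
  also have "\<dots> = Ex (\<lambda>x. (Z x)\<^sup>2) + Ex (\<lambda>x. 2 * (Z x * l x) + (l x)\<^sup>2)"
    using Z l by (intro Ex_padd[of N] pfun_intros)
  also have "Ex (\<lambda>x. 2 * (Z x * l x) + (l x)\<^sup>2) = Ex (\<lambda>x. 2 * (Z x * l x)) + Ex (\<lambda>x. (l x)\<^sup>2)"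
    using Z l by (intro Ex_padd[of N] pfun_intros)
  also have "Ex (\<lambda>x. 2 * (Z x * l x)) = 0"
    using chaos_orth[OF assms(1,2)] by (simp add: Ex_cmult)
  finally show ?thesis by simp
qed

text \<open>The largest eigenvalue in degree \<open>d\<close> is \<open>d\<close>. On the top chaos
  the Dirichlet form is exact, and its cross term with the lower part vanishes.\<close>

lemma energy_le:
  "polyfun N d f \<Longrightarrow> (\<Sum>i<N. Ex (\<lambda>x. (pdiff i f x)\<^sup>2)) \<le> real d * Ex (\<lambda>x. (f x)\<^sup>2)"
proof (induction d arbitrary: f)
  case 0
  then show ?case by (simp add: pdiff_0)
next
  case (Suc d)
  obtain Z l where Zl: "chaos N (Suc d) Z" "polyfun N d l" "f = (\<lambda>x. Z x + l x)"
    using chaos_decomposition[OF Suc.prems] .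
  note Z = chaos_pfun[OF Zl(1)] and l = polyfun_imp_pfun[OF Zl(2)]
  have "Ex (\<lambda>x. (pdiff i f x)\<^sup>2) = Ex (\<lambda>x. pdiff i Z x * pdiff i Z x) +
      (2 * Ex (\<lambda>x. pdiff i Z x * pdiff i l x) + Ex (\<lambda>x. (pdiff i l x)\<^sup>2))" for i
  proof -
    have "Ex (\<lambda>x. (pdiff i f x)\<^sup>2) = Ex (\<lambda>x. pdiff i Z x * pdiff i Z x +
      (2 * (pdiff i Z x * pdiff i l x) + (pdiff i l x)\<^sup>2))"
      by (simp add: Zl(3) pfun_pdiff_add[OF Z l] power2_sum power2_eq_square algebra_simps)
    also have "\<dots> = Ex (\<lambda>x. pdiff i Z x * pdiff i Z x) +
        Ex (\<lambda>x. 2 * (pdiff i Z x * pdiff i l x) + (pdiff i l x)\<^sup>2)"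
      using Z l by (intro Ex_padd[of N] pfun_intros)
    also have "Ex (\<lambda>x. 2 * (pdiff i Z x * pdiff i l x) + (pdiff i l x)\<^sup>2) =
        Ex (\<lambda>x. 2 * (pdiff i Z x * pdiff i l x)) + Ex (\<lambda>x. (pdiff i l x)\<^sup>2)"
      using Z l by (intro Ex_padd[of N] pfun_intros)
    finally show ?thesis by (simp only: Ex_cmult)
  qed
  then have "(\<Sum>i<N. Ex (\<lambda>x. (pdiff i f x)\<^sup>2)) =
      real (Suc d) * Ex (\<lambda>x. Z x * Z x) + (2 * (real (Suc d) * Ex (\<lambda>x. Z x * l x)) +
        (\<Sum>i<N. Ex (\<lambda>x. (pdiff i l x)\<^sup>2)))"
    using chaos_eigen[OF Zl(1) Z] chaos_eigen[OF Zl(1) l]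
    by (simp add: sum.distrib sum_distrib_left[symmetric])
  also have "Ex (\<lambda>x. Z x * l x) = 0" using chaos_orth[OF Zl(1,2)] by simp
  also have "(\<Sum>i<N. Ex (\<lambda>x. (pdiff i l x)\<^sup>2)) \<le> real d * Ex (\<lambda>x. (l x)\<^sup>2)"
    by (rule Suc.IH[OF Zl(2)])
  finally have "(\<Sum>i<N. Ex (\<lambda>x. (pdiff i f x)\<^sup>2)) \<le>
      real (Suc d) * Ex (\<lambda>x. (Z x)\<^sup>2) + real d * Ex (\<lambda>x. (l x)\<^sup>2)"
    by (simp add: power2_eq_square)
  also have "\<dots> \<le> real (Suc d) * Ex (\<lambda>x. (f x)\<^sup>2)"
    unfolding Zl(3) Ex_square_chaos_decomposition[OF Zl(1,2)]
    by (simp add: algebra_simps)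
  finally show ?case .
qed

text \<open>Cauchy--Schwarz on each pair of summands passes fourth moment bounds to sums of squares
  without loss in the number of summands, as gradients in arbitrarily many variables
  require.\<close>

lemma Ex_square_sum_squares_le:
  assumes "\<And>i. i \<in> I \<Longrightarrow> pfun N (f i)"
    and "\<And>i. i \<in> I \<Longrightarrow> Ex (\<lambda>x. f i x ^ 4) \<le> C * (Ex (\<lambda>x. (f i x)\<^sup>2))\<^sup>2" "0 \<le> C"
    and "\<And>j. j \<in> J \<Longrightarrow> pfun N (g j)"
    and "\<And>j. j \<in> J \<Longrightarrow> Ex (\<lambda>x. g j x ^ 4) \<le> D * (Ex (\<lambda>x. (g j x)\<^sup>2))\<^sup>2" "0 \<le> D"
  shows "Ex (\<lambda>x. (\<Sum>i\<in>I. (f i x)\<^sup>2) * (\<Sum>j\<in>J. (g j x)\<^sup>2)) \<le>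
    sqrt (C * D) * (\<Sum>i\<in>I. Ex (\<lambda>x. (f i x)\<^sup>2)) * (\<Sum>j\<in>J. Ex (\<lambda>x. (g j x)\<^sup>2))"
proof -
  have "Ex (\<lambda>x. (\<Sum>i\<in>I. (f i x)\<^sup>2) * (\<Sum>j\<in>J. (g j x)\<^sup>2)) =
      Ex (\<lambda>x. \<Sum>i\<in>I. \<Sum>j\<in>J. (f i x)\<^sup>2 * (g j x)\<^sup>2)"
    by (simp add: sum_product)
  also have "\<dots> = (\<Sum>i\<in>I. Ex (\<lambda>x. \<Sum>j\<in>J. (f i x)\<^sup>2 * (g j x)\<^sup>2))"
    using assms(1,4) by (intro Ex_psum[of _ N] pfun_intros) auto
  also have "\<dots> = (\<Sum>i\<in>I. \<Sum>j\<in>J. Ex (\<lambda>x. (f i x)\<^sup>2 * (g j x)\<^sup>2))"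
    using assms(1,4) by (intro sum.cong refl Ex_psum[of _ N] pfun_intros) auto
  also have "\<dots> \<le> (\<Sum>i\<in>I. \<Sum>j\<in>J. sqrt (C * D) * Ex (\<lambda>x. (f i x)\<^sup>2) * Ex (\<lambda>x. (g j x)\<^sup>2))"
  proof (intro sum_mono)
    fix i j assume ij: "i \<in> I" "j \<in> J"
    have "(Ex (\<lambda>x. (f i x)\<^sup>2 * (g j x)\<^sup>2))\<^sup>2 \<le> Ex (\<lambda>x. ((f i x)\<^sup>2)\<^sup>2) * Ex (\<lambda>x. ((g j x)\<^sup>2)\<^sup>2)"
      using ij assms(1,4) by (intro Ex_cauchy_schwarz[of N] pfun_intros) auto
    also have "\<dots> = Ex (\<lambda>x. f i x ^ 4) * Ex (\<lambda>x. g j x ^ 4)" by (simp add: power_mult[symmetric])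
    also have "\<dots> \<le> (C * (Ex (\<lambda>x. (f i x)\<^sup>2))\<^sup>2) * (D * (Ex (\<lambda>x. (g j x)\<^sup>2))\<^sup>2)"
      using ij assms(2,3,5,6) by (intro mult_mono) (auto intro!: Ex_nonneg)
    also have "\<dots> = (sqrt (C * D) * Ex (\<lambda>x. (f i x)\<^sup>2) * Ex (\<lambda>x. (g j x)\<^sup>2))\<^sup>2"
      using assms(3,6) by (simp add: power_mult_distrib)
    finally show "Ex (\<lambda>x. (f i x)\<^sup>2 * (g j x)\<^sup>2) \<le> sqrt (C * D) * Ex (\<lambda>x. (f i x)\<^sup>2) * Ex (\<lambda>x. (g j x)\<^sup>2)"
      by (rule power2_le_imp_le) (use assms(3,6) in simp)
  qed
  also have "\<dots> = sqrt (C * D) * (\<Sum>i\<in>I. Ex (\<lambda>x. (f i x)\<^sup>2)) * (\<Sum>j\<in>J. Ex (\<lambda>x. (g j x)\<^sup>2))"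
    unfolding mult.assoc sum_product by (simp only: sum_distrib_left)
  finally show ?thesis .
qed

text \<open>On a chaos, integration by parts turns the fourth moment into
  \<open>3/q\<close> times \<open>E[Z\<^sup>2 |DZ|\<^sup>2]\<close>, and the derivatives have smaller degree.\<close>

theorem hypercontractivity:
  "polyfun N d f \<Longrightarrow> Ex (\<lambda>x. f x ^ 4) \<le> 72 ^ d * (Ex (\<lambda>x. (f x)\<^sup>2))\<^sup>2"
proof (induction d arbitrary: f)
  case 0
  then obtain c where "f = (\<lambda>x. c)" using polyfun_0 by blast
  then show ?case by (simp add: power_mult[symmetric])
next
  case (Suc d)
  obtain Z l where Zl: "chaos N (Suc d) Z" "polyfun N d l" "f = (\<lambda>x. Z x + l x)"
    using chaos_decomposition[OF Suc.prems] .
  note Z = chaos_pfun[OF Zl(1)] and l = polyfun_imp_pfun[OF Zl(2)]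
  define S where "S = (\<lambda>x. \<Sum>i<N. (pdiff i Z x)\<^sup>2)"
  have Sp: "pfun N S" unfolding S_def using Z by (intro pfun_intros)
  have "Ex (\<lambda>x. (S x)\<^sup>2) \<le> sqrt (72 ^ d * 72 ^ d) * (\<Sum>i<N. Ex (\<lambda>x. (pdiff i Z x)\<^sup>2)) * (\<Sum>i<N. Ex (\<lambda>x. (pdiff i Z x)\<^sup>2))"
    unfolding S_def power2_eq_square[of "sum _ _"]
    using Z polyfun_pdiff[OF chaos_polyfun[OF Zl(1)]]
    by (intro Ex_square_sum_squares_le[of _ N] Suc.IH pfun_intros) auto
  also have "sqrt (72 ^ d * 72 ^ d) = (72::real) ^ d" by simp
  also have "(\<Sum>i<N. Ex (\<lambda>x. (pdiff i Z x)\<^sup>2)) = real (Suc d) * Ex (\<lambda>x. (Z x)\<^sup>2)"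
    using chaos_eigen[OF Zl(1) Z] by (simp add: power2_eq_square)
  finally have S2: "Ex (\<lambda>x. (S x)\<^sup>2) \<le> 72 ^ d * (real (Suc d) * Ex (\<lambda>x. (Z x)\<^sup>2))\<^sup>2"
    by (simp add: power2_eq_square mult.assoc)
  have "real (Suc d) * Ex (\<lambda>x. Z x ^ 4) = real (Suc d) * Ex (\<lambda>x. Z x * Z x ^ 3)"
    by (simp add: power3_eq_cube power4_eq_xxxx mult.assoc)
  also have "\<dots> = (\<Sum>i<N. Ex (\<lambda>x. pdiff i Z x * pdiff i (\<lambda>x. Z x ^ 3) x))"
    using Z by (intro chaos_eigen[OF Zl(1), symmetric] pfun_intros)
  also have "\<dots> = (\<Sum>i<N. Ex (\<lambda>x. 3 * ((Z x)\<^sup>2 * (pdiff i Z x)\<^sup>2)))"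
  proof -
    have "pdiff i (\<lambda>x. Z x * (Z x * Z x)) = (\<lambda>x. 3 * ((Z x)\<^sup>2 * pdiff i Z x))" for i
      by (subst pfun_pdiff_mult[OF Z pfun_mult[OF Z Z]], subst pfun_pdiff_mult[OF Z Z])
        (simp add: power2_eq_square fun_eq_iff algebra_simps)
    then have "pdiff i (\<lambda>x. Z x ^ 3) = (\<lambda>x. 3 * ((Z x)\<^sup>2 * pdiff i Z x))" for i
      by (simp add: power3_eq_cube mult.assoc)
    then show ?thesis by (simp add: power2_eq_square mult_ac)
  qed
  also have "\<dots> = (\<Sum>i<N. 3 * Ex (\<lambda>x. (Z x)\<^sup>2 * (pdiff i Z x)\<^sup>2))" by (simp only: Ex_cmult)
  also have "\<dots> = 3 * Ex (\<lambda>x. (Z x)\<^sup>2 * S x)"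
    unfolding S_def sum_distrib_left[symmetric]
    using Z by (subst Ex_psum[symmetric, of _ N]) (auto intro!: pfun_intros simp: sum_distrib_left)
  finally have eq: "real (Suc d) * Ex (\<lambda>x. Z x ^ 4) = 3 * Ex (\<lambda>x. (Z x)\<^sup>2 * S x)" .
  define z where "z = Ex (\<lambda>x. Z x ^ 4)"
  define s where "s = Ex (\<lambda>x. (Z x)\<^sup>2)"
  have z0: "0 \<le> z" "0 \<le> s" unfolding z_def s_def by (auto intro: Ex_nonneg)
  have "(Ex (\<lambda>x. (Z x)\<^sup>2 * S x))\<^sup>2 \<le> Ex (\<lambda>x. ((Z x)\<^sup>2)\<^sup>2) * Ex (\<lambda>x. (S x)\<^sup>2)"
    using Z Sp by (intro Ex_cauchy_schwarz[of N] pfun_intros)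
  also have "\<dots> = z * Ex (\<lambda>x. (S x)\<^sup>2)" by (simp add: z_def power_mult[symmetric])
  also have "\<dots> \<le> z * (72 ^ d * (real (Suc d) * s)\<^sup>2)"
    using S2 z0 by (intro mult_left_mono) (auto simp: s_def)
  finally have "(real (Suc d) * z)\<^sup>2 \<le> 9 * (z * (72 ^ d * (real (Suc d) * s)\<^sup>2))"
    unfolding z_def eq by (simp add: power_mult_distrib)
  then have "(real (Suc d))\<^sup>2 * (z * z) \<le> (real (Suc d))\<^sup>2 * (9 * (z * (72 ^ d * s\<^sup>2)))"
    by (simp add: power_mult_distrib power2_eq_square mult_ac)
  then have "z * z \<le> z * (9 * (72 ^ d * s\<^sup>2))"
    by (subst (asm) mult_le_cancel_left_pos) (auto simp: mult_ac)
  \<comment> \<open>The 9 is the square of the 3 that comes from differentiating the cube.\<close>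
  then have z: "z \<le> 9 * (72 ^ d * s\<^sup>2)"
    using z0 by (cases "z = 0") (auto simp: mult_le_cancel_left)
  \<comment> \<open>The fourth power of the sum \<open>Z + l\<close> costs a factor 8; with the 9
    above this explains the base 72.\<close>
  have "Ex (\<lambda>x. f x ^ 4) \<le> Ex (\<lambda>x. 8 * (Z x ^ 4 + l x ^ 4))"
  proof (rule Ex_pmono[of N])
    fix x
    have "(Z x + l x)\<^sup>2 \<le> 2 * ((Z x)\<^sup>2 + (l x)\<^sup>2)"
      using sum_squares_bound[of "Z x" "l x"] by (simp add: power2_sum)
    then have "((Z x + l x)\<^sup>2)\<^sup>2 \<le> (2 * ((Z x)\<^sup>2 + (l x)\<^sup>2))\<^sup>2" by (intro power_mono) auto
    also have "\<dots> \<le> 8 * (((Z x)\<^sup>2)\<^sup>2 + ((l x)\<^sup>2)\<^sup>2)"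
      using sum_squares_bound[of "(Z x)\<^sup>2" "(l x)\<^sup>2"] by (simp add: power2_sum power_mult_distrib)
    finally show "f x ^ 4 \<le> 8 * (Z x ^ 4 + l x ^ 4)" by (simp add: Zl(3) power_mult[symmetric])
  qed (use Z l in \<open>auto simp: Zl(3) intro!: pfun_intros\<close>)
  also have "\<dots> = 8 * (z + Ex (\<lambda>x. l x ^ 4))"
    using Z l by (subst Ex_cmult, subst Ex_padd[of N]) (auto simp: z_def intro!: pfun_intros)
  also have "\<dots> \<le> 8 * (9 * (72 ^ d * s\<^sup>2) + 72 ^ d * (Ex (\<lambda>x. (l x)\<^sup>2))\<^sup>2)"
    using z Suc.IH[OF Zl(2)] by simp
  also have "\<dots> \<le> 72 ^ Suc d * (s\<^sup>2 + (Ex (\<lambda>x. (l x)\<^sup>2))\<^sup>2)"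
    by (simp add: algebra_simps)
  also have "\<dots> \<le> 72 ^ Suc d * (s + Ex (\<lambda>x. (l x)\<^sup>2))\<^sup>2"
    using z0 by (intro mult_left_mono) (auto simp: power2_sum)
  also have "s + Ex (\<lambda>x. (l x)\<^sup>2) = Ex (\<lambda>x. (f x)\<^sup>2)"
    unfolding Zl(3) s_def Ex_square_chaos_decomposition[OF Zl(1,2)] ..
  finally show ?case .
qed

text \<open>The preceding pair estimate with one summand on each side: on bounded degrees,
  multiplication is continuous in L2.\<close>

lemma Ex_square_mult_le:
  assumes "polyfun N d f" "polyfun N e g"
  shows "Ex (\<lambda>x. (f x * g x)\<^sup>2) \<le> 72 ^ (d + e) * Ex (\<lambda>x. (f x)\<^sup>2) * Ex (\<lambda>x. (g x)\<^sup>2)"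
proof -
  have "Ex (\<lambda>x. (\<Sum>i\<in>{()}. (f x)\<^sup>2) * (\<Sum>i\<in>{()}. (g x)\<^sup>2)) \<le>
    sqrt (72 ^ d * 72 ^ e) * (\<Sum>i\<in>{()}. Ex (\<lambda>x. (f x)\<^sup>2)) * (\<Sum>j\<in>{()}. Ex (\<lambda>x. (g x)\<^sup>2))"
    by (intro Ex_square_sum_squares_le[of _ N] hypercontractivity[OF assms(1)]
        hypercontractivity[OF assms(2)] polyfun_imp_pfun[OF assms(1)] polyfun_imp_pfun[OF assms(2)]) auto
  also have "\<dots> \<le> 72 ^ (d + e) * (\<Sum>i\<in>{()}. Ex (\<lambda>x. (f x)\<^sup>2)) * (\<Sum>j\<in>{()}. Ex (\<lambda>x. (g x)\<^sup>2))"
  proof (intro mult_right_mono)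
    have "(72::real) ^ (d + e) \<le> (72 ^ (d + e))\<^sup>2"
      unfolding power2_eq_square by (simp add: mult_le_cancel_left1)
    then show "sqrt (72 ^ d * 72 ^ e) \<le> 72 ^ (d + e)"
      by (intro real_le_lsqrt) (auto simp: power_add)
  qed auto
  finally show ?thesis by (simp add: power_mult_distrib)
qed

end

section \<open>Irreducible chaos elements satisfy Isserlis' recursion asymptotically\<close>

fun pdiffs :: "nat list \<Rightarrow> ((nat \<Rightarrow> real) \<Rightarrow> real) \<Rightarrow> (nat \<Rightarrow> real) \<Rightarrow> real" where
  "pdiffs [] f = f"
| "pdiffs (i # is) f = pdiffs is (pdiff i f)"

lemma polyfun_pdiffs: "polyfun N d f \<Longrightarrow> polyfun N (d - length is) (pdiffs is f)"
proof (induction "is" arbitrary: d f)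
  case (Cons i "is")
  show ?case using Cons.IH[OF polyfun_pdiff[OF Cons.prems]] by simp
qed simp

lemma polyfun_pdiffs': "polyfun N d f \<Longrightarrow> polyfun N d (pdiffs is f)"
  by (rule polyfun_mono[OF polyfun_pdiffs]) auto

lemma pfun_pdiffs: "pfun N f \<Longrightarrow> pfun N (pdiffs is f)"
  using polyfun_pdiffs' unfolding pfun_def by blast

lemma pdiffs_add:
  "pfun N f \<Longrightarrow> pfun N g \<Longrightarrow> pdiffs is (\<lambda>x. f x + g x) = (\<lambda>x. pdiffs is f x + pdiffs is g x)"
  by (induction "is" arbitrary: f g) (simp_all add: pfun_pdiff_add pfun_pdiff)

lemma pdiffs_const: "is \<noteq> [] \<Longrightarrow> pdiffs is (\<lambda>x. c) = (\<lambda>x. 0)"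
proof (induction "is" arbitrary: c)
  case (Cons i "is")
  then show ?case by (cases "is = []") auto
qed simp

lemma pdiffs_pdiff_commute: "pfun N f \<Longrightarrow> pdiffs is (pdiff i f) = pdiff i (pdiffs is f)"
  by (induction "is" arbitrary: f) (simp_all add: pfun_pdiff_commute[of N _ _ i] pfun_pdiff)

lemma pdiffs_append: "pdiffs (xs @ ys) f = pdiffs ys (pdiffs xs f)"
  by (induction xs arbitrary: f) auto

text \<open>Tuples keep order and repetition, so a tensor of order \<open>q\<close> is a function on
  this set and sums over derivatives carry no multinomial weights.\<close>

definition index_lists :: "nat \<Rightarrow> nat \<Rightarrow> nat list set" where
  "index_lists N q = {is. set is \<subseteq> {..<N} \<and> length is = q}"

lemma finite_index_lists [simp]: "finite (index_lists N q)"
  unfolding index_lists_def by (rule finite_lists_length_eq) simp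

lemma index_lists_0 [simp]: "index_lists N 0 = {[]}"
  by (auto simp: index_lists_def)

lemma sum_index_lists_Suc:
  "(\<Sum>is\<in>index_lists N (Suc q). F is) = (\<Sum>i<N. \<Sum>is\<in>index_lists N q. F (i # is))"
proof -
  have eq: "index_lists N (Suc q) = (\<lambda>(i, is). i # is) ` ({..<N} \<times> index_lists N q)"
    by (auto simp: index_lists_def image_iff length_Suc_conv)
  have "inj_on (\<lambda>(i, is). i # is) ({..<N} \<times> index_lists N q)" by (auto simp: inj_on_def)
  then have "(\<Sum>is\<in>index_lists N (Suc q). F is) = (\<Sum>(i, is)\<in>{..<N} \<times> index_lists N q. F (i # is))"
    unfolding eq by (subst sum.reindex) (auto simp: case_prod_beta)
  then show ?thesis by (simp add: sum.cartesian_product)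
qed

text \<open>A boolean list is a mask on the slots of a tuple; the mask and its negation give the two
  index groups of a flattening.\<close>

fun select :: "bool list \<Rightarrow> nat list \<Rightarrow> nat list" where
  "select (b # bs) (i # is) = (if b then i # select bs is else select bs is)"
| "select _ _ = []"

lemma sum_bool_lists_Suc:
  "(\<Sum>bs | length bs = Suc n. F bs) = (\<Sum>bs | length bs = n. F (True # bs) + F (False # bs))"
proof -
  have eq: "{bs :: bool list. length bs = Suc n} = (#) True ` {bs. length bs = n} \<union> (#) False ` {bs. length bs = n}"
    by (auto simp: image_iff length_Suc_conv)
  have fin: "finite {bs :: bool list. length bs = n}"
    using finite_lists_length_eq[of "UNIV :: bool set" n] by simp
  show ?thesis
    unfolding eq by (subst sum.union_disjoint) (auto simp: fin sum.reindex sum.distrib)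
qed

lemma finite_bool_lists [simp]: "finite {bs :: bool list. length bs = n}"
  using finite_lists_length_eq[of "UNIV :: bool set" n] by simp

text \<open>Iterated product rule: the mask records which derivatives fall on the first
  factor.\<close>

lemma pdiffs_mult:
  assumes "pfun N f" "pfun N g"
  shows "pdiffs is (\<lambda>x. f x * g x) =
    (\<lambda>x. \<Sum>bs | length bs = length is. pdiffs (select bs is) f x * pdiffs (select (map Not bs) is) g x)"
  using assms
proof (induction "is" arbitrary: f g)
  case (Cons i "is")
  have "pdiffs (i # is) (\<lambda>x. f x * g x) =
      pdiffs is (\<lambda>x. pdiff i f x * g x + f x * pdiff i g x)"
    using pfun_pdiff_mult[OF Cons.prems] by simp
  also have "\<dots> = (\<lambda>x. pdiffs is (\<lambda>x. pdiff i f x * g x) x + pdiffs is (\<lambda>x. f x * pdiff i g x) x)"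
    using Cons.prems by (intro pdiffs_add[of N] pfun_intros)
  finally show ?case
    using Cons.IH[of "pdiff i f" g] Cons.IH[of f "pdiff i g"] Cons.prems
    by (simp add: sum_bool_lists_Suc sum.distrib pfun_pdiff)
qed simp

text \<open>For a fixed mask, a tuple and its two selected parts determine each other.\<close>

lemma sum_select:
  "(\<Sum>is\<in>index_lists N (length bs). w (select bs is) (select (map Not bs) is)) =
   (\<Sum>js\<in>index_lists N (length (filter id bs)). \<Sum>ls\<in>index_lists N (length (filter Not bs)). w js ls)"
proof (induction bs arbitrary: w)
  case (Cons b bs)
  show ?case
  proof (cases b)
    case True
    then show ?thesis using Cons.IH[of "\<lambda>js. w (_ # js)"] by (simp add: sum_index_lists_Suc)
  next
    case False
    have "(\<Sum>is\<in>index_lists N (length (b # bs)). w (select (b # bs) is) (select (map Not (b # bs)) is)) =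
      (\<Sum>i<N. \<Sum>is\<in>index_lists N (length bs). w (select bs is) (i # select (map Not bs) is))"
      using False by (simp add: sum_index_lists_Suc)
    also have "\<dots> = (\<Sum>i<N. \<Sum>js\<in>index_lists N (length (filter id bs)).
        \<Sum>ls\<in>index_lists N (length (filter Not bs)). w js (i # ls))"
      by (intro sum.cong refl Cons.IH)
    also have "\<dots> = (\<Sum>js\<in>index_lists N (length (filter id bs)). \<Sum>i<N.
        \<Sum>ls\<in>index_lists N (length (filter Not bs)). w js (i # ls))"
      by (rule sum.swap)
    finally show ?thesis using False by (simp add: sum_index_lists_Suc id_def)
  qed
qed simp

text \<open>Derivatives commute; for a chaos element this is the symmetry of its kernel.\<close>

lemma pdiffs_select:
  "pfun N f \<Longrightarrow> length bs = length is \<Longrightarrow> pdiffs (select bs is @ select (map Not bs) is) f = pdiffs is f"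
proof (induction bs "is" arbitrary: f rule: list_induct2')
  case (4 b bs i "is")
  show ?case
  proof (cases b)
    case True
    then show ?thesis using 4 by (simp add: pfun_pdiff)
  next
    case False
    then show ?thesis
      using 4 by (simp add: pdiffs_append pdiffs_pdiff_commute[symmetric, of N] pfun_pdiff)
  qed
qed auto

lemma select_const:
  "length is = n \<Longrightarrow> select (replicate n True) is = is"
  "length is = n \<Longrightarrow> select (replicate n False) is = []"
  by (induction "is" arbitrary: n) auto

lemma filter_mask_length:
  "length (filter id bs) + length (filter Not bs) = length bs"
  by (induction bs) auto

lemma filter_mask_eq_0:
  "length (filter id bs) = 0 \<Longrightarrow> bs = replicate (length bs) False"
  "length (filter Not bs) = 0 \<Longrightarrow> bs = replicate (length bs) True"
  by (induction bs) (auto split: if_splits)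

definition list_monomial :: "nat list \<Rightarrow> (nat \<Rightarrow> real) \<Rightarrow> real" where
  "list_monomial is x = prod_list (map x is)"

lemma polyfun_list_monomial: "set is \<subseteq> {..<N} \<Longrightarrow> polyfun N (length is) (list_monomial is)"
  unfolding list_monomial_def[abs_def]
  by (induction "is") (auto intro: polyfun.intros)

lemma list_monomial_append: "list_monomial (js @ ls) x = list_monomial js x * list_monomial ls x"
  by (simp add: list_monomial_def)

lemma power2_sum_le_card:
  fixes f :: "'b \<Rightarrow> real"
  shows "(\<Sum>i\<in>I. f i)\<^sup>2 \<le> card I * (\<Sum>i\<in>I. (f i)\<^sup>2)"
  using Cauchy_Schwarz_ineq_sum[of "\<lambda>_. 1" f I] by simp

section \<open>Kernels of chaos elements and their flattenings\<close>

context gaussian_seq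
begin

text \<open>Each derivative lies in the chaos of the next lower order, so iterating the eigenvalue
  identity collects the factors \<open>q\<close>, \<open>q - 1\<close>, down to 1.\<close>

lemma chaos_expansion:
  assumes "chaos N q Z" "pfun N R"
  shows "fact q * Ex (\<lambda>x. Z x * R x) = (\<Sum>is\<in>index_lists N q. Ex (\<lambda>x. pdiffs is Z x * pdiffs is R x))"
  using assms
proof (induction q arbitrary: Z R)
  case (Suc q)
  have "fact (Suc q) * Ex (\<lambda>x. Z x * R x) = fact q * (real (Suc q) * Ex (\<lambda>x. Z x * R x))" by simp
  also have "real (Suc q) * Ex (\<lambda>x. Z x * R x) = (\<Sum>i<N. Ex (\<lambda>x. pdiff i Z x * pdiff i R x))"
    by (rule chaos_eigen[OF Suc.prems, symmetric])
  also have "fact q * \<dots> = (\<Sum>i<N. fact q * Ex (\<lambda>x. pdiff i Z x * pdiff i R x))"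
    by (rule sum_distrib_left)
  also have "\<dots> = (\<Sum>i<N. \<Sum>is\<in>index_lists N q. Ex (\<lambda>x. pdiffs is (pdiff i Z) x * pdiffs is (pdiff i R) x))"
    using chaos_pdiff[OF Suc.prems(1)] Suc.prems(2)
    by (intro sum.cong refl Suc.IH pfun_pdiff) auto
  finally show ?case by (simp add: sum_index_lists_Suc)
qed simp

text \<open>The kernel of a chaos element, equal to \<open>fact q\<close> times its usual symmetric
  kernel. The derivatives of order \<open>q\<close> are constant there, so evaluation at the origin
  loses nothing.\<close>

definition coeff :: "((nat \<Rightarrow> real) \<Rightarrow> real) \<Rightarrow> nat list \<Rightarrow> real" where
  "coeff Z is = pdiffs is Z (\<lambda>_. 0)"

lemma pdiffs_eq_coeff:
  assumes "chaos N q Z" "length is = q"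
  shows "pdiffs is Z = (\<lambda>x. coeff Z is)"
proof -
  have "polyfun N 0 (pdiffs is Z)" using polyfun_pdiffs[OF chaos_polyfun[OF assms(1)], of "is"] assms by simp
  then obtain c where "pdiffs is Z = (\<lambda>x. c)" using polyfun_0 by blast
  then show ?thesis by (simp add: coeff_def)
qed

text \<open>Each integration by parts trades a coordinate of the monomial for a derivative of
  \<open>Z\<close>; the term that differentiates the monomial has too low a degree to pair with
  \<open>Z\<close>.\<close>

lemma Ex_chaos_list_monomial:
  assumes "chaos N q Z" "is \<in> index_lists N q"
  shows "Ex (\<lambda>x. Z x * list_monomial is x) = coeff Z is"
  using assms
proof (induction "is" arbitrary: Z q)
  case Nil
  then have "q = 0" by (simp add: index_lists_def)
  then obtain c where "Z = (\<lambda>x. c)" using Nil polyfun_0 chaos_polyfun by blast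
  then show ?case by (simp add: coeff_def list_monomial_def)
next
  case (Cons i "is")
  then have i: "i < N" "q = Suc (length is)" "is \<in> index_lists N (q - 1)" "set is \<subseteq> {..<N}"
    by (auto simp: index_lists_def)
  note Z = chaos_pfun[OF Cons.prems(1)] and m = polyfun_list_monomial[OF i(4)]
  note mp = polyfun_imp_pfun[OF m]
  have "Ex (\<lambda>x. Z x * list_monomial (i # is) x) = Ex (\<lambda>x. x i * (Z x * list_monomial is x))"
    by (simp add: list_monomial_def mult.left_commute)
  also have "\<dots> = Ex (pdiff i (\<lambda>x. Z x * list_monomial is x))"
    using i Z mp by (intro Ex_pibp[of _ N] pfun_mult)
  also have "\<dots> = Ex (\<lambda>x. pdiff i Z x * list_monomial is x) + Ex (\<lambda>x. Z x * pdiff i (list_monomial is) x)"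
    unfolding pfun_pdiff_mult[OF Z mp] using Z mp by (intro Ex_padd[of N] pfun_intros)
  also have "Ex (\<lambda>x. Z x * pdiff i (list_monomial is) x) = 0"
    using chaos_orth[OF Cons.prems(1) polyfun_pdiff'[OF m]] i by simp
  also have "Ex (\<lambda>x. pdiff i Z x * list_monomial is x) = coeff (pdiff i Z) is"
    by (rule Cons.IH[OF chaos_pdiff[OF Cons.prems(1) i(1)] i(3)])
  finally show ?case by (simp add: coeff_def)
qed

definition tensor_poly :: "nat \<Rightarrow> nat \<Rightarrow> (nat list \<Rightarrow> real) \<Rightarrow> (nat \<Rightarrow> real) \<Rightarrow> real" where
  "tensor_poly N k a x = (\<Sum>js\<in>index_lists N k. a js * list_monomial js x)"

lemma polyfun_tensor_poly: "polyfun N k (tensor_poly N k a)"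
  unfolding tensor_poly_def[abs_def]
proof (intro polyfun_sum polyfun_cmult)
  fix js assume "js \<in> index_lists N k"
  then show "polyfun N k (list_monomial js)" using polyfun_list_monomial[of js N] by (auto simp: index_lists_def)
qed

text \<open>Turns a tensor into a polynomial to which irreducibility can be applied. The second
  moment of \<open>P\<close> is the pairing of \<open>a\<close> with the kernel of \<open>P\<close>,
  whose squared norm is \<open>fact k\<close> times that moment; Cauchy--Schwarz concludes.\<close>

lemma tensor_poly_chaos_part:
  assumes "1 \<le> k"
  obtains P l where "chaos N k P" "polyfun N (k - 1) l" "tensor_poly N k a = (\<lambda>x. P x + l x)"
    "Ex (\<lambda>x. (P x)\<^sup>2) \<le> fact k * (\<Sum>js\<in>index_lists N k. (a js)\<^sup>2)"
proof -
  obtain P l where Pl: "chaos N k P" "polyfun N (k - 1) l" "tensor_poly N k a = (\<lambda>x. P x + l x)"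
    using chaos_decomposition[of N "k - 1" "tensor_poly N k a"] polyfun_tensor_poly assms by auto
  note P = chaos_pfun[OF Pl(1)] and l = polyfun_imp_pfun[OF Pl(2)]
  define p where "p = Ex (\<lambda>x. (P x)\<^sup>2)"
  define A where "A = (\<Sum>js\<in>index_lists N k. (a js)\<^sup>2)"
  have "p = Ex (\<lambda>x. P x * tensor_poly N k a x)"
  proof -
    have "Ex (\<lambda>x. P x * tensor_poly N k a x) = Ex (\<lambda>x. P x * P x + P x * l x)"
      by (simp add: Pl(3) distrib_left)
    also have "\<dots> = p + Ex (\<lambda>x. P x * l x)"
      using P l by (subst Ex_padd[of N]) (auto simp: p_def power2_eq_square intro!: pfun_intros)
    also have "Ex (\<lambda>x. P x * l x) = 0" using chaos_orth[OF Pl(1,2)] assms by simp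
    finally show ?thesis by simp
  qed
  also have "\<dots> = Ex (\<lambda>x. \<Sum>js\<in>index_lists N k. a js * (P x * list_monomial js x))"
    by (simp add: tensor_poly_def sum_distrib_left mult.left_commute)
  also have "\<dots> = (\<Sum>js\<in>index_lists N k. Ex (\<lambda>x. a js * (P x * list_monomial js x)))"
    using P by (intro Ex_psum[of _ N] pfun_intros)
      (auto simp: index_lists_def intro: polyfun_imp_pfun[OF polyfun_list_monomial])
  also have "\<dots> = (\<Sum>js\<in>index_lists N k. a js * coeff P js)"
    by (intro sum.cong refl) (simp add: Ex_cmult Ex_chaos_list_monomial[OF Pl(1)])
  finally have "p\<^sup>2 \<le> A * (\<Sum>js\<in>index_lists N k. (coeff P js)\<^sup>2)"
    unfolding A_def using Cauchy_Schwarz_ineq_sum by simp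
  also have "(\<Sum>js\<in>index_lists N k. (coeff P js)\<^sup>2) = fact k * p"
    using chaos_expansion[OF Pl(1) P] pdiffs_eq_coeff[OF Pl(1)]
    by (simp add: p_def power2_eq_square index_lists_def)
  finally have "p * p \<le> p * (fact k * A)" by (simp add: power2_eq_square mult_ac)
  moreover have "0 \<le> p" "0 \<le> A" by (auto simp: p_def A_def intro: sum_nonneg)
  ultimately have "p \<le> fact k * A" by (cases "p = 0") (auto simp: mult_le_cancel_left)
  then show ?thesis using that[OF Pl] by (simp add: p_def A_def)
qed

text \<open>Smallness of \<open>E[Z P Q]\<close> says that all proper flattenings of the kernel of \<open>Z\<close>
  have small operator norm.\<close>

definition irreducible :: "nat \<Rightarrow> nat \<Rightarrow> real \<Rightarrow> ((nat \<Rightarrow> real) \<Rightarrow> real) \<Rightarrow> bool" where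
  "irreducible N q e Z \<longleftrightarrow> (\<forall>k l P Q. 1 \<le> k \<longrightarrow> 1 \<le> l \<longrightarrow> k + l = q \<longrightarrow> polyfun N k P \<longrightarrow> polyfun N l Q \<longrightarrow>
     (Ex (\<lambda>x. Z x * (P x * Q x)))\<^sup>2 \<le> e * Ex (\<lambda>x. (P x)\<^sup>2) * Ex (\<lambda>x. (Q x)\<^sup>2))"

text \<open>The tensors are replaced by the chaos parts \<open>P\<close> and \<open>Q\<close> of
  their polynomials. The lower order corrections to the product have degree below \<open>q\<close>
  and are invisible to \<open>Z\<close>, so irreducibility applies to \<open>P * Q\<close>.\<close>

lemma flattening_le:
  assumes "chaos N q Z" "irreducible N q e Z" "1 \<le> k" "1 \<le> l" "k + l = q" "0 \<le> e"
  shows "(\<Sum>js\<in>index_lists N k. \<Sum>ls\<in>index_lists N l. coeff Z (js @ ls) * (a js * b ls))\<^sup>2 \<le>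
    e * fact q * (\<Sum>js\<in>index_lists N k. (a js)\<^sup>2) * (\<Sum>ls\<in>index_lists N l. (b ls)\<^sup>2)"
proof -
  define A where "A = (\<Sum>js\<in>index_lists N k. (a js)\<^sup>2)"
  define B where "B = (\<Sum>js\<in>index_lists N l. (b js)\<^sup>2)"
  have AB: "0 \<le> A" "0 \<le> B" by (auto simp: A_def B_def intro: sum_nonneg)
  obtain P p where P: "chaos N k P" "polyfun N (k - 1) p" "tensor_poly N k a = (\<lambda>x. P x + p x)"
    "Ex (\<lambda>x. (P x)\<^sup>2) \<le> fact k * A" unfolding A_def using tensor_poly_chaos_part[OF assms(3)] .
  obtain Q r where Q: "chaos N l Q" "polyfun N (l - 1) r" "tensor_poly N l b = (\<lambda>x. Q x + r x)"
    "Ex (\<lambda>x. (Q x)\<^sup>2) \<le> fact l * B" unfolding B_def using tensor_poly_chaos_part[OF assms(4)] .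
  note Z = chaos_pfun[OF assms(1)]
  have mono: "js \<in> index_lists N k' \<Longrightarrow> pfun N (list_monomial js)" for js k'
    by (auto simp: index_lists_def intro: polyfun_imp_pfun[OF polyfun_list_monomial])
  have "(\<Sum>js\<in>index_lists N k. \<Sum>ls\<in>index_lists N l. coeff Z (js @ ls) * (a js * b ls)) =
    (\<Sum>js\<in>index_lists N k. \<Sum>ls\<in>index_lists N l. Ex (\<lambda>x. (a js * b ls) * (Z x * list_monomial (js @ ls) x)))"
  proof (intro sum.cong refl)
    fix js ls assume "js \<in> index_lists N k" "ls \<in> index_lists N l"
    then have "js @ ls \<in> index_lists N q" using assms(5) by (auto simp: index_lists_def)
    then show "coeff Z (js @ ls) * (a js * b ls) = Ex (\<lambda>x. (a js * b ls) * (Z x * list_monomial (js @ ls) x))"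
      using Ex_chaos_list_monomial[OF assms(1)] by (simp add: Ex_cmult)
  qed
  also have "\<dots> = (\<Sum>js\<in>index_lists N k. Ex (\<lambda>x. \<Sum>ls\<in>index_lists N l. (a js * b ls) * (Z x * list_monomial (js @ ls) x)))"
    using Z mono by (intro sum.cong refl Ex_psum[symmetric, of _ N]) (auto simp: list_monomial_append intro!: pfun_intros)
  also have "\<dots> = Ex (\<lambda>x. \<Sum>js\<in>index_lists N k. \<Sum>ls\<in>index_lists N l. (a js * b ls) * (Z x * list_monomial (js @ ls) x))"
    using Z mono by (intro Ex_psum[symmetric, of _ N] pfun_sum) (auto simp: list_monomial_append intro!: pfun_intros)
  also have "(\<lambda>x. \<Sum>js\<in>index_lists N k. \<Sum>ls\<in>index_lists N l. (a js * b ls) * (Z x * list_monomial (js @ ls) x)) =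
      (\<lambda>x. Z x * (tensor_poly N k a x * tensor_poly N l b x))"
    unfolding tensor_poly_def sum_product unfolding sum_distrib_left
    by (intro ext sum.cong refl) (simp add: list_monomial_append mult_ac)
  also have "\<dots> = (\<lambda>x. Z x * (P x * Q x) + Z x * (p x * tensor_poly N l b x + P x * r x))"
    by (simp add: P(3) Q(3) algebra_simps)
  also have "Ex \<dots> = Ex (\<lambda>x. Z x * (P x * Q x)) + Ex (\<lambda>x. Z x * (p x * tensor_poly N l b x + P x * r x))"
    using Z chaos_pfun[OF P(1)] chaos_pfun[OF Q(1)] polyfun_imp_pfun[OF P(2)] polyfun_imp_pfun[OF Q(2)]
      polyfun_imp_pfun[OF polyfun_tensor_poly] by (intro Ex_padd[of N] pfun_intros)
  also have "Ex (\<lambda>x. Z x * (p x * tensor_poly N l b x + P x * r x)) = 0"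
  proof (rule chaos_orth[OF assms(1)])
    show "polyfun N (q - 1) (\<lambda>x. p x * tensor_poly N l b x + P x * r x)"
      using polyfun_mult[OF P(2) polyfun_tensor_poly[of N l b]] polyfun_mult[OF chaos_polyfun[OF P(1)] Q(2)] assms
      by (intro polyfun.add) (auto elim!: polyfun_mono)
  qed (use assms in simp)
  finally have "(\<Sum>js\<in>index_lists N k. \<Sum>ls\<in>index_lists N l. coeff Z (js @ ls) * (a js * b ls))\<^sup>2 =
      (Ex (\<lambda>x. Z x * (P x * Q x)))\<^sup>2" by simp
  also have "\<dots> \<le> e * Ex (\<lambda>x. (P x)\<^sup>2) * Ex (\<lambda>x. (Q x)\<^sup>2)"
    using assms chaos_polyfun[OF P(1)] chaos_polyfun[OF Q(1)] by (auto simp: irreducible_def)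
  also have "\<dots> \<le> e * (fact k * A) * (fact l * B)"
    using P(4) Q(4) assms AB by (intro mult_mono) auto
  also have "\<dots> = e * (fact k * fact l) * A * B" by (simp add: mult_ac)
  also have "\<dots> \<le> e * fact q * A * B"
  proof (intro mult_right_mono mult_left_mono)
    have "fact k * fact l \<le> (fact q :: nat)"
      using assms(5) dvd_imp_le[OF fact_fact_dvd_fact[of k l]] by auto
    then show "fact k * fact l \<le> (fact q :: real)"
      by (metis of_nat_fact of_nat_le_iff of_nat_mult)
  qed (use AB assms in auto)
  finally show ?thesis by (simp add: A_def B_def)
qed

section \<open>Contraction with a kernel as an approximate derivation\<close>

lemma iterated_energy_le:
  "polyfun N d f \<Longrightarrow> (\<Sum>is\<in>index_lists N k. Ex (\<lambda>x. (pdiffs is f x)\<^sup>2)) \<le> real d ^ k * Ex (\<lambda>x. (f x)\<^sup>2)"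
proof (induction k arbitrary: f)
  case (Suc k)
  have "(\<Sum>is\<in>index_lists N (Suc k). Ex (\<lambda>x. (pdiffs is f x)\<^sup>2)) =
      (\<Sum>i<N. \<Sum>is\<in>index_lists N k. Ex (\<lambda>x. (pdiffs is (pdiff i f) x)\<^sup>2))"
    by (simp add: sum_index_lists_Suc)
  also have "\<dots> \<le> (\<Sum>i<N. real d ^ k * Ex (\<lambda>x. (pdiff i f x)\<^sup>2))"
    by (intro sum_mono Suc.IH polyfun_pdiff' Suc.prems)
  also have "\<dots> = real d ^ k * (\<Sum>i<N. Ex (\<lambda>x. (pdiff i f x)\<^sup>2))" by (simp add: sum_distrib_left)
  also have "\<dots> \<le> real d ^ k * (real d * Ex (\<lambda>x. (f x)\<^sup>2))"
    by (intro mult_left_mono energy_le Suc.prems) auto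
  finally show ?case by (simp add: mult_ac)
qed simp

text \<open>The kernel of \<open>Z\<close> paired with the derivatives of order \<open>q\<close> of
  \<open>f\<close>. In expectation this is pairing with \<open>Z\<close>, up to
  \<open>fact q\<close>, but before expectation it obeys a product rule.\<close>

definition contract :: "nat \<Rightarrow> nat \<Rightarrow> ((nat \<Rightarrow> real) \<Rightarrow> real) \<Rightarrow> ((nat \<Rightarrow> real) \<Rightarrow> real) \<Rightarrow> (nat \<Rightarrow> real) \<Rightarrow> real" where
  "contract N q Z f x = (\<Sum>is\<in>index_lists N q. coeff Z is * pdiffs is f x)"

lemma polyfun_contract: "polyfun N d f \<Longrightarrow> polyfun N (d - q) (contract N q Z f)"
  unfolding contract_def[abs_def]
proof (intro polyfun_sum polyfun_cmult)
  fix "is" assume "polyfun N d f" "is \<in> index_lists N q"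
  then show "polyfun N (d - q) (pdiffs is f)" using polyfun_pdiffs[of N d f "is"] by (auto simp: index_lists_def)
qed

lemma pfun_contract: "pfun N f \<Longrightarrow> pfun N (contract N q Z f)"
  using polyfun_contract unfolding pfun_def by blast

lemma Ex_contract:
  assumes "chaos N q Z" "pfun N f"
  shows "Ex (contract N q Z f) = fact q * Ex (\<lambda>x. Z x * f x)"
proof -
  have "Ex (contract N q Z f) = (\<Sum>is\<in>index_lists N q. Ex (\<lambda>x. coeff Z is * pdiffs is f x))"
    unfolding contract_def[abs_def] using assms by (intro Ex_psum[of _ N] pfun_intros pfun_pdiffs)
  also have "\<dots> = (\<Sum>is\<in>index_lists N q. Ex (\<lambda>x. pdiffs is Z x * pdiffs is f x))"
    using pdiffs_eq_coeff[OF assms(1)] by (intro sum.cong refl) (auto simp: index_lists_def)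
  finally show ?thesis using chaos_expansion[OF assms] by simp
qed

text \<open>In degree at most \<open>q\<close> the derivatives of order \<open>q\<close> are
  constant, so the contraction equals its expectation. This turns the derivation property into a
  recursion for moments.\<close>

lemma contract_eq_const:
  assumes "chaos N q Z" "polyfun N q f"
  shows "contract N q Z f = (\<lambda>x. fact q * Ex (\<lambda>x. Z x * f x))"
proof -
  have "polyfun N 0 (contract N q Z f)" using polyfun_contract[OF assms(2), of q Z] by simp
  then obtain c where c: "contract N q Z f = (\<lambda>x. c)" using polyfun_0 by blast
  have "c = Ex (contract N q Z f)" by (simp add: c)
  then show ?thesis using Ex_contract[OF assms(1) polyfun_imp_pfun[OF assms(2)]] c by simp
qed

text \<open>In the Leibniz expansion the two constant masks put all derivatives on one factor and
  give the derivation terms; what remains are proper flattenings.\<close>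

lemma contract_mult:
  assumes Z: "chaos N q Z" and q: "1 \<le> q" and f: "pfun N f" and g: "pfun N g"
  shows "contract N q Z (\<lambda>x. f x * g x) x - f x * contract N q Z g x - g x * contract N q Z f x =
    (\<Sum>bs\<in>{bs. length bs = q} - {replicate q True, replicate q False}.
      \<Sum>js\<in>index_lists N (length (filter id bs)). \<Sum>ls\<in>index_lists N (length (filter Not bs)).
        coeff Z (js @ ls) * (pdiffs js f x * pdiffs ls g x))"
proof -
  define t where "t bs = (\<Sum>is\<in>index_lists N q. coeff Z is *
    (pdiffs (select bs is) f x * pdiffs (select (map Not bs) is) g x))" for bs
  have t: "t bs = (\<Sum>js\<in>index_lists N (length (filter id bs)). \<Sum>ls\<in>index_lists N (length (filter Not bs)).
        coeff Z (js @ ls) * (pdiffs js f x * pdiffs ls g x))" if "length bs = q" for bs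
  proof -
    have "t bs = (\<Sum>is\<in>index_lists N (length bs). coeff Z (select bs is @ select (map Not bs) is) *
      (pdiffs (select bs is) f x * pdiffs (select (map Not bs) is) g x))"
      unfolding t_def that using that pdiffs_select[OF chaos_pfun[OF Z], of bs]
      by (intro sum.cong refl) (auto simp: coeff_def index_lists_def)
    then show ?thesis 
      using sum_select[where bs = bs and N = N and w = "\<lambda>js ls. coeff Z (js @ ls) * (pdiffs js f x * pdiffs ls g x)"]
      by simp
  qed
  have "contract N q Z (\<lambda>x. f x * g x) x = (\<Sum>is\<in>index_lists N q. coeff Z is *
     (\<Sum>bs | length bs = q. pdiffs (select bs is) f x * pdiffs (select (map Not bs) is) g x))"
    unfolding contract_def by (intro sum.cong refl) (auto simp: pdiffs_mult[OF f g] index_lists_def)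
  also have "\<dots> = (\<Sum>is\<in>index_lists N q. \<Sum>bs | length bs = q.
     coeff Z is * (pdiffs (select bs is) f x * pdiffs (select (map Not bs) is) g x))"
    by (simp add: sum_distrib_left)
  also have "\<dots> = (\<Sum>bs | length bs = q. t bs)" unfolding t_def by (rule sum.swap)
  also have "\<dots> = (\<Sum>bs\<in>{bs. length bs = q} - {replicate q True, replicate q False}. t bs) +
      (\<Sum>bs\<in>{replicate q True, replicate q False}. t bs)"
    by (rule sum.subset_diff) auto
  \<comment> \<open>\<open>1 \<le> q\<close> makes the two constant masks distinct.\<close>
  also have "(\<Sum>bs\<in>{replicate q True, replicate q False}. t bs) = t (replicate q True) + t (replicate q False)"
    using q by (subst sum.insert) auto
  also have "t (replicate q True) = g x * contract N q Z f x"
    unfolding t_def contract_def sum_distrib_left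
    by (intro sum.cong refl) (auto simp: select_const index_lists_def)
  also have "t (replicate q False) = f x * contract N q Z g x"
    unfolding t_def contract_def sum_distrib_left
    by (intro sum.cong refl) (auto simp: select_const index_lists_def)
  finally show ?thesis using t by simp
qed

text \<open>For each mixed mask the flattening bound is applied at every point \<open>x\<close>,
  with the derivatives of \<open>f\<close> and \<open>g\<close> as tensors; hypercontractivity and
  iterated energy bounds control the expectation. The factor \<open>4 ^ q\<close> is the square of
  the bound \<open>2 ^ q\<close> for the number of masks.\<close>

theorem contract_approx_derivation:
  assumes Z: "chaos N q Z" "irreducible N q e Z" "0 \<le> e" and q: "1 \<le> q"
    and f: "polyfun N d f" and g: "polyfun N d' g"
  shows "Ex (\<lambda>x. (contract N q Z (\<lambda>x. f x * g x) x - f x * contract N q Z g x - g x * contract N q Z f x)\<^sup>2)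
    \<le> e * (4 ^ q * fact q * 72 ^ (d + d') * (real (d + d') + 1) ^ q) * Ex (\<lambda>x. (f x)\<^sup>2) * Ex (\<lambda>x. (g x)\<^sup>2)"
proof -
  note fp = polyfun_imp_pfun[OF f] and gp = polyfun_imp_pfun[OF g]
  define MB where "MB = {bs. length bs = q} - {replicate q True, replicate q False}"
  define b where "b bs x = (\<Sum>js\<in>index_lists N (length (filter id bs)). \<Sum>ls\<in>index_lists N (length (filter Not bs)).
        coeff Z (js @ ls) * (pdiffs js f x * pdiffs ls g x))" for bs x
  define K where "K = e * (fact q * 72 ^ (d + d') * (real (d + d') + 1) ^ q) * Ex (\<lambda>x. (f x)\<^sup>2) * Ex (\<lambda>x. (g x)\<^sup>2)"
  have K0: "0 \<le> K" using Z(3) by (simp add: K_def)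
  have finMB: "finite MB" by (simp add: MB_def)
  have bp: "pfun N (b bs)" for bs
    unfolding b_def using fp gp by (intro pfun_intros pfun_pdiffs)
  have bK: "Ex (\<lambda>x. (b bs x)\<^sup>2) \<le> K" if "bs \<in> MB" for bs
  proof -
    define k where "k = length (filter id bs)"
    define l where "l = length (filter Not bs)"
    have kl: "k + l = q" "1 \<le> k" "1 \<le> l"
      using that filter_mask_length[of bs] filter_mask_eq_0[of bs] unfolding MB_def k_def l_def
      by (auto simp: Suc_le_eq)
    have "Ex (\<lambda>x. (b bs x)\<^sup>2) \<le>
        Ex (\<lambda>x. (e * fact q) * ((\<Sum>js\<in>index_lists N k. (pdiffs js f x)\<^sup>2) * (\<Sum>ls\<in>index_lists N l. (pdiffs ls g x)\<^sup>2)))"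
    proof (rule Ex_pmono[of N])
      show "(b bs x)\<^sup>2 \<le> (e * fact q) * ((\<Sum>js\<in>index_lists N k. (pdiffs js f x)\<^sup>2) * (\<Sum>ls\<in>index_lists N l. (pdiffs ls g x)\<^sup>2))" for x
        using flattening_le[OF Z(1,2) kl(2,3,1) Z(3), of "\<lambda>js. pdiffs js f x" "\<lambda>ls. pdiffs ls g x"]
        by (simp add: b_def k_def l_def mult.assoc)
    qed (use bp fp gp in \<open>auto intro!: pfun_intros pfun_pdiffs\<close>)
    also have "\<dots> = (e * fact q) * Ex (\<lambda>x. (\<Sum>js\<in>index_lists N k. (pdiffs js f x)\<^sup>2) * (\<Sum>ls\<in>index_lists N l. (pdiffs ls g x)\<^sup>2))"
      by (rule Ex_cmult)
    also have "\<dots> \<le> (e * fact q) * (sqrt (72 ^ d * 72 ^ d') * (\<Sum>js\<in>index_lists N k. Ex (\<lambda>x. (pdiffs js f x)\<^sup>2)) *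
        (\<Sum>ls\<in>index_lists N l. Ex (\<lambda>x. (pdiffs ls g x)\<^sup>2)))"
      using Z(3) fp gp
      by (intro mult_left_mono Ex_square_sum_squares_le[of _ N] pfun_pdiffs hypercontractivity[OF polyfun_pdiffs'[OF f]]
          hypercontractivity[OF polyfun_pdiffs'[OF g]]) auto
    also have "\<dots> \<le> (e * fact q) * (72 ^ (d + d') * (real d ^ k * Ex (\<lambda>x. (f x)\<^sup>2)) * (real d' ^ l * Ex (\<lambda>x. (g x)\<^sup>2)))"
    proof (intro mult_left_mono mult_mono iterated_energy_le f g)
      have "(72::real) ^ (d + d') \<le> (72 ^ (d + d'))\<^sup>2"
        unfolding power2_eq_square by (simp add: mult_le_cancel_left1)
      then show "sqrt (72 ^ d * 72 ^ d') \<le> 72 ^ (d + d')"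
        by (intro real_le_lsqrt) (auto simp: power_add)
    qed (use Z(3) in \<open>auto intro!: sum_nonneg mult_nonneg_nonneg\<close>)
    also have "\<dots> = (e * (fact q * 72 ^ (d + d') * (real d ^ k * real d' ^ l)) * Ex (\<lambda>x. (f x)\<^sup>2) * Ex (\<lambda>x. (g x)\<^sup>2))"
      by (simp add: mult_ac)
    also have "\<dots> \<le> K"
      unfolding K_def
    proof (intro mult_right_mono mult_left_mono)
      have "real d ^ k * real d' ^ l \<le> (real (d + d') + 1) ^ k * (real (d + d') + 1) ^ l"
        by (intro mult_mono power_mono) auto
      then show "real d ^ k * real d' ^ l \<le> (real (d + d') + 1) ^ q"
        by (simp add: power_add[symmetric] kl)
    qed (use Z(3) in auto)
    finally show ?thesis .
  qed
  have card: "real (card MB) \<le> 2 ^ q"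
  proof -
    have "card MB \<le> card {bs :: bool list. length bs = q}" unfolding MB_def by (intro card_mono) auto
    also have "\<dots> = 2 ^ q" using card_lists_length_eq[of "UNIV :: bool set" q] by simp
    finally show ?thesis by (metis of_nat_le_iff of_nat_numeral of_nat_power)
  qed
  have "Ex (\<lambda>x. (contract N q Z (\<lambda>x. f x * g x) x - f x * contract N q Z g x - g x * contract N q Z f x)\<^sup>2) =
      Ex (\<lambda>x. (\<Sum>bs\<in>MB. b bs x)\<^sup>2)"
    unfolding contract_mult[OF Z(1) q fp gp] MB_def b_def ..
  also have "\<dots> \<le> Ex (\<lambda>x. card MB * (\<Sum>bs\<in>MB. (b bs x)\<^sup>2))"
    using bp by (intro Ex_pmono[of N] power2_sum_le_card pfun_intros)
  also have "\<dots> = card MB * Ex (\<lambda>x. \<Sum>bs\<in>MB. (b bs x)\<^sup>2)" by (rule Ex_cmult)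
  also have "Ex (\<lambda>x. \<Sum>bs\<in>MB. (b bs x)\<^sup>2) = (\<Sum>bs\<in>MB. Ex (\<lambda>x. (b bs x)\<^sup>2))"
    using bp by (intro Ex_psum[of _ N] pfun_intros)
  also have "real (card MB) * (\<Sum>bs\<in>MB. Ex (\<lambda>x. (b bs x)\<^sup>2)) \<le> real (card MB) * (card MB * K)"
    using bK by (intro mult_left_mono sum_bounded_above) auto
  also have "\<dots> \<le> 2 ^ q * (2 ^ q * K)"
    using card K0 by (intro mult_mono) auto
  also have "\<dots> = e * (4 ^ q * fact q * 72 ^ (d + d') * (real (d + d') + 1) ^ q) * Ex (\<lambda>x. (f x)\<^sup>2) * Ex (\<lambda>x. (g x)\<^sup>2)"
    by (simp add: K_def mult_ac power_mult_distrib[symmetric])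
  finally show ?thesis .
qed

lemma Ex_square_prod_list_le:
  assumes "0 \<le> K" "\<And>Y. Y \<in> set Ys \<Longrightarrow> polyfun N d Y" "\<And>Y. Y \<in> set Ys \<Longrightarrow> Ex (\<lambda>x. (Y x)\<^sup>2) \<le> K"
  shows "Ex (\<lambda>x. (\<Prod>Y\<leftarrow>Ys. Y x)\<^sup>2) \<le> (72 ^ (length Ys * d) * K) ^ length Ys"
  using assms(2,3)
proof (induction Ys)
  case (Cons Y Ys)
  let ?n = "length Ys"
  have "Ex (\<lambda>x. (\<Prod>Y\<leftarrow>Y # Ys. Y x)\<^sup>2) = Ex (\<lambda>x. (Y x * (\<Prod>Y\<leftarrow>Ys. Y x))\<^sup>2)" by simp
  also have "\<dots> \<le> 72 ^ (d + ?n * d) * Ex (\<lambda>x. (Y x)\<^sup>2) * Ex (\<lambda>x. (\<Prod>Y\<leftarrow>Ys. Y x)\<^sup>2)"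
    using Cons.prems by (intro Ex_square_mult_le polyfun_prod_list) auto
  also have "\<dots> \<le> 72 ^ (d + ?n * d) * K * (72 ^ (?n * d) * K) ^ ?n"
    using Cons assms(1) by (intro mult_mono) auto
  also have "\<dots> \<le> 72 ^ (d + ?n * d) * K * (72 ^ (Suc ?n * d) * K) ^ ?n"
    using assms(1) by (intro mult_left_mono power_mono mult_right_mono power_increasing) auto
  also have "\<dots> = (72 ^ (length (Y # Ys) * d) * K) ^ length (Y # Ys)" by simp
  finally show ?case .
qed simp

definition remove_nth :: "nat \<Rightarrow> 'b list \<Rightarrow> 'b list" where
  "remove_nth i xs = take i xs @ drop (Suc i) xs"

text \<open>What contraction would give on the product of \<open>Ys\<close> if it were an exact
  derivation.\<close>

definition wick_sum :: "nat \<Rightarrow> nat \<Rightarrow> ((nat \<Rightarrow> real) \<Rightarrow> real) \<Rightarrow> ((nat \<Rightarrow> real) \<Rightarrow> real) list \<Rightarrow> (nat \<Rightarrow> real) \<Rightarrow> real" where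
  "wick_sum N q Z Ys x = (\<Sum>i<length Ys. contract N q Z (Ys ! i) x * (\<Prod>Y\<leftarrow>remove_nth i Ys. Y x))"

lemma wick_sum_Cons:
  "wick_sum N q Z (Y # Ys) x = contract N q Z Y x * (\<Prod>Y\<leftarrow>Ys. Y x) + Y x * wick_sum N q Z Ys x"
  by (simp add: wick_sum_def remove_nth_def sum.lessThan_Suc_shift sum_distrib_left mult_ac
      del: sum.lessThan_Suc)

lemma polyfun_wick_sum:
  "(\<And>Y. Y \<in> set Ys \<Longrightarrow> polyfun N d Y) \<Longrightarrow> polyfun N (length Ys * d) (wick_sum N q Z Ys)"
proof (induction Ys)
  case Nil
  then show ?case by (simp add: wick_sum_def[abs_def] polyfun.const)
next
  case (Cons Y Ys)
  have "polyfun N (d + length Ys * d) (wick_sum N q Z (Y # Ys))"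
    unfolding wick_sum_Cons[abs_def] using Cons polyfun_mono[OF polyfun_contract[of N d Y q Z], of d]
    by (intro polyfun.add polyfun_mult polyfun_prod_list) auto
  then show ?case by simp
qed

lemma Ex_square_add_le:
  assumes "pfun N f" "pfun N g"
  shows "Ex (\<lambda>x. (f x + g x)\<^sup>2) \<le> 2 * Ex (\<lambda>x. (f x)\<^sup>2) + 2 * Ex (\<lambda>x. (g x)\<^sup>2)"
proof -
  have "Ex (\<lambda>x. (f x + g x)\<^sup>2) \<le> Ex (\<lambda>x. 2 * (f x)\<^sup>2 + 2 * (g x)\<^sup>2)"
  proof (rule Ex_pmono[of N])
    show "(f x + g x)\<^sup>2 \<le> 2 * (f x)\<^sup>2 + 2 * (g x)\<^sup>2" for x
      using sum_squares_bound[of "f x" "g x"] by (simp add: power2_sum)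
  qed (use assms in \<open>auto intro!: pfun_intros\<close>)
  also have "\<dots> = 2 * Ex (\<lambda>x. (f x)\<^sup>2) + 2 * Ex (\<lambda>x. (g x)\<^sup>2)"
    using assms by (subst Ex_padd[of N]) (auto simp: Ex_cmult intro!: pfun_intros)
  finally show ?thesis .
qed

text \<open>\<open>C\<close> is quantified before \<open>N\<close>, \<open>Z\<close>,
  \<open>e\<close> and \<open>Ys\<close>, so it stays fixed while the number of variables grows and
  the defect \<open>e\<close> tends to 0.\<close>

lemma contract_prod_list_approx:
  assumes q: "1 \<le> q" and K: "0 \<le> K"
  shows "\<exists>C\<ge>0. \<forall>N Z e Ys. chaos N q Z \<longrightarrow> irreducible N q e Z \<longrightarrow> 0 \<le> e \<longrightarrow> length Ys = m \<longrightarrow>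
    (\<forall>Y\<in>set Ys. polyfun N d Y \<and> Ex (\<lambda>x. (Y x)\<^sup>2) \<le> K) \<longrightarrow>
    Ex (\<lambda>x. (contract N q Z (\<lambda>x. \<Prod>Y\<leftarrow>Ys. Y x) x - wick_sum N q Z Ys x)\<^sup>2) \<le> C * e"
proof (induction m)
  case 0
  have "contract N q Z (\<lambda>x. 1) x = 0" for N Z x
    unfolding contract_def using q by (intro sum.neutral ballI) (subst pdiffs_const, auto simp: index_lists_def)
  then show ?case by (intro exI[of _ 0]) (auto simp: wick_sum_def)
next
  case (Suc m)
  then obtain C where C: "0 \<le> C" "\<And>N Z e Ys. chaos N q Z \<Longrightarrow> irreducible N q e Z \<Longrightarrow> 0 \<le> e \<Longrightarrow> length Ys = m \<Longrightarrow>
    (\<And>Y. Y \<in> set Ys \<Longrightarrow> polyfun N d Y \<and> Ex (\<lambda>x. (Y x)\<^sup>2) \<le> K) \<Longrightarrow>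
    Ex (\<lambda>x. (contract N q Z (\<lambda>x. \<Prod>Y\<leftarrow>Ys. Y x) x - wick_sum N q Z Ys x)\<^sup>2) \<le> C * e"
    by blast
  define A where "A = 4 ^ q * fact q * 72 ^ (d + m * d) * (real (d + m * d) + 1) ^ q * K * (72 ^ (m * d) * K) ^ m"
  define B where "B = 72 ^ (d + m * d) * K * C"
  have AB: "0 \<le> A" "0 \<le> B" using K C(1) by (auto simp: A_def B_def)
  show ?case
  proof (intro exI[of _ "2 * A + 2 * B"] conjI allI impI)
    fix N Z e Ys
    assume Z: "chaos N q Z" "irreducible N q e Z" "0 \<le> e" and len: "length Ys = Suc m"
      and Ys: "\<forall>Y\<in>set Ys. polyfun N d Y \<and> Ex (\<lambda>x. (Y x)\<^sup>2) \<le> K"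
    then obtain Y Ys' where Y: "Ys = Y # Ys'" "length Ys' = m" by (auto simp: length_Suc_conv)
    let ?T = "contract N q Z" and ?S = "\<lambda>x. \<Prod>Y\<leftarrow>Ys'. Y x"
    have YK: "polyfun N d Y" "Ex (\<lambda>x. (Y x)\<^sup>2) \<le> K" using Ys Y by auto
    have S: "polyfun N (m * d) ?S" using Ys Y polyfun_prod_list[of Ys' N d] by auto
    have SK: "Ex (\<lambda>x. (?S x)\<^sup>2) \<le> (72 ^ (m * d) * K) ^ m"
      using Ex_square_prod_list_le[OF K, of Ys' N d] Ys Y by auto
    have W: "polyfun N (m * d) (wick_sum N q Z Ys')" using Ys Y polyfun_wick_sum[of Ys' N d] by auto
    have TS: "polyfun N (m * d) (?T ?S)" by (rule polyfun_mono[OF polyfun_contract[OF S]]) auto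
    \<comment> \<open>\<open>u\<close> is the derivation defect of \<open>Y\<close> against the
      remaining product, \<open>v\<close> the error of the induction hypothesis multiplied by
      \<open>Y\<close>.\<close>
    define u where "u x = ?T (\<lambda>x. Y x * ?S x) x - Y x * ?T ?S x - ?S x * ?T Y x" for x
    define v where "v x = Y x * (?T ?S x - wick_sum N q Z Ys' x)" for x
    have u: "pfun N u" "pfun N v" unfolding u_def v_def
      using polyfun_imp_pfun[OF YK(1)] polyfun_imp_pfun[OF S] polyfun_imp_pfun[OF W]
      by (auto intro!: pfun_intros pfun_contract)
    have "Ex (\<lambda>x. (u x)\<^sup>2) \<le> e * (4 ^ q * fact q * 72 ^ (d + m * d) * (real (d + m * d) + 1) ^ q) *
        Ex (\<lambda>x. (Y x)\<^sup>2) * Ex (\<lambda>x. (?S x)\<^sup>2)"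
      unfolding u_def by (rule contract_approx_derivation[OF Z q YK(1) S])
    also have "\<dots> \<le> e * (4 ^ q * fact q * 72 ^ (d + m * d) * (real (d + m * d) + 1) ^ q) *
        K * (72 ^ (m * d) * K) ^ m"
      using Z(3) K by (intro mult_mono YK SK) auto
    finally have ue: "Ex (\<lambda>x. (u x)\<^sup>2) \<le> A * e" by (simp add: A_def mult_ac)
    have "Ex (\<lambda>x. (v x)\<^sup>2) \<le> 72 ^ (d + m * d) * Ex (\<lambda>x. (Y x)\<^sup>2) * Ex (\<lambda>x. (?T ?S x - wick_sum N q Z Ys' x)\<^sup>2)"
      unfolding v_def by (rule Ex_square_mult_le[OF YK(1) polyfun_diff[OF TS W]])
    also have "\<dots> \<le> 72 ^ (d + m * d) * K * (C * e)"
      using Z K Ys Y by (intro mult_mono YK C(2)) auto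
    finally have ve: "Ex (\<lambda>x. (v x)\<^sup>2) \<le> B * e" by (simp add: B_def mult_ac)
    have "Ex (\<lambda>x. (?T (\<lambda>x. \<Prod>Y\<leftarrow>Ys. Y x) x - wick_sum N q Z Ys x)\<^sup>2) = Ex (\<lambda>x. (u x + v x)\<^sup>2)"
      unfolding u_def v_def by (simp add: Y wick_sum_Cons algebra_simps)
    also have "\<dots> \<le> 2 * Ex (\<lambda>x. (u x)\<^sup>2) + 2 * Ex (\<lambda>x. (v x)\<^sup>2)" by (rule Ex_square_add_le[OF u])
    also have "\<dots> \<le> (2 * A + 2 * B) * e" using ue ve by (simp add: algebra_simps)
    finally show "Ex (\<lambda>x. (?T (\<lambda>x. \<Prod>Y\<leftarrow>Ys. Y x) x - wick_sum N q Z Ys x)\<^sup>2) \<le> (2 * A + 2 * B) * e" .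
  qed (use AB in auto)
qed

text \<open>An irreducible \<open>Z\<close> almost satisfies the recursion which characterises the moments of
  Gaussian families (Isserlis' theorem).\<close>

theorem approx_isserlis:
  assumes q: "1 \<le> q" and K: "0 \<le> K"
  shows "\<exists>C\<ge>0. \<forall>N Z e Ys. chaos N q Z \<longrightarrow> irreducible N q e Z \<longrightarrow> 0 \<le> e \<longrightarrow> length Ys = m \<longrightarrow>
    (\<forall>Y\<in>set Ys. polyfun N q Y \<and> Ex (\<lambda>x. (Y x)\<^sup>2) \<le> K) \<longrightarrow>
    (Ex (\<lambda>x. Z x * (\<Prod>Y\<leftarrow>Ys. Y x)) -
      (\<Sum>i<m. Ex (\<lambda>x. Z x * (Ys ! i) x) * Ex (\<lambda>x. \<Prod>Y\<leftarrow>remove_nth i Ys. Y x)))\<^sup>2 \<le> C * e"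
proof -
  obtain C where C: "0 \<le> C" "\<And>N Z e Ys. chaos N q Z \<Longrightarrow> irreducible N q e Z \<Longrightarrow> 0 \<le> e \<Longrightarrow> length Ys = m \<Longrightarrow>
    (\<forall>Y\<in>set Ys. polyfun N q Y \<and> Ex (\<lambda>x. (Y x)\<^sup>2) \<le> K) \<Longrightarrow>
    Ex (\<lambda>x. (contract N q Z (\<lambda>x. \<Prod>Y\<leftarrow>Ys. Y x) x - wick_sum N q Z Ys x)\<^sup>2) \<le> C * e"
    using contract_prod_list_approx[OF assms, of m q] by blast
  show ?thesis
  proof (intro exI[of _ C] conjI allI impI C(1))
    fix N Z e Ys
    assume Z: "chaos N q Z" "irreducible N q e Z" "0 \<le> e" and len: "length Ys = m"
      and Ys: "\<forall>Y\<in>set Ys. polyfun N q Y \<and> Ex (\<lambda>x. (Y x)\<^sup>2) \<le> K"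
    let ?T = "contract N q Z" and ?S = "\<lambda>x. \<Prod>Y\<leftarrow>Ys. Y x"
    have Yp: "Y \<in> set Ys \<Longrightarrow> pfun N Y" for Y using Ys polyfun_imp_pfun by blast
    have Sp: "pfun N ?S" using Yp by (rule pfun_prod_list)
    have rp: "pfun N (\<lambda>x. \<Prod>Y\<leftarrow>remove_nth i Ys. Y x)" for i
      using Yp by (intro pfun_prod_list) (auto simp: remove_nth_def dest: in_set_takeD in_set_dropD)
    have Wp: "pfun N (wick_sum N q Z Ys)" using Ys by (intro polyfun_imp_pfun[OF polyfun_wick_sum]) auto
    \<comment> \<open>Every factor has degree at most that of \<open>Z\<close>, so its contraction
      is a constant and leaves the expectation.\<close>
    have eqc: "?T (Ys ! i) = (\<lambda>x. fact q * Ex (\<lambda>x. Z x * (Ys ! i) x))" if "i < m" for i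
      using that len Ys by (intro contract_eq_const[OF Z(1)]) auto
    have "wick_sum N q Z Ys = (\<lambda>x. \<Sum>i<m. (fact q * Ex (\<lambda>x. Z x * (Ys ! i) x)) * (\<Prod>Y\<leftarrow>remove_nth i Ys. Y x))"
      unfolding wick_sum_def len by (intro ext sum.cong refl) (simp add: eqc)
    then have "Ex (wick_sum N q Z Ys) = (\<Sum>i<m. Ex (\<lambda>x. (fact q * Ex (\<lambda>x. Z x * (Ys ! i) x)) * (\<Prod>Y\<leftarrow>remove_nth i Ys. Y x)))"
      using rp by (simp only:) (intro Ex_psum[of _ N] pfun_cmult)
    also have "\<dots> = fact q * (\<Sum>i<m. Ex (\<lambda>x. Z x * (Ys ! i) x) * Ex (\<lambda>x. \<Prod>Y\<leftarrow>remove_nth i Ys. Y x))"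
      by (simp only: Ex_cmult sum_distrib_left mult.assoc)
    finally have W: "Ex (wick_sum N q Z Ys) = \<dots>" .
    define D where "D = Ex (\<lambda>x. Z x * ?S x) - (\<Sum>i<m. Ex (\<lambda>x. Z x * (Ys ! i) x) * Ex (\<lambda>x. \<Prod>Y\<leftarrow>remove_nth i Ys. Y x))"
    have "Ex (\<lambda>x. ?T ?S x - wick_sum N q Z Ys x) = Ex (?T ?S) - Ex (wick_sum N q Z Ys)"
      by (intro Ex_pdiff[of N] pfun_contract Sp Wp)
    also have "\<dots> = fact q * D"
      unfolding W Ex_contract[OF Z(1) Sp] D_def by (simp add: right_diff_distrib)
    finally have D: "fact q * D = Ex (\<lambda>x. 1 * (?T ?S x - wick_sum N q Z Ys x))" by simp
    have "D\<^sup>2 \<le> (fact q * D)\<^sup>2"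
      unfolding power_mult_distrib by (simp add: mult_le_cancel_right1 one_le_power)
    also have "\<dots> \<le> Ex (\<lambda>x. 1\<^sup>2) * Ex (\<lambda>x. (?T ?S x - wick_sum N q Z Ys x)\<^sup>2)"
      unfolding D by (intro Ex_cauchy_schwarz[of N] pfun_intros pfun_contract Sp Wp)
    also have "\<dots> \<le> C * e" using C(2)[OF Z len Ys] by simp
    finally show "(Ex (\<lambda>x. Z x * ?S x) -
      (\<Sum>i<m. Ex (\<lambda>x. Z x * (Ys ! i) x) * Ex (\<lambda>x. \<Prod>Y\<leftarrow>remove_nth i Ys. Y x)))\<^sup>2 \<le> C * e"
      by (simp add: D_def)
  qed
qed

end

section \<open>Decomposition of polynomial sequences along an ultrafilter\<close>

definition ultrafilter :: "'b filter \<Rightarrow> bool" where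
  "ultrafilter U \<longleftrightarrow> U \<noteq> bot \<and> (\<forall>P. eventually P U \<or> eventually (\<lambda>x. \<not> P x) U)"

text \<open>Finer filters are smaller in the order of \<open>filter\<close>, so Zorn yields a
  minimal proper filter below \<open>F\<close>. A chain of proper filters is a base of its infimum,
  which is therefore proper; and adjoining a predicate whose negation does not hold eventually
  cannot change a minimal filter.\<close>

lemma ex_ultrafilter:
  assumes "F \<noteq> bot"
  shows "\<exists>U. ultrafilter U \<and> U \<le> F"
proof -
  define A where "A = {G. G \<noteq> bot \<and> G \<le> F}"
  have "\<exists>m\<in>A. \<forall>a\<in>A. a \<le> m \<longrightarrow> a = m"
  proof (rule predicate_Zorn)
    show "partial_order_on A (relation_of (\<lambda>x y. y \<le> x) A)"
      by (auto simp: partial_order_on_def preorder_on_def refl_on_def trans_def antisym_def relation_of_def)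
    fix C assume C: "C \<in> Chains (relation_of (\<lambda>x y. y \<le> x) A)"
    then have CA: "C \<subseteq> A" and chain: "\<And>a b. a \<in> C \<Longrightarrow> b \<in> C \<Longrightarrow> a \<le> b \<or> b \<le> a"
      by (auto simp: Chains_def relation_of_def)
    show "\<exists>u\<in>A. \<forall>a\<in>C. u \<le> a"
    proof (cases "C = {}")
      case True
      then show ?thesis using assms by (auto simp: A_def)
    next
      case False
      have "\<exists>x\<in>C. x \<le> inf a b" if "a \<in> C" "b \<in> C" for a b
        using chain[OF that] that by (metis inf.absorb1 inf.absorb2 order_refl)
      then have "eventually (\<lambda>_. False) (Inf C) \<longleftrightarrow> (\<exists>b\<in>C. eventually (\<lambda>_. False) b)"
        using False by (intro eventually_Inf_base) auto
      moreover have "b \<noteq> bot" if "b \<in> C" for b using CA that by (auto simp: A_def)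
      ultimately have "Inf C \<noteq> bot" by (auto simp: trivial_limit_def)
      moreover obtain c where "c \<in> C" using False by auto
      then have "Inf C \<le> F" using CA by (auto simp: A_def intro: Inf_lower2)
      ultimately show ?thesis by (intro bexI[of _ "Inf C"]) (auto simp: A_def intro: Inf_lower)
    qed
  qed
  then obtain m where m: "m \<noteq> bot" "m \<le> F" "\<And>a. a \<noteq> bot \<Longrightarrow> a \<le> m \<Longrightarrow> a = m"
    unfolding A_def using order_trans by blast
  have "eventually P m" if "\<not> eventually (\<lambda>x. \<not> P x) m" for P
  proof -
    have "inf m (principal {x. P x}) \<noteq> bot"
      using that by (auto simp: trivial_limit_def eventually_inf_principal)
    then have "inf m (principal {x. P x}) = m" by (intro m) auto
    moreover have "eventually P (inf m (principal {x. P x}))" by (simp add: eventually_inf_principal)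
    ultimately show ?thesis by simp
  qed
  then have "ultrafilter m" using m(1) unfolding ultrafilter_def by blast
  then show ?thesis using m(2) by blast
qed

lemma ultrafilter_not: "ultrafilter U \<Longrightarrow> \<not> eventually P U \<Longrightarrow> eventually (\<lambda>x. \<not> P x) U"
  by (auto simp: ultrafilter_def)

lemma ultrafilter_finite_choice:
  assumes "ultrafilter U" "finite S" "eventually (\<lambda>x. \<exists>k\<in>S. P k x) U"
  shows "\<exists>k\<in>S. eventually (P k) U"
proof (rule ccontr)
  assume "\<not> (\<exists>k\<in>S. eventually (P k) U)"
  then have "\<forall>k\<in>S. eventually (\<lambda>x. \<not> P k x) U" using ultrafilter_not[OF assms(1)] by blast
  then have "eventually (\<lambda>x. \<forall>k\<in>S. \<not> P k x) U" using assms(2) by (simp add: eventually_ball_finite)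
  with assms(3) have "eventually (\<lambda>x. False) U" by eventually_elim auto
  then show False using assms(1) by (auto simp: ultrafilter_def trivial_limit_def)
qed

text \<open>Compactness of \<open>{-B..B}\<close> gives a cluster point, and an ultrafilter
  converges to each of its cluster points.\<close>

lemma ultrafilter_convergent:
  fixes a :: "'b \<Rightarrow> real"
  assumes "ultrafilter U" "\<And>n. \<bar>a n\<bar> \<le> B"
  shows "\<exists>l. (a \<longlongrightarrow> l) U"
proof -
  have "filtermap a U \<noteq> bot" using assms(1) by (simp add: ultrafilter_def filtermap_bot_iff)
  moreover have "eventually (\<lambda>x. x \<in> {-B..B}) (filtermap a U)"
    using assms(2) by (auto simp: eventually_filtermap abs_le_iff minus_le_iff intro!: always_eventually)
  ultimately obtain l where l: "inf (nhds l) (filtermap a U) \<noteq> bot"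
    using compact_filter[of "{-B..B}"] compact_Icc by meson
  have "(a \<longlongrightarrow> l) U"
  proof (rule topological_tendstoI)
    fix S assume S: "open S" "l \<in> S"
    show "eventually (\<lambda>x. a x \<in> S) U"
    proof (rule ccontr)
      assume "\<not> eventually (\<lambda>x. a x \<in> S) U"
      then have "eventually (\<lambda>x. x \<notin> S) (filtermap a U)"
        using ultrafilter_not[OF assms(1)] by (auto simp: eventually_filtermap)
      moreover have "eventually (\<lambda>x. x \<in> S) (nhds l)" using S by (auto simp: eventually_nhds)
      ultimately have "eventually (\<lambda>x. False) (inf (nhds l) (filtermap a U))"
        unfolding eventually_inf by blast
      then show False using l by (simp add: trivial_limit_def)
    qed
  qed
  then show ?thesis by blast
qed

section \<open>Bounded polynomial sequences as elements of an ultraproduct\<close>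

locale gaussian_ultra = gaussian_seq M G for M :: "'a measure" and G +
  fixes U :: "nat filter" and Nv :: "nat \<Rightarrow> nat"
  assumes U: "ultrafilter U" and U_le: "U \<le> sequentially"
begin

lemma U_not_bot [simp]: "U \<noteq> bot"
  using U by (simp add: ultrafilter_def)

lemma U_sequentially: "eventually P sequentially \<Longrightarrow> eventually P U"
  using U_le by (auto simp: le_filter_def)

text \<open>Representatives, not classes. Degree and second moment are controlled for every
  \<open>n\<close>, so constructions that succeed only along \<open>U\<close> must fill in the other
  indices.\<close>

definition bseq :: "nat \<Rightarrow> (nat \<Rightarrow> (nat \<Rightarrow> real) \<Rightarrow> real) \<Rightarrow> bool" where
  "bseq d s \<longleftrightarrow> (\<forall>n. polyfun (Nv n) d (s n)) \<and> (\<exists>B. \<forall>n. Ex (\<lambda>x. (s n x)\<^sup>2) \<le> B)"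

lemma bseq_polyfun: "bseq d s \<Longrightarrow> polyfun (Nv n) d (s n)"
  and bseq_pfun: "bseq d s \<Longrightarrow> pfun (Nv n) (s n)"
  by (auto simp: bseq_def intro: polyfun_imp_pfun)

lemma bseq_bound:
  assumes "bseq d s"
  obtains B where "0 \<le> B" "\<And>n. Ex (\<lambda>x. (s n x)\<^sup>2) \<le> B"
proof -
  obtain B where "\<And>n. Ex (\<lambda>x. (s n x)\<^sup>2) \<le> B" using assms by (auto simp: bseq_def)
  then show ?thesis using Ex_square_nonneg order_trans by (intro that[of B]) blast+
qed

lemma bseqI:
  "(\<And>n. polyfun (Nv n) d (s n)) \<Longrightarrow> (\<And>n. Ex (\<lambda>x. (s n x)\<^sup>2) \<le> B) \<Longrightarrow> bseq d s"
  by (auto simp: bseq_def)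

lemma bseq_mono: "bseq d s \<Longrightarrow> d \<le> d' \<Longrightarrow> bseq d' s"
  by (auto simp: bseq_def intro: polyfun_mono)

lemma bseq_const: "bseq d (\<lambda>n x. c)"
  by (rule bseqI[of _ _ "c\<^sup>2"]) (auto intro: polyfun.const)

lemma bseq_add:
  assumes "bseq d s" "bseq d t"
  shows "bseq d (\<lambda>n x. s n x + t n x)"
proof -
  obtain B C where B: "\<And>n. Ex (\<lambda>x. (s n x)\<^sup>2) \<le> B" and C: "\<And>n. Ex (\<lambda>x. (t n x)\<^sup>2) \<le> C"
    using assms bseq_bound by metis
  show ?thesis
  proof (rule bseqI)
    show "Ex (\<lambda>x. (s n x + t n x)\<^sup>2) \<le> 2 * B + 2 * C" for n
      using Ex_square_add_le[OF bseq_pfun[OF assms(1)] bseq_pfun[OF assms(2)], of n] B[of n] C[of n] by simp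
  qed (intro polyfun.add bseq_polyfun assms)
qed

lemma bseq_cmult:
  assumes "bseq d s"
  shows "bseq d (\<lambda>n x. c * s n x)"
proof -
  obtain B where B: "\<And>n. Ex (\<lambda>x. (s n x)\<^sup>2) \<le> B" using assms bseq_bound by metis
  show ?thesis
  proof (rule bseqI)
    show "Ex (\<lambda>x. (c * s n x)\<^sup>2) \<le> c\<^sup>2 * B" for n
      unfolding power_mult_distrib Ex_cmult using B by (intro mult_left_mono) auto
  qed (intro polyfun_cmult bseq_polyfun assms)
qed

lemma bseq_diff: "bseq d s \<Longrightarrow> bseq d t \<Longrightarrow> bseq d (\<lambda>n x. s n x - t n x)"
  using bseq_add[OF _ bseq_cmult[of d t "-1"]] by simp

lemma bseq_mult:
  assumes "bseq d s" "bseq e t"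
  shows "bseq (d + e) (\<lambda>n x. s n x * t n x)"
proof -
  obtain B where B: "0 \<le> B" "\<And>n. Ex (\<lambda>x. (s n x)\<^sup>2) \<le> B" using assms(1) by (rule bseq_bound) blast
  obtain C where C: "0 \<le> C" "\<And>n. Ex (\<lambda>x. (t n x)\<^sup>2) \<le> C" using assms(2) by (rule bseq_bound) blast
  show ?thesis
  proof (rule bseqI)
    fix n
    show "polyfun (Nv n) (d + e) (\<lambda>x. s n x * t n x)" by (intro polyfun_mult bseq_polyfun assms)
    have "Ex (\<lambda>x. (s n x * t n x)\<^sup>2) \<le> 72 ^ (d + e) * Ex (\<lambda>x. (s n x)\<^sup>2) * Ex (\<lambda>x. (t n x)\<^sup>2)"
      by (rule Ex_square_mult_le[OF bseq_polyfun[OF assms(1)] bseq_polyfun[OF assms(2)]])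
    also have "\<dots> \<le> 72 ^ (d + e) * B * C" using B C by (intro mult_mono) auto
    finally show "Ex (\<lambda>x. (s n x * t n x)\<^sup>2) \<le> 72 ^ (d + e) * B * C" .
  qed
qed

lemma bseq_prod_list:
  "(\<And>s. s \<in> set ss \<Longrightarrow> \<exists>d. bseq d s) \<Longrightarrow> \<exists>d. bseq d (\<lambda>n x. \<Prod>s\<leftarrow>ss. s n x)"
proof (induction ss)
  case Nil
  then show ?case using bseq_const by auto
next
  case (Cons s ss)
  then obtain d e where "bseq d s" "bseq e (\<lambda>n x. \<Prod>s\<leftarrow>ss. s n x)" by fastforce
  from bseq_mult[OF this] show ?case by auto
qed

lemma Ex_bounded:
  assumes "bseq d s"
  shows "\<exists>B. \<forall>n. \<bar>Ex (s n)\<bar> \<le> B"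
proof -
  obtain B where B: "0 \<le> B" "\<And>n. Ex (\<lambda>x. (s n x)\<^sup>2) \<le> B" using assms by (rule bseq_bound) blast
  have "\<bar>Ex (s n)\<bar> \<le> 1 + B" for n
  proof -
    have "(Ex (\<lambda>x. 1 * s n x))\<^sup>2 \<le> Ex (\<lambda>x. 1\<^sup>2) * Ex (\<lambda>x. (s n x)\<^sup>2)"
      by (intro Ex_cauchy_schwarz[of "Nv n"] pfun_const bseq_pfun[OF assms])
    then have "\<bar>Ex (s n)\<bar>\<^sup>2 \<le> B" using B(2)[of n] by simp
    moreover have "\<bar>Ex (s n)\<bar> \<le> 1 + \<bar>Ex (s n)\<bar>\<^sup>2"
    proof -
      have "0 \<le> (\<bar>Ex (s n)\<bar> - 1)\<^sup>2" by simp
      then show ?thesis by (simp add: power2_diff)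
    qed
    ultimately show ?thesis by simp
  qed
  then show ?thesis by blast
qed

text \<open>On products this is the inner product of the ultraproduct; for bounded sequences the
  limit exists because \<open>U\<close> is an ultrafilter.\<close>

definition UEx :: "(nat \<Rightarrow> (nat \<Rightarrow> real) \<Rightarrow> real) \<Rightarrow> real" where
  "UEx s = Lim U (\<lambda>n. Ex (s n))"

lemma UEx_tendsto:
  assumes "bseq d s" shows "((\<lambda>n. Ex (s n)) \<longlongrightarrow> UEx s) U"
proof -
  obtain B where "\<And>n. \<bar>Ex (s n)\<bar> \<le> B" using Ex_bounded[OF assms] by blast
  then obtain l where "((\<lambda>n. Ex (s n)) \<longlongrightarrow> l) U"
    using ultrafilter_convergent[OF U, of "\<lambda>n. Ex (s n)" B] by blast
  then show ?thesis unfolding UEx_def by (simp add: tendsto_Lim)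
qed

lemma UEx_eqI: "((\<lambda>n. Ex (s n)) \<longlongrightarrow> l) U \<Longrightarrow> UEx s = l"
  unfolding UEx_def by (rule tendsto_Lim) auto

lemma UEx_add: "bseq d s \<Longrightarrow> bseq e t \<Longrightarrow> UEx (\<lambda>n x. s n x + t n x) = UEx s + UEx t"
proof (rule UEx_eqI)
  assume *: "bseq d s" "bseq e t"
  have "(\<lambda>n. Ex (\<lambda>x. s n x + t n x)) = (\<lambda>n. Ex (s n) + Ex (t n))"
    using * by (intro ext Ex_padd) (auto intro: bseq_pfun)
  then show "((\<lambda>n. Ex (\<lambda>x. s n x + t n x)) \<longlongrightarrow> UEx s + UEx t) U"
    using * by (auto intro: tendsto_add UEx_tendsto)
qed

lemma UEx_cmult: "bseq d s \<Longrightarrow> UEx (\<lambda>n x. c * s n x) = c * UEx s"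
  by (rule UEx_eqI) (auto simp: Ex_cmult intro: tendsto_mult UEx_tendsto)

lemma UEx_diff: "bseq d s \<Longrightarrow> bseq e t \<Longrightarrow> UEx (\<lambda>n x. s n x - t n x) = UEx s - UEx t"
  using UEx_add[OF _ bseq_cmult[of e t "-1"], of d s] UEx_cmult[of e t "-1"] by simp

lemma UEx_nonneg: "bseq d s \<Longrightarrow> (\<And>n x. 0 \<le> s n x) \<Longrightarrow> 0 \<le> UEx s"
  by (rule tendsto_lowerbound[OF UEx_tendsto]) (auto intro!: Ex_nonneg always_eventually)

lemma bseq_square: "bseq d s \<Longrightarrow> bseq (d + d) (\<lambda>n x. (s n x)\<^sup>2)"
  using bseq_mult[of d s d s] by (simp add: power2_eq_square)

lemma UEx_cauchy_schwarz:
  assumes "bseq d s" "bseq e t"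
  shows "(UEx (\<lambda>n x. s n x * t n x))\<^sup>2 \<le> UEx (\<lambda>n x. (s n x)\<^sup>2) * UEx (\<lambda>n x. (t n x)\<^sup>2)"
proof (rule tendsto_le[OF U_not_bot])
  show "((\<lambda>n. (Ex (\<lambda>x. s n x * t n x))\<^sup>2) \<longlongrightarrow> (UEx (\<lambda>n x. s n x * t n x))\<^sup>2) U"
    by (intro tendsto_power UEx_tendsto[OF bseq_mult[OF assms]])
  show "((\<lambda>n. Ex (\<lambda>x. (s n x)\<^sup>2) * Ex (\<lambda>x. (t n x)\<^sup>2)) \<longlongrightarrow> UEx (\<lambda>n x. (s n x)\<^sup>2) * UEx (\<lambda>n x. (t n x)\<^sup>2)) U"
    by (intro tendsto_mult UEx_tendsto[OF bseq_square[OF assms(1)]] UEx_tendsto[OF bseq_square[OF assms(2)]])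
qed (auto intro!: always_eventually Ex_cauchy_schwarz bseq_pfun[OF assms(1)] bseq_pfun[OF assms(2)])

text \<open>Chaos membership is exact for each \<open>n\<close>, whereas irreducibility holds in the
  limit only. At \<open>q = 1\<close> there is no splitting and the last condition is
  vacuous.\<close>

definition irr_seq :: "nat \<Rightarrow> (nat \<Rightarrow> (nat \<Rightarrow> real) \<Rightarrow> real) \<Rightarrow> bool" where
  "irr_seq q s \<longleftrightarrow> 1 \<le> q \<and> bseq q s \<and> (\<forall>n. chaos (Nv n) q (s n)) \<and>
    (\<forall>e>0. \<forall>\<^sub>F n in U. irreducible (Nv n) q e (s n))"

text \<open>The degree is formal and adds under products. Since irreducible sequences have order at
  least 1, it also bounds the degree of the expression as a polynomial in them.\<close>

inductive gen :: "nat \<Rightarrow> (nat \<Rightarrow> (nat \<Rightarrow> real) \<Rightarrow> real) \<Rightarrow> bool" where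
  const: "gen d (\<lambda>n x. c)"
| irr: "irr_seq q s \<Longrightarrow> q \<le> d \<Longrightarrow> gen d s"
| add: "gen d s \<Longrightarrow> gen d t \<Longrightarrow> gen d (\<lambda>n x. s n x + t n x)"
| mult: "gen d s \<Longrightarrow> gen e t \<Longrightarrow> gen (d + e) (\<lambda>n x. s n x * t n x)"

lemma gen_bseq: "gen d s \<Longrightarrow> bseq d s"
  by (induction rule: gen.induct)
    (auto simp: irr_seq_def intro: bseq_const bseq_add bseq_mult bseq_mono)

lemma gen_mono: "gen d s \<Longrightarrow> d \<le> d' \<Longrightarrow> gen d' s"
proof (induction arbitrary: d' rule: gen.induct)
  case (irr q s d)
  then show ?case by (auto intro: gen.irr)
next
  case (mult d s e t)
  have "gen (d + (d' - d)) (\<lambda>n x. s n x * t n x)" using mult by (intro gen.mult) auto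
  then show ?case using mult.prems by simp
qed (auto intro: gen.intros)

text \<open>The closure is taken with the same degree bound on the approximants; this is how the
  bound \<open>d\<close> reaches the limiting polynomial.\<close>

definition appr :: "nat \<Rightarrow> (nat \<Rightarrow> (nat \<Rightarrow> real) \<Rightarrow> real) \<Rightarrow> bool" where
  "appr d s \<longleftrightarrow> bseq d s \<and> (\<forall>e>0. \<exists>t. gen d t \<and> (\<forall>\<^sub>F n in U. Ex (\<lambda>x. (s n x - t n x)\<^sup>2) < e))"

lemma appr_bseq: "appr d s \<Longrightarrow> bseq d s"
  by (simp add: appr_def)

lemma apprD:
  assumes "appr d s" "e > 0"
  obtains t where "gen d t" "\<forall>\<^sub>F n in U. Ex (\<lambda>x. (s n x - t n x)\<^sup>2) < e"
  using assms by (auto simp: appr_def)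

lemma gen_appr: "gen d s \<Longrightarrow> appr d s"
  unfolding appr_def by (auto intro: gen_bseq intro!: exI[of _ s])

lemma appr_mono:
  assumes "appr d s" "d \<le> d'" shows "appr d' s"
  unfolding appr_def
proof (intro conjI allI impI)
  show "bseq d' s" using assms bseq_mono appr_bseq by blast
  fix e :: real assume "e > 0"
  then obtain t where "gen d t" "\<forall>\<^sub>F n in U. Ex (\<lambda>x. (s n x - t n x)\<^sup>2) < e" by (rule apprD[OF assms(1)])
  then show "\<exists>t. gen d' t \<and> (\<forall>\<^sub>F n in U. Ex (\<lambda>x. (s n x - t n x)\<^sup>2) < e)"
    using gen_mono assms(2) by blast
qed

lemma appr_closed:
  assumes "bseq d s" "\<And>e. e > 0 \<Longrightarrow> \<exists>t. appr d t \<and> (\<forall>\<^sub>F n in U. Ex (\<lambda>x. (s n x - t n x)\<^sup>2) < e)"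
  shows "appr d s"
  unfolding appr_def
proof (intro conjI allI impI assms(1))
  fix e :: real assume e: "e > 0"
  obtain t where t: "appr d t" "\<forall>\<^sub>F n in U. Ex (\<lambda>x. (s n x - t n x)\<^sup>2) < e / 4"
    using assms(2)[of "e / 4"] e by auto
  obtain g where g: "gen d g" "\<forall>\<^sub>F n in U. Ex (\<lambda>x. (t n x - g n x)\<^sup>2) < e / 4"
    using apprD[OF t(1), of "e / 4"] e by auto
  have "Ex (\<lambda>x. (s n x - g n x)\<^sup>2) \<le> 2 * Ex (\<lambda>x. (s n x - t n x)\<^sup>2) + 2 * Ex (\<lambda>x. (t n x - g n x)\<^sup>2)" for n
    using Ex_square_add_le[of "Nv n" "\<lambda>x. s n x - t n x" "\<lambda>x. t n x - g n x"]
      bseq_pfun[OF assms(1)] bseq_pfun[OF appr_bseq[OF t(1)]] bseq_pfun[OF gen_bseq[OF g(1)]]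
    by (auto simp: pfun_diff)
  note le = this
  have "\<forall>\<^sub>F n in U. Ex (\<lambda>x. (s n x - g n x)\<^sup>2) < e"
    using t(2) g(2)
  proof eventually_elim
    case (elim n)
    then show ?case using le[of n] by linarith
  qed
  then show "\<exists>t. gen d t \<and> (\<forall>\<^sub>F n in U. Ex (\<lambda>x. (s n x - t n x)\<^sup>2) < e)" using g(1) by blast
qed

lemma appr_add:
  assumes "appr d s" "appr d t"
  shows "appr d (\<lambda>n x. s n x + t n x)"
  unfolding appr_def
proof (intro conjI allI impI)
  show "bseq d (\<lambda>n x. s n x + t n x)" using assms bseq_add appr_bseq by blast
  fix e :: real assume "e > 0"
  then have e: "e / 4 > 0" by simp
  obtain g where g: "gen d g" "\<forall>\<^sub>F n in U. Ex (\<lambda>x. (s n x - g n x)\<^sup>2) < e / 4"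
    using apprD[OF assms(1) e] .
  obtain h where h: "gen d h" "\<forall>\<^sub>F n in U. Ex (\<lambda>x. (t n x - h n x)\<^sup>2) < e / 4"
    using apprD[OF assms(2) e] .
  have "Ex (\<lambda>x. (s n x + t n x - (g n x + h n x))\<^sup>2) \<le> 2 * Ex (\<lambda>x. (s n x - g n x)\<^sup>2) + 2 * Ex (\<lambda>x. (t n x - h n x)\<^sup>2)" for n
    using Ex_square_add_le[OF
        pfun_diff[OF bseq_pfun[OF appr_bseq[OF assms(1)]] bseq_pfun[OF gen_bseq[OF g(1)]]]
        pfun_diff[OF bseq_pfun[OF appr_bseq[OF assms(2)]] bseq_pfun[OF gen_bseq[OF h(1)]]], of n]
    by (simp add: add_diff_add)
  note le = this
  have "\<forall>\<^sub>F n in U. Ex (\<lambda>x. (s n x + t n x - (g n x + h n x))\<^sup>2) < e"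
    using h(2) g(2)
  proof eventually_elim
    case (elim n)
    then show ?case using le[of n] by linarith
  qed
  then show "\<exists>t'. gen d t' \<and> (\<forall>\<^sub>F n in U. Ex (\<lambda>x. (s n x + t n x - t' n x)\<^sup>2) < e)"
    using gen.add[OF g(1) h(1)] by blast
qed

text \<open>Uses \<open>s * t - g * h = s * (t - h) + (s - g) * h\<close> and continuity of
  multiplication by hypercontractivity.\<close>

lemma appr_mult:
  assumes "appr d s" "appr e t"
  shows "appr (d + e) (\<lambda>n x. s n x * t n x)"
  unfolding appr_def
proof (intro conjI allI impI)
  show "bseq (d + e) (\<lambda>n x. s n x * t n x)" using assms bseq_mult appr_bseq by blast
  fix r :: real assume r: "r > 0"
  note s = appr_bseq[OF assms(1)] and t = appr_bseq[OF assms(2)]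
  obtain B where B: "0 \<le> B" "\<And>n. Ex (\<lambda>x. (s n x)\<^sup>2) \<le> B" using s by (rule bseq_bound) blast
  obtain C where C: "0 \<le> C" "\<And>n. Ex (\<lambda>x. (t n x)\<^sup>2) \<le> C" using t by (rule bseq_bound) blast
  \<comment> \<open>\<open>2 * C + 2\<close> bounds the second moment of \<open>h\<close>, whose
    squared distance to \<open>t\<close> is below \<open>e' \<le> 1\<close>.\<close>
  define K where "K = 72 ^ (d + e) * 2 * (B + (2 * C + 2))"
  have K: "K > 0" using B C by (auto simp: K_def intro!: mult_pos_pos)
  define e' where "e' = min 1 (r / K)"
  have e': "0 < e'" "e' \<le> 1" "K * e' \<le> r" using r K by (auto simp: e'_def min_def field_simps)
  obtain g where g: "gen d g" "\<forall>\<^sub>F n in U. Ex (\<lambda>x. (s n x - g n x)\<^sup>2) < e'" using apprD[OF assms(1) e'(1)] .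
  obtain h where h: "gen e h" "\<forall>\<^sub>F n in U. Ex (\<lambda>x. (t n x - h n x)\<^sup>2) < e'" using apprD[OF assms(2) e'(1)] .
  note gb = gen_bseq[OF g(1)] and hb = gen_bseq[OF h(1)]
  have "Ex (\<lambda>x. (s n x * t n x - g n x * h n x)\<^sup>2) < r"
    if n: "Ex (\<lambda>x. (s n x - g n x)\<^sup>2) < e'" "Ex (\<lambda>x. (t n x - h n x)\<^sup>2) < e'" for n
  proof -
    note pf = bseq_pfun[OF s] bseq_pfun[OF t] bseq_pfun[OF gb] bseq_pfun[OF hb]
    have "Ex (\<lambda>x. (t n x + (- 1) * (t n x - h n x))\<^sup>2) \<le>
      2 * Ex (\<lambda>x. (t n x)\<^sup>2) + 2 * Ex (\<lambda>x. ((- 1) * (t n x - h n x))\<^sup>2)"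
      using pf by (intro Ex_square_add_le[of "Nv n"] pfun_cmult pfun_diff)
    then have hC: "Ex (\<lambda>x. (h n x)\<^sup>2) \<le> 2 * C + 2"
      using C(2)[of n] n(2) e'(2) by (simp add: power2_commute)
    have "Ex (\<lambda>x. (s n x * t n x - g n x * h n x)\<^sup>2) =
        Ex (\<lambda>x. (s n x * (t n x - h n x) + (s n x - g n x) * h n x)\<^sup>2)" by (simp add: algebra_simps)
    also have "\<dots> \<le> 2 * Ex (\<lambda>x. (s n x * (t n x - h n x))\<^sup>2) + 2 * Ex (\<lambda>x. ((s n x - g n x) * h n x)\<^sup>2)"
      using pf by (intro Ex_square_add_le[of "Nv n"] pfun_intros)
    also have "Ex (\<lambda>x. (s n x * (t n x - h n x))\<^sup>2) \<le> 72 ^ (d + e) * Ex (\<lambda>x. (s n x)\<^sup>2) * Ex (\<lambda>x. (t n x - h n x)\<^sup>2)"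
      by (rule Ex_square_mult_le[OF bseq_polyfun[OF s] bseq_polyfun[OF bseq_diff[OF t hb]]])
    also have "\<dots> \<le> 72 ^ (d + e) * B * e'" using B n by (intro mult_mono) auto
    also have "Ex (\<lambda>x. ((s n x - g n x) * h n x)\<^sup>2) \<le> 72 ^ (d + e) * Ex (\<lambda>x. (s n x - g n x)\<^sup>2) * Ex (\<lambda>x. (h n x)\<^sup>2)"
      by (rule Ex_square_mult_le[OF bseq_polyfun[OF bseq_diff[OF s gb]] bseq_polyfun[OF hb]])
    finally have 1: "Ex (\<lambda>x. (s n x * t n x - g n x * h n x)\<^sup>2) \<le>
        2 * (72 ^ (d + e) * B * e') + 2 * (72 ^ (d + e) * Ex (\<lambda>x. (s n x - g n x)\<^sup>2) * Ex (\<lambda>x. (h n x)\<^sup>2))"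
      by simp
    have "72 ^ (d + e) * Ex (\<lambda>x. (s n x - g n x)\<^sup>2) * Ex (\<lambda>x. (h n x)\<^sup>2) \<le> 72 ^ (d + e) * Ex (\<lambda>x. (s n x - g n x)\<^sup>2) * (2 * C + 2)"
      using hC by (intro mult_left_mono) auto
    also have "\<dots> < 72 ^ (d + e) * e' * (2 * C + 2)"
      using n C(1) by (intro mult_strict_right_mono mult_strict_left_mono) auto
    finally have "Ex (\<lambda>x. (s n x * t n x - g n x * h n x)\<^sup>2) < K * e'"
      using 1 by (simp add: K_def algebra_simps)
    then show ?thesis using e'(3) by simp
  qed
  note lt = this
  have "\<forall>\<^sub>F n in U. Ex (\<lambda>x. (s n x * t n x - g n x * h n x)\<^sup>2) < r"
    using g(2) h(2) by eventually_elim (rule lt)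
  then show "\<exists>t'. gen (d + e) t' \<and> (\<forall>\<^sub>F n in U. Ex (\<lambda>x. (s n x * t n x - t' n x)\<^sup>2) < r)"
    using gen.mult[OF g(1) h(1)] by blast
qed

lemma appr_cmult: "appr d s \<Longrightarrow> appr d (\<lambda>n x. c * s n x)"
  using appr_mult[OF gen_appr[OF gen.const[of 0 c]]] by simp

text \<open>Completeness of the ultraproduct, by a diagonal argument.\<close>

lemma bseq_complete:
  assumes A: "\<And>k. bseq d (A k)"
    and cauchy: "\<And>i j. i \<le> j \<Longrightarrow> \<forall>\<^sub>F n in U. Ex (\<lambda>x. (A i n x - A j n x)\<^sup>2) < (1/4) ^ i"
  obtains L where "bseq d L" "\<And>i. \<forall>\<^sub>F n in U. Ex (\<lambda>x. (A i n x - L n x)\<^sup>2) < (1/4) ^ i"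
proof -
  define good where "good n k \<longleftrightarrow> (\<forall>j\<le>k. \<forall>i\<le>j. Ex (\<lambda>x. (A i n x - A j n x)\<^sup>2) < (1/4) ^ i)" for n k
  \<comment> \<open>The diagonal index: the last level up to which the Cauchy estimates hold at
    \<open>n\<close>, capped by \<open>n\<close> so that the maximum exists. It exceeds every fixed
    level along \<open>U\<close>.\<close>
  define kk where "kk n = (GREATEST k. k \<le> n \<and> good n k)" for n
  have good0: "good n 0" for n by (simp add: good_def)
  have kk: "kk n \<le> n \<and> good n (kk n)" for n
    unfolding kk_def by (rule GreatestI_nat[of _ 0 n]) (auto simp: good0)
  have kk_ge: "m \<le> kk n" if "m \<le> n" "good n m" for m n
    unfolding kk_def using that by (intro Greatest_le_nat[of _ _ n]) auto
  have ev_good: "\<forall>\<^sub>F n in U. good n m" for m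
  proof -
    have "\<forall>\<^sub>F n in U. \<forall>j\<in>{..m}. \<forall>i\<in>{..j}. Ex (\<lambda>x. (A i n x - A j n x)\<^sup>2) < (1/4) ^ i"
      using cauchy by (intro eventually_ball_finite ballI) auto
    then show ?thesis by (simp add: good_def Ball_def)
  qed
  define L where "L n = A (kk n) n" for n
  obtain B where B: "0 \<le> B" "\<And>n. Ex (\<lambda>x. (A 0 n x)\<^sup>2) \<le> B" using A[of 0] by (rule bseq_bound) blast
  show ?thesis
  proof (rule that[of L])
    show "bseq d L"
    proof (rule bseqI)
      show "polyfun (Nv n) d (L n)" for n unfolding L_def by (rule bseq_polyfun[OF A])
      show "Ex (\<lambda>x. (L n x)\<^sup>2) \<le> 2 * B + 2" for n
      proof -
        have "Ex (\<lambda>x. (A 0 n x - L n x)\<^sup>2) < (1/4) ^ 0"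
          using kk[of n] unfolding good_def L_def by blast
        moreover have "Ex (\<lambda>x. (A 0 n x + (- 1) * (A 0 n x - L n x))\<^sup>2) \<le>
            2 * Ex (\<lambda>x. (A 0 n x)\<^sup>2) + 2 * Ex (\<lambda>x. ((- 1) * (A 0 n x - L n x))\<^sup>2)"
          unfolding L_def by (intro Ex_square_add_le[of "Nv n"] pfun_cmult pfun_diff bseq_pfun[OF A])
        ultimately show ?thesis using B(2)[of n] by (simp add: power2_commute)
      qed
    qed
    fix i
    have "\<forall>\<^sub>F n in U. i \<le> n" by (rule U_sequentially) (rule eventually_ge_at_top)
    then show "\<forall>\<^sub>F n in U. Ex (\<lambda>x. (A i n x - L n x)\<^sup>2) < (1/4) ^ i"
      using ev_good[of i]
    proof eventually_elim
      case (elim n)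
      then have "i \<le> kk n" by (rule kk_ge)
      then show ?case using kk[of n] unfolding good_def L_def by blast
    qed
  qed
qed

lemma UEx_square_diff:
  assumes "bseq d s" "bseq d t"
  shows "UEx (\<lambda>n x. (s n x - c * t n x)\<^sup>2) =
    UEx (\<lambda>n x. (s n x)\<^sup>2) - 2 * c * UEx (\<lambda>n x. s n x * t n x) + c\<^sup>2 * UEx (\<lambda>n x. (t n x)\<^sup>2)"
proof -
  have "UEx (\<lambda>n x. (s n x - c * t n x)\<^sup>2) =
      UEx (\<lambda>n x. ((s n x)\<^sup>2 + (- 2 * c) * (s n x * t n x)) + c\<^sup>2 * (t n x)\<^sup>2)"
    by (simp add: power2_diff power_mult_distrib algebra_simps)
  also have "\<dots> = UEx (\<lambda>n x. (s n x)\<^sup>2 + (- 2 * c) * (s n x * t n x)) + UEx (\<lambda>n x. c\<^sup>2 * (t n x)\<^sup>2)"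
    by (intro UEx_add[of "d + d" _ "d + d"] bseq_add bseq_cmult bseq_square bseq_mult assms)
  also have "UEx (\<lambda>n x. (s n x)\<^sup>2 + (- 2 * c) * (s n x * t n x)) = UEx (\<lambda>n x. (s n x)\<^sup>2) + UEx (\<lambda>n x. (- 2 * c) * (s n x * t n x))"
    by (intro UEx_add[of "d + d" _ "d + d"] bseq_cmult bseq_square bseq_mult assms)
  also have "UEx (\<lambda>n x. (- 2 * c) * (s n x * t n x)) = (- 2 * c) * UEx (\<lambda>n x. s n x * t n x)"
    by (rule UEx_cmult[OF bseq_mult[OF assms]])
  also have "UEx (\<lambda>n x. c\<^sup>2 * (t n x)\<^sup>2) = c\<^sup>2 * UEx (\<lambda>n x. (t n x)\<^sup>2)"
    by (rule UEx_cmult[OF bseq_square[OF assms(2)]])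
  finally show ?thesis by simp
qed

text \<open>Hilbert space projection for the limiting seminorm: a minimising sequence is Cauchy by
  the parallelogram identity, and completeness supplies the minimiser.\<close>

lemma appr_projection:
  assumes F: "bseq d F"
  obtains A where "appr d A" "\<And>t. appr d t \<Longrightarrow> UEx (\<lambda>n x. (F n x - A n x) * t n x) = 0"
proof -
  define \<phi> where "\<phi> A = UEx (\<lambda>n x. (F n x - A n x)\<^sup>2)" for A
  define c where "c = Inf (\<phi> ` {A. appr d A})"
  have bdiff: "bseq d (\<lambda>n x. F n x - A n x)" if "appr d A" for A
    using that F bseq_diff appr_bseq by blast
  have \<phi>0: "0 \<le> \<phi> A" if "appr d A" for A
    unfolding \<phi>_def by (intro UEx_nonneg[OF bseq_square[OF bdiff[OF that]]]) auto
  have bdd: "bdd_below (\<phi> ` {A. appr d A})" using \<phi>0 by (auto intro!: bdd_belowI[of _ 0])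
  have c_le: "c \<le> \<phi> A" if "appr d A" for A
    unfolding c_def using bdd that by (intro cInf_lower) auto
  have ex: "\<exists>A. appr d A \<and> \<phi> A < c + (1/4) ^ k / 8" for k
  proof -
    have "appr d (\<lambda>n x. 0)" by (intro gen_appr gen.const)
    then have "\<phi> ` {A. appr d A} \<noteq> {}" by (metis (mono_tags) empty_iff image_eqI mem_Collect_eq)
    moreover have "Inf (\<phi> ` {A. appr d A}) < c + (1/4) ^ k / 8" by (simp add: c_def)
    ultimately have "\<exists>x\<in>\<phi> ` {A. appr d A}. x < c + (1/4) ^ k / 8" by (rule cInf_lessD)
    then show ?thesis by (elim bexE imageE) auto
  qed
  define A where "A k = (SOME A. appr d A \<and> \<phi> A < c + (1/4) ^ k / 8)" for k
  have A': "appr d (A k) \<and> \<phi> (A k) < c + (1/4) ^ k / 8" for k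
    unfolding A_def by (rule someI_ex[OF ex])
  have A: "appr d (A k)" "\<phi> (A k) < c + (1/4) ^ k / 8" for k
    using A'[of k] by auto
  note Ab = appr_bseq[OF A(1)]
  have cauchy: "\<forall>\<^sub>F n in U. Ex (\<lambda>x. (A i n x - A j n x)\<^sup>2) < (1/4) ^ i" if "i \<le> j" for i j
  proof -
    define m where "m = (\<lambda>n x. (1/2) * (A i n x + A j n x))"
    have m: "appr d m" unfolding m_def by (rule appr_cmult[OF appr_add[OF A(1) A(1)]])
    have "Ex (\<lambda>x. (A i n x - A j n x)\<^sup>2) =
        2 * Ex (\<lambda>x. (F n x - A i n x)\<^sup>2) + 2 * Ex (\<lambda>x. (F n x - A j n x)\<^sup>2) - 4 * Ex (\<lambda>x. (F n x - m n x)\<^sup>2)" for n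
    proof -
      note pf = bseq_pfun[OF F] bseq_pfun[OF Ab] bseq_pfun[OF appr_bseq[OF m]]
      have "Ex (\<lambda>x. (A i n x - A j n x)\<^sup>2) = Ex (\<lambda>x. (2 * (F n x - A i n x)\<^sup>2 + 2 * (F n x - A j n x)\<^sup>2) - 4 * (F n x - m n x)\<^sup>2)"
      proof (rule arg_cong[of _ _ Ex], rule ext)
        fix x
        have "4 * (F n x - m n x)\<^sup>2 = (2 * F n x - (A i n x + A j n x))\<^sup>2"
          by (simp add: m_def power2_eq_square field_simps)
        then show "(A i n x - A j n x)\<^sup>2 = (2 * (F n x - A i n x)\<^sup>2 + 2 * (F n x - A j n x)\<^sup>2) - 4 * (F n x - m n x)\<^sup>2"
          by (simp add: power2_eq_square algebra_simps)
      qed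
      also have "\<dots> = Ex (\<lambda>x. 2 * (F n x - A i n x)\<^sup>2 + 2 * (F n x - A j n x)\<^sup>2) - Ex (\<lambda>x. 4 * (F n x - m n x)\<^sup>2)"
        using pf by (intro Ex_pdiff[of "Nv n"] pfun_intros)
      also have "Ex (\<lambda>x. 2 * (F n x - A i n x)\<^sup>2 + 2 * (F n x - A j n x)\<^sup>2) =
          Ex (\<lambda>x. 2 * (F n x - A i n x)\<^sup>2) + Ex (\<lambda>x. 2 * (F n x - A j n x)\<^sup>2)"
        using pf by (intro Ex_padd[of "Nv n"] pfun_intros)
      finally show ?thesis by (simp only: Ex_cmult)
    qed
    moreover have "((\<lambda>n. 2 * Ex (\<lambda>x. (F n x - A i n x)\<^sup>2) + 2 * Ex (\<lambda>x. (F n x - A j n x)\<^sup>2) - 4 * Ex (\<lambda>x. (F n x - m n x)\<^sup>2))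
        \<longlongrightarrow> 2 * \<phi> (A i) + 2 * \<phi> (A j) - 4 * \<phi> m) U"
      unfolding \<phi>_def by (intro tendsto_intros UEx_tendsto[OF bseq_square[OF bdiff]] A m)
    ultimately have lim: "((\<lambda>n. Ex (\<lambda>x. (A i n x - A j n x)\<^sup>2)) \<longlongrightarrow> 2 * \<phi> (A i) + 2 * \<phi> (A j) - 4 * \<phi> m) U"
      by simp
    have "(1/4::real) ^ j \<le> (1/4) ^ i" using that by (intro power_decreasing) auto
    \<comment> \<open>The slacks of \<open>1/8\<close> at \<open>i\<close> and \<open>j\<close>,
      each doubled, sum to at most \<open>(1/4) ^ i / 2\<close>.\<close>
    then have "2 * \<phi> (A i) + 2 * \<phi> (A j) - 4 * \<phi> m < (1/4) ^ i"
      using A(2)[of i] A(2)[of j] c_le[OF m] zero_less_power[of "1/4::real" i] by linarith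
    then show ?thesis using order_tendstoD(2)[OF lim] by blast
  qed
  obtain L where L: "bseq d L" "\<And>i. \<forall>\<^sub>F n in U. Ex (\<lambda>x. (A i n x - L n x)\<^sup>2) < (1/4) ^ i"
    using bseq_complete[OF Ab cauchy] by blast
  have lim0: "(\<lambda>k. (1/4::real) ^ k) \<longlonglongrightarrow> 0" by (intro LIMSEQ_realpow_zero) auto
  have "appr d L"
  proof (rule appr_closed[OF L(1)])
    fix e :: real assume "e > 0"
    then obtain k where "(1/4) ^ k < e"
      using order_tendstoD(2)[OF lim0] by (auto simp: eventually_sequentially)
    then have "\<forall>\<^sub>F n in U. Ex (\<lambda>x. (L n x - A k n x)\<^sup>2) < e"
      using L(2)[of k] by (auto elim!: eventually_mono simp: power2_commute)
    then show "\<exists>t. appr d t \<and> (\<forall>\<^sub>F n in U. Ex (\<lambda>x. (L n x - t n x)\<^sup>2) < e)" using A(1) by blast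
  qed
  moreover have "UEx (\<lambda>n x. (F n x - L n x) * t n x) = 0" if t: "appr d t" for t
  proof -
    note tb = appr_bseq[OF t]
    define T where "T = UEx (\<lambda>n x. (t n x)\<^sup>2)"
    have T0: "0 \<le> T" unfolding T_def by (intro UEx_nonneg[OF bseq_square[OF tb]]) auto
    define I where "I = UEx (\<lambda>n x. (F n x - L n x) * t n x)"
    have bound: "I\<^sup>2 \<le> (4 * T) * (1/4) ^ k" for k
    proof -
      define J where "J = UEx (\<lambda>n x. (F n x - A k n x) * t n x)"
      define J' where "J' = UEx (\<lambda>n x. (A k n x - L n x) * t n x)"
      \<comment> \<open>Moving \<open>A k\<close> by a multiple of \<open>t\<close> stays admissible
        and cannot fall below the infimum; the discriminant of this quadratic in \<open>a\<close>
        bounds \<open>J\<close>.\<close>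
      have "0 \<le> (1/4) ^ k / 8 + 2 * a * J + a\<^sup>2 * T" for a
      proof -
        have "appr d (\<lambda>n x. A k n x + (- a) * t n x)" by (rule appr_add[OF A(1) appr_cmult[OF t]])
        from c_le[OF this] have "c \<le> UEx (\<lambda>n x. ((F n x - A k n x) - (- a) * t n x)\<^sup>2)"
          by (simp add: \<phi>_def algebra_simps)
        also have "\<dots> = \<phi> (A k) + 2 * a * J + a\<^sup>2 * T"
          unfolding UEx_square_diff[OF bdiff[OF A(1)] tb] \<phi>_def J_def T_def by simp
        finally show ?thesis using A(2)[of k] by linarith
      qed
      then have "J\<^sup>2 \<le> (1/4) ^ k / 8 * T" by (rule quadratic_nonneg_imp_discriminant)
      also have "\<dots> \<le> (1/4) ^ k * T" using T0 by (intro mult_right_mono) auto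
      finally have J: "J\<^sup>2 \<le> (1/4) ^ k * T" .
      have bAL: "bseq d (\<lambda>n x. A k n x - L n x)" by (rule bseq_diff[OF Ab L(1)])
      have "UEx (\<lambda>n x. (A k n x - L n x)\<^sup>2) \<le> (1/4) ^ k"
        by (rule tendsto_upperbound[OF UEx_tendsto[OF bseq_square[OF bAL]] _ U_not_bot],
            rule eventually_mono[OF L(2)[of k]]) simp
      then have J': "J'\<^sup>2 \<le> (1/4) ^ k * T"
        using UEx_cauchy_schwarz[OF bAL tb] T0 mult_right_mono[of _ "(1/4) ^ k" T]
        unfolding J'_def T_def by fastforce
      have "I = UEx (\<lambda>n x. (F n x - A k n x) * t n x + (A k n x - L n x) * t n x)"
        unfolding I_def by (simp add: algebra_simps)
      also have "\<dots> = J + J'"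
        unfolding J_def J'_def by (rule UEx_add[OF bseq_mult[OF bdiff[OF A(1)] tb] bseq_mult[OF bAL tb]])
      finally have "I\<^sup>2 \<le> 2 * J\<^sup>2 + 2 * J'\<^sup>2"
        using sum_squares_bound[of J J'] by (simp add: power2_sum)
      then have "I\<^sup>2 \<le> 4 * ((1/4) ^ k * T)" using J J' by linarith
      then show ?thesis by (simp only: mult_ac)
    qed
    have "(\<lambda>k. (4 * T) * (1/4) ^ k) \<longlonglongrightarrow> (4 * T) * 0" by (intro tendsto_mult tendsto_const lim0)
    then have "I\<^sup>2 \<le> 0" using bound by (intro LIMSEQ_le_const[where X = "\<lambda>k. (4 * T) * (1/4) ^ k"]) auto
    then show ?thesis by (simp add: I_def)
  qed
  ultimately show ?thesis by (rule that)
qed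

text \<open>If irreducibility failed along \<open>U\<close>, normalised factors of smaller degree
  would pair with \<open>Z\<close> by a fixed amount. By induction they lie in the closure, hence so
  does their product, to which \<open>Z\<close> is orthogonal.\<close>

lemma orth_appr_irr_seq:
  assumes Z: "bseq d Z" "\<And>n. chaos (Nv n) d (Z n)" "1 \<le> d"
    and orth: "\<And>t. appr d t \<Longrightarrow> UEx (\<lambda>n x. Z n x * t n x) = 0"
    and IH: "\<And>k s. k < d \<Longrightarrow> bseq k s \<Longrightarrow> appr k s"
  shows "irr_seq d Z"
  unfolding irr_seq_def
proof (intro conjI allI impI Z(1,2,3))
  fix e :: real assume e: "e > 0"
  show "\<forall>\<^sub>F n in U. irreducible (Nv n) d e (Z n)"
  proof (rule ccontr)
    assume "\<not> (\<forall>\<^sub>F n in U. irreducible (Nv n) d e (Z n))"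
    then have "\<forall>\<^sub>F n in U. \<not> irreducible (Nv n) d e (Z n)" by (rule ultrafilter_not[OF U])
    then have "\<forall>\<^sub>F n in U. \<exists>k\<in>{1..<d}. \<exists>P Q. polyfun (Nv n) k P \<and> polyfun (Nv n) (d - k) Q \<and>
        e * Ex (\<lambda>x. (P x)\<^sup>2) * Ex (\<lambda>x. (Q x)\<^sup>2) < (Ex (\<lambda>x. Z n x * (P x * Q x)))\<^sup>2"
    proof eventually_elim
      case (elim n)
      then obtain k l P Q where "1 \<le> k" "1 \<le> l" "k + l = d" "polyfun (Nv n) k P" "polyfun (Nv n) l Q"
        "e * Ex (\<lambda>x. (P x)\<^sup>2) * Ex (\<lambda>x. (Q x)\<^sup>2) < (Ex (\<lambda>x. Z n x * (P x * Q x)))\<^sup>2"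
        unfolding irreducible_def by (auto simp: not_le)
      then show ?case by (intro bexI[of _ k] exI[of _ P] exI[of _ Q]) auto
    qed
    \<comment> \<open>The ultrafilter selects one of the finitely many splittings, so that the
      factors form sequences of fixed degrees.\<close>
    then obtain k where k: "k \<in> {1..<d}" and ev: "\<forall>\<^sub>F n in U. \<exists>P Q. polyfun (Nv n) k P \<and> polyfun (Nv n) (d - k) Q \<and>
        e * Ex (\<lambda>x. (P x)\<^sup>2) * Ex (\<lambda>x. (Q x)\<^sup>2) < (Ex (\<lambda>x. Z n x * (P x * Q x)))\<^sup>2"
      using ultrafilter_finite_choice[OF U finite_atLeastLessThan, of 1 d "\<lambda>k n. \<exists>P Q. polyfun (Nv n) k P \<and>
        polyfun (Nv n) (d - k) Q \<and> e * Ex (\<lambda>x. (P x)\<^sup>2) * Ex (\<lambda>x. (Q x)\<^sup>2) < (Ex (\<lambda>x. Z n x * (P x * Q x)))\<^sup>2"]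
      by blast
    define good where "good n PQ \<longleftrightarrow> polyfun (Nv n) k (fst PQ) \<and> polyfun (Nv n) (d - k) (snd PQ) \<and>
      Ex (\<lambda>x. (fst PQ x)\<^sup>2) = 1 \<and> Ex (\<lambda>x. (snd PQ x)\<^sup>2) = 1 \<and> e < (Ex (\<lambda>x. Z n x * (fst PQ x * snd PQ x)))\<^sup>2" for n PQ
    have ev2: "\<forall>\<^sub>F n in U. \<exists>PQ. good n PQ"
      using ev
    proof eventually_elim
      case (elim n)
      then obtain P Q where PQ: "polyfun (Nv n) k P" "polyfun (Nv n) (d - k) Q"
        "e * Ex (\<lambda>x. (P x)\<^sup>2) * Ex (\<lambda>x. (Q x)\<^sup>2) < (Ex (\<lambda>x. Z n x * (P x * Q x)))\<^sup>2" by blast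
      note pf = polyfun_imp_pfun[OF PQ(1)] polyfun_imp_pfun[OF PQ(2)] bseq_pfun[OF Z(1)]
      define p where "p = Ex (\<lambda>x. (P x)\<^sup>2)"
      define r where "r = Ex (\<lambda>x. (Q x)\<^sup>2)"
      \<comment> \<open>The violated inequality is strict, while a factor of zero second moment
        would make both sides 0.\<close>
      have "p \<noteq> 0"
      proof
        assume "p = 0"
        then have "Ex (\<lambda>x. P x * (Z n x * Q x)) = 0"
          unfolding p_def using pf by (intro Ex_mult_eq_0[of "Nv n"] pfun_mult)
        then show False using PQ(3) \<open>p = 0\<close> by (simp add: p_def mult.left_commute)
      qed
      moreover have "r \<noteq> 0"
      proof
        assume "r = 0"
        then have "Ex (\<lambda>x. Q x * (Z n x * P x)) = 0"
          unfolding r_def using pf by (intro Ex_mult_eq_0[of "Nv n"] pfun_mult)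
        then show False using PQ(3) \<open>r = 0\<close> by (simp add: r_def mult_ac)
      qed
      ultimately have pr: "p > 0" "r > 0" by (auto simp: p_def r_def less_le)
      have 1: "Ex (\<lambda>x. (1 / sqrt p * P x)\<^sup>2) = 1" "Ex (\<lambda>x. (1 / sqrt r * Q x)\<^sup>2) = 1"
        unfolding power_mult_distrib Ex_cmult using pr by (auto simp: p_def[symmetric] r_def[symmetric] power_divide)
      have "Ex (\<lambda>x. Z n x * ((1 / sqrt p * P x) * (1 / sqrt r * Q x))) =
          Ex (\<lambda>x. (1 / sqrt p * (1 / sqrt r)) * (Z n x * (P x * Q x)))" by (simp add: mult_ac)
      also have "\<dots> = (1 / sqrt p * (1 / sqrt r)) * Ex (\<lambda>x. Z n x * (P x * Q x))" by (rule Ex_cmult)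
      finally have "(Ex (\<lambda>x. Z n x * ((1 / sqrt p * P x) * (1 / sqrt r * Q x))))\<^sup>2 =
          (Ex (\<lambda>x. Z n x * (P x * Q x)))\<^sup>2 / (p * r)"
        using pr by (simp add: power_mult_distrib power_divide)
      also have "\<dots> > e" using PQ(3) pr by (simp add: field_simps p_def[symmetric] r_def[symmetric])
      finally show ?case
        using PQ(1,2) 1 by (intro exI[of _ "(\<lambda>x. 1 / sqrt p * P x, \<lambda>x. 1 / sqrt r * Q x)"])
          (auto simp: good_def simp del: times_divide_eq_left intro: polyfun_cmult)
    qed
    \<comment> \<open>Where no violating pair exists the zero pair is inserted, which keeps both
      sequences bounded for all \<open>n\<close>.\<close>
    define PQ where "PQ n = (if \<exists>PQ. good n PQ then SOME PQ. good n PQ else (\<lambda>x. 0, \<lambda>x. 0))" for n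
    have PQ: "good n (PQ n)" if "\<exists>PQ. good n PQ" for n
      unfolding PQ_def using that someI_ex[OF that] by simp
    have PQ0: "PQ n = (\<lambda>x. 0, \<lambda>x. 0)" if "\<not> (\<exists>PQ. good n PQ)" for n
      using that by (simp add: PQ_def)
    have "bseq k (\<lambda>n. fst (PQ n))"
    proof (rule bseqI[of _ _ 1])
      show "polyfun (Nv n) k (fst (PQ n))" for n
        using PQ[of n] PQ0[of n] by (cases "\<exists>PQ. good n PQ") (auto simp: good_def intro: polyfun.const)
      show "Ex (\<lambda>x. (fst (PQ n) x)\<^sup>2) \<le> 1" for n
        using PQ[of n] PQ0[of n] by (cases "\<exists>PQ. good n PQ") (auto simp: good_def)
    qed
    moreover have "bseq (d - k) (\<lambda>n. snd (PQ n))"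
    proof (rule bseqI[of _ _ 1])
      show "polyfun (Nv n) (d - k) (snd (PQ n))" for n
        using PQ[of n] PQ0[of n] by (cases "\<exists>PQ. good n PQ") (auto simp: good_def intro: polyfun.const)
      show "Ex (\<lambda>x. (snd (PQ n) x)\<^sup>2) \<le> 1" for n
        using PQ[of n] PQ0[of n] by (cases "\<exists>PQ. good n PQ") (auto simp: good_def)
    qed
    ultimately have "appr (k + (d - k)) (\<lambda>n x. fst (PQ n) x * snd (PQ n) x)"
      using k by (intro appr_mult IH) auto
    then have ap: "appr d (\<lambda>n x. fst (PQ n) x * snd (PQ n) x)" using k by simp
    have "((\<lambda>n. (Ex (\<lambda>x. Z n x * (fst (PQ n) x * snd (PQ n) x)))\<^sup>2) \<longlongrightarrow> 0\<^sup>2) U"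
      using UEx_tendsto[OF bseq_mult[OF Z(1) appr_bseq[OF ap]]] orth[OF ap] by (intro tendsto_power) simp
    then have "\<forall>\<^sub>F n in U. (Ex (\<lambda>x. Z n x * (fst (PQ n) x * snd (PQ n) x)))\<^sup>2 < e"
      using order_tendstoD(2)[of _ "0\<^sup>2 :: real" U e] e by simp
    with ev2 have "\<forall>\<^sub>F n in U. False"
    proof eventually_elim
      case (elim n)
      then show ?case using PQ[of n] by (auto simp: good_def)
    qed
    then show False using U_not_bot by (simp add: trivial_limit_def)
  qed
qed

text \<open>The residual of the projection is split into its top chaos \<open>Z\<close> and a lower
  part \<open>l\<close>. By induction \<open>l\<close> lies in the closure, so its limiting norm is
  0. Hence \<open>Z\<close> is orthogonal to the closure, therefore irreducible, therefore itself a
  generator.\<close>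

theorem bseq_appr: "bseq d F \<Longrightarrow> appr d F"
proof (induction d arbitrary: F rule: less_induct)
  case (less d)
  show ?case
  proof (cases d)
    case 0
    have "\<exists>c. F n = (\<lambda>x. c)" for n using bseq_polyfun[OF less.prems, of n] polyfun_0 0 by blast
    then obtain c where c: "\<And>n. F n = (\<lambda>x. c n)" by metis
    have cE: "Ex (F n) = c n" for n by (simp add: c)
    \<comment> \<open>Degree 0: bounded constants converge along the ultrafilter, and the constant
      limit is a generator.\<close>
    obtain l where l: "(c \<longlongrightarrow> l) U"
      using UEx_tendsto[OF less.prems] unfolding cE by blast
    show ?thesis
      unfolding appr_def
    proof (intro conjI allI impI less.prems)
      fix e :: real assume "e > 0"
      have "((\<lambda>n. (c n - l)\<^sup>2) \<longlongrightarrow> (l - l)\<^sup>2) U" by (intro tendsto_intros l)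
      then have "\<forall>\<^sub>F n in U. (c n - l)\<^sup>2 < e" using order_tendstoD(2) \<open>e > 0\<close> by fastforce
      then show "\<exists>t. gen d t \<and> (\<forall>\<^sub>F n in U. Ex (\<lambda>x. (F n x - t n x)\<^sup>2) < e)"
        by (intro exI[of _ "\<lambda>n x. l"]) (auto simp: c intro: gen.const)
    qed
  next
    case (Suc p)
    obtain A where A: "appr d A" "\<And>t. appr d t \<Longrightarrow> UEx (\<lambda>n x. (F n x - A n x) * t n x) = 0"
      using appr_projection[OF less.prems] by blast
    define R where "R = (\<lambda>n x. F n x - A n x)"
    have R: "bseq d R" unfolding R_def by (rule bseq_diff[OF less.prems appr_bseq[OF A(1)]])
    have R_orth: "UEx (\<lambda>n x. R n x * t n x) = 0" if "appr d t" for t using A(2)[OF that] by (simp add: R_def)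
    have "\<exists>Z l. chaos (Nv n) (Suc p) Z \<and> polyfun (Nv n) p l \<and> R n = (\<lambda>x. Z x + l x)" for n
      using chaos_decomposition[of "Nv n" p "R n"] bseq_polyfun[OF R, of n] Suc by metis
    then obtain Z l where Z: "\<And>n. chaos (Nv n) (Suc p) (Z n)" and l: "\<And>n. polyfun (Nv n) p (l n)"
      and R_eq: "\<And>n. R n = (\<lambda>x. Z n x + l n x)" by metis
    obtain B where B: "\<And>n. Ex (\<lambda>x. (R n x)\<^sup>2) \<le> B" using R by (rule bseq_bound) blast
    have sq: "Ex (\<lambda>x. (R n x)\<^sup>2) = Ex (\<lambda>x. (Z n x)\<^sup>2) + Ex (\<lambda>x. (l n x)\<^sup>2)" for n
      unfolding R_eq by (rule Ex_square_chaos_decomposition[OF Z l])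
    have Zb: "bseq d Z"
    proof (rule bseqI)
      show "polyfun (Nv n) d (Z n)" for n using chaos_polyfun[OF Z] Suc by simp
      show "Ex (\<lambda>x. (Z n x)\<^sup>2) \<le> B" for n
        using sq[of n] B[of n] Ex_square_nonneg[of "l n"] by linarith
    qed
    have lb: "bseq p l"
    proof (rule bseqI)
      show "polyfun (Nv n) p (l n)" for n by (rule l)
      show "Ex (\<lambda>x. (l n x)\<^sup>2) \<le> B" for n
        using sq[of n] B[of n] Ex_square_nonneg[of "Z n"] by linarith
    qed
    have lbd: "bseq d l" using lb bseq_mono Suc by simp
    have la: "appr d l" using less.IH[OF _ lb] Suc appr_mono by simp
    have l0: "UEx (\<lambda>n x. (l n x)\<^sup>2) = 0"
    proof -
      have "Ex (\<lambda>x. R n x * l n x) = Ex (\<lambda>x. (l n x)\<^sup>2)" for n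
      proof -
        have "Ex (\<lambda>x. R n x * l n x) = Ex (\<lambda>x. Z n x * l n x + (l n x)\<^sup>2)"
          by (simp add: R_eq power2_eq_square algebra_simps)
        also have "\<dots> = Ex (\<lambda>x. Z n x * l n x) + Ex (\<lambda>x. (l n x)\<^sup>2)"
          by (intro Ex_padd[of "Nv n"] pfun_mult pfun_power bseq_pfun[OF Zb] bseq_pfun[OF lb])
        finally show ?thesis using chaos_orth[OF Z l] by simp
      qed
      then show ?thesis using R_orth[OF la] by (simp add: UEx_def)
    qed
    have Z_orth: "UEx (\<lambda>n x. Z n x * t n x) = 0" if t: "appr d t" for t
    proof -
      note tb = appr_bseq[OF t]
      have "(UEx (\<lambda>n x. l n x * t n x))\<^sup>2 \<le> 0"
        using UEx_cauchy_schwarz[OF lbd tb] l0 by simp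
      moreover have "UEx (\<lambda>n x. R n x * t n x - l n x * t n x) =
          UEx (\<lambda>n x. R n x * t n x) - UEx (\<lambda>n x. l n x * t n x)"
        by (rule UEx_diff[OF bseq_mult[OF R tb] bseq_mult[OF lbd tb]])
      ultimately show ?thesis using R_orth[OF t] by (simp add: R_eq algebra_simps)
    qed
    have "irr_seq d Z"
      using Z Suc less.IH Z_orth by (intro orth_appr_irr_seq[OF Zb]) auto
    then have "appr d Z" by (intro gen_appr gen.irr) auto
    then have "appr d (\<lambda>n x. A n x + (Z n x + l n x))"
      by (intro appr_add[OF A(1) appr_add[OF _ la]])
    moreover have "(\<lambda>n x. A n x + (Z n x + l n x)) = F"
      using R_eq by (auto simp: fun_eq_iff R_def algebra_simps)
    ultimately show ?thesis by simp
  qed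
qed

end

section \<open>The Gaussian limit of irreducible sequences\<close>

lemma pdiff_unused:
  assumes "polyfun N d f" "N \<le> i"
  shows "pdiff i f = (\<lambda>x. 0)"
proof
  fix x
  have "(\<lambda>t. f (x(i := t))) = (\<lambda>t. f x)"
    using assms(2) by (intro ext polyfun_cong[OF assms(1)]) auto
  then show "pdiff i f x = 0" by (simp add: pdiff_def)
qed

lemma prod_list_map_remove1:
  fixes f :: "'b \<Rightarrow> real"
  shows "x \<in> set xs \<Longrightarrow> (\<Prod>y\<leftarrow>xs. f y) = f x * (\<Prod>y\<leftarrow>remove1 x xs. f y)"
  by (induction xs) (auto simp: mult.left_commute)

context gaussian_ultra
begin

text \<open>Padding for families indexed by all natural numbers.\<close>

lemma irr_seq_zero: "irr_seq 1 (\<lambda>n x. 0)"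
  unfolding irr_seq_def
  by (auto simp: chaos_def irreducible_def intro: bseq_const polyfun.const)

text \<open>The families are concatenated, the second shifted by \<open>K1\<close>. Repetitions and
  correlations are harmless, as the Gram matrix will account for them.\<close>

lemma gen_combine:
  assumes p1: "polyfun K1 d p1" "\<And>i. i < K1 \<Longrightarrow> irr_seq (q1 i) (Z1 i)" "s1 = (\<lambda>n x. p1 (\<lambda>i. Z1 i n x))"
    and p2: "polyfun K2 e p2" "\<And>i. i < K2 \<Longrightarrow> irr_seq (q2 i) (Z2 i)" "s2 = (\<lambda>n x. p2 (\<lambda>i. Z2 i n x))"
  obtains K r1 r2 Z q where "polyfun K d r1" "polyfun K e r2" "\<forall>i<K. irr_seq (q i) (Z i)"
    "s1 = (\<lambda>n x. r1 (\<lambda>i. Z i n x))" "s2 = (\<lambda>n x. r2 (\<lambda>i. Z i n x))"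
proof -
  define Z where "Z i = (if i < K1 then Z1 i else Z2 (i - K1))" for i
  define q where "q i = (if i < K1 then q1 i else q2 (i - K1))" for i
  define r2 where "r2 = (\<lambda>y :: nat \<Rightarrow> real. p2 (\<lambda>i. y (i + K1)))"
  show ?thesis
  proof (rule that[of "K1 + K2" p1 r2 q Z])
    show "polyfun (K1 + K2) d p1" using p1(1) by (rule polyfun_mono_vars) simp
    have "polyfun (K1 + K2) (e * 1) r2"
      unfolding r2_def by (rule polyfun_comp[OF p2(1)]) (rule polyfun_var, simp)
    then show "polyfun (K1 + K2) e r2" by simp
    show "\<forall>i<K1 + K2. irr_seq (q i) (Z i)" using p1(2) p2(2) by (auto simp: Z_def q_def)
    show "s1 = (\<lambda>n x. p1 (\<lambda>i. Z i n x))"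
      unfolding p1(3) by (intro ext polyfun_cong[OF p1(1)]) (simp add: Z_def)
    show "s2 = (\<lambda>n x. r2 (\<lambda>i. Z i n x))"
      unfolding p2(3) r2_def by (simp add: Z_def)
  qed
qed

lemma gen_extract:
  "gen d s \<Longrightarrow> \<exists>K p Z q. polyfun K d p \<and> (\<forall>i<K. irr_seq (q i) (Z i)) \<and> s = (\<lambda>n x. p (\<lambda>i. Z i n x))"
proof (induction rule: gen.induct)
  case (const d c)
  show ?case by (rule exI[of _ 0], rule exI[of _ "\<lambda>x. c"]) (auto intro: polyfun.const)
next
  case (irr q s d)
  have "polyfun 1 d (\<lambda>y. y 0)"
    using irr by (intro polyfun_mono[OF polyfun_var]) (auto simp: irr_seq_def)
  then show ?case
    using irr by (intro exI[of _ 1] exI[of _ "\<lambda>y. y 0"] exI[of _ "\<lambda>i. s"] exI[of _ "\<lambda>i. q"]) auto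
next
  case (add d s t)
  obtain K1 p1 Z1 q1 where 1: "polyfun K1 d p1" "\<forall>i<K1. irr_seq (q1 i) (Z1 i)" "s = (\<lambda>n x. p1 (\<lambda>i. Z1 i n x))"
    using add.IH(1) by blast
  obtain K2 p2 Z2 q2 where 2: "polyfun K2 d p2" "\<forall>i<K2. irr_seq (q2 i) (Z2 i)" "t = (\<lambda>n x. p2 (\<lambda>i. Z2 i n x))"
    using add.IH(2) by blast
  obtain K r1 r2 Z q where r: "polyfun K d r1" "polyfun K d r2" "\<forall>i<K. irr_seq (q i) (Z i)"
    "s = (\<lambda>n x. r1 (\<lambda>i. Z i n x))" "t = (\<lambda>n x. r2 (\<lambda>i. Z i n x))"
    using gen_combine[OF 1(1) 1(2)[rule_format] 1(3) 2(1) 2(2)[rule_format] 2(3)] .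
  show ?case
    using polyfun.add[OF r(1,2)] r(3)
    by (intro exI[of _ K] exI[of _ "\<lambda>y. r1 y + r2 y"] exI[of _ Z] exI[of _ q]) (auto simp: r(4,5))
next
  case (mult d s e t)
  obtain K1 p1 Z1 q1 where 1: "polyfun K1 d p1" "\<forall>i<K1. irr_seq (q1 i) (Z1 i)" "s = (\<lambda>n x. p1 (\<lambda>i. Z1 i n x))"
    using mult.IH(1) by blast
  obtain K2 p2 Z2 q2 where 2: "polyfun K2 e p2" "\<forall>i<K2. irr_seq (q2 i) (Z2 i)" "t = (\<lambda>n x. p2 (\<lambda>i. Z2 i n x))"
    using mult.IH(2) by blast
  obtain K r1 r2 Z q where r: "polyfun K d r1" "polyfun K e r2" "\<forall>i<K. irr_seq (q i) (Z i)"
    "s = (\<lambda>n x. r1 (\<lambda>i. Z i n x))" "t = (\<lambda>n x. r2 (\<lambda>i. Z i n x))"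
    using gen_combine[OF 1(1) 1(2)[rule_format] 1(3) 2(1) 2(2)[rule_format] 2(3)] .
  show ?case
    using polyfun_mult[OF r(1,2)] r(3)
    by (intro exI[of _ K] exI[of _ "\<lambda>y. r1 y * r2 y"] exI[of _ Z] exI[of _ q]) (auto simp: r(4,5))
qed

end

section \<open>Gram matrix of a countable irreducible family and its Gaussian realisation\<close>

locale irreducible_family = gaussian_ultra M G U Nv for M :: "'a measure" and G U Nv +
  fixes Z :: "nat \<Rightarrow> nat \<Rightarrow> (nat \<Rightarrow> real) \<Rightarrow> real" and q :: "nat \<Rightarrow> nat"
  assumes irr: "irr_seq (q j) (Z j)"
begin

lemma Z_bseq: "bseq (q j) (Z j)"
  and Z_chaos: "chaos (Nv n) (q j) (Z j n)"
  and q_ge: "1 \<le> q j"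
  and Z_irr: "e > 0 \<Longrightarrow> \<forall>\<^sub>F n in U. irreducible (Nv n) (q j) e (Z j n)"
  using irr[of j] by (auto simp: irr_seq_def)

lemma bseq_sum_Z:
  "\<exists>D. bseq D (\<lambda>n x. \<Sum>i<m. c i * Z i n x)"
proof (induction m)
  case (Suc m)
  then obtain D where "bseq D (\<lambda>n x. \<Sum>i<m. c i * Z i n x)" by blast
  then have "bseq (D + q m) (\<lambda>n x. (\<Sum>i<m. c i * Z i n x) + c m * Z m n x)"
    by (intro bseq_add[OF bseq_mono bseq_cmult[OF bseq_mono[OF Z_bseq]]]) auto
  then show ?case by auto
qed (auto intro: bseq_const)

lemma UEx_mult_sum_Z:
  assumes "bseq d s"
  shows "UEx (\<lambda>n x. s n x * (\<Sum>i<m. c i * Z i n x)) = (\<Sum>i<m. c i * UEx (\<lambda>n x. s n x * Z i n x))"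
proof (rule UEx_eqI)
  have "Ex (\<lambda>x. s n x * (\<Sum>i<m. c i * Z i n x)) = (\<Sum>i<m. c i * Ex (\<lambda>x. s n x * Z i n x))" for n
  proof -
    have "Ex (\<lambda>x. s n x * (\<Sum>i<m. c i * Z i n x)) = Ex (\<lambda>x. \<Sum>i<m. c i * (s n x * Z i n x))"
      by (simp add: sum_distrib_left mult.left_commute)
    also have "\<dots> = (\<Sum>i<m. Ex (\<lambda>x. c i * (s n x * Z i n x)))"
      by (intro Ex_psum[of _ "Nv n"] pfun_cmult pfun_mult bseq_pfun[OF assms] bseq_pfun[OF Z_bseq])
    finally show ?thesis by (simp only: Ex_cmult)
  qed
  moreover have "((\<lambda>n. \<Sum>i<m. c i * Ex (\<lambda>x. s n x * Z i n x)) \<longlongrightarrow> (\<Sum>i<m. c i * UEx (\<lambda>n x. s n x * Z i n x))) U"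
    by (intro tendsto_sum tendsto_mult tendsto_const UEx_tendsto[OF bseq_mult[OF assms Z_bseq]])
  ultimately show "((\<lambda>n. Ex (\<lambda>x. s n x * (\<Sum>i<m. c i * Z i n x))) \<longlongrightarrow> (\<Sum>i<m. c i * UEx (\<lambda>n x. s n x * Z i n x))) U"
    by simp
qed

text \<open>Gram--Schmidt for the limiting inner product. The coefficients do not depend on
  \<open>n\<close>, so the same numbers can build Gaussian variables.\<close>

lemma ex_projection_coeffs:
  assumes "bseq d s"
  shows "\<exists>c. \<forall>j<m. UEx (\<lambda>n x. (s n x - (\<Sum>i<m. c i * Z i n x)) * Z j n x) = 0"
  using assms
proof (induction m arbitrary: d s)
  case (Suc m)
  obtain c where c: "\<And>j. j < m \<Longrightarrow> UEx (\<lambda>n x. (s n x - (\<Sum>i<m. c i * Z i n x)) * Z j n x) = 0"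
    using Suc.IH[OF Suc.prems] by blast
  obtain b where b: "\<And>j. j < m \<Longrightarrow> UEx (\<lambda>n x. (Z m n x - (\<Sum>i<m. b i * Z i n x)) * Z j n x) = 0"
    using Suc.IH[OF Z_bseq[of m]] by blast
  obtain D1 where D1: "bseq D1 (\<lambda>n x. \<Sum>i<m. c i * Z i n x)" using bseq_sum_Z[of c m] by (elim exE)
  obtain D2 where D2: "bseq D2 (\<lambda>n x. \<Sum>i<m. b i * Z i n x)" using bseq_sum_Z[of b m] by (elim exE)
  note D = D1 D2
  define D where "D = d + D1 + D2 + q m"
  define f where "f = (\<lambda>n x. s n x - (\<Sum>i<m. c i * Z i n x))"
  define g where "g = (\<lambda>n x. Z m n x - (\<Sum>i<m. b i * Z i n x))"
  have f: "bseq D f" unfolding f_def D_def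
    by (rule bseq_diff[OF bseq_mono[OF Suc.prems] bseq_mono[OF D(1)]]) auto
  have g: "bseq D g" unfolding g_def D_def
    by (rule bseq_diff[OF bseq_mono[OF Z_bseq] bseq_mono[OF D(2)]]) auto
  define t where "t = UEx (\<lambda>n x. f n x * g n x) / UEx (\<lambda>n x. (g n x)\<^sup>2)"
  define h where "h = (\<lambda>n x. f n x - t * g n x)"
  have h: "bseq D h" unfolding h_def by (intro bseq_diff bseq_cmult f g)
  have h_mult: "UEx (\<lambda>n x. h n x * u n x) = UEx (\<lambda>n x. f n x * u n x) - t * UEx (\<lambda>n x. g n x * u n x)"
    if "bseq e u" for e u
  proof -
    have "UEx (\<lambda>n x. h n x * u n x) = UEx (\<lambda>n x. f n x * u n x - t * (g n x * u n x))"
      by (simp add: h_def algebra_simps)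
    also have "\<dots> = UEx (\<lambda>n x. f n x * u n x) - UEx (\<lambda>n x. t * (g n x * u n x))"
      by (rule UEx_diff[OF bseq_mult[OF f that] bseq_cmult[OF bseq_mult[OF g that]]])
    finally show ?thesis using UEx_cmult[OF bseq_mult[OF g that], of t] by simp
  qed
  have hj: "UEx (\<lambda>n x. h n x * Z j n x) = 0" if "j < m" for j
    using h_mult[OF Z_bseq[of j]] c[OF that] b[OF that] by (simp add: f_def g_def)
  have hg: "UEx (\<lambda>n x. h n x * g n x) = 0"
  proof (cases "UEx (\<lambda>n x. (g n x)\<^sup>2) = 0")
    case True
    then show ?thesis using UEx_cauchy_schwarz[OF h g] by simp
  next
    case False
    then show ?thesis using h_mult[OF g] by (simp add: t_def power2_eq_square)
  qed
  have "UEx (\<lambda>n x. h n x * Z m n x) = UEx (\<lambda>n x. h n x * g n x + h n x * (\<Sum>i<m. b i * Z i n x))"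
    by (simp add: g_def algebra_simps)
  also have "\<dots> = UEx (\<lambda>n x. h n x * g n x) + UEx (\<lambda>n x. h n x * (\<Sum>i<m. b i * Z i n x))"
    by (rule UEx_add[OF bseq_mult[OF h g] bseq_mult[OF h D(2)]])
  also have "\<dots> = 0" using hg hj by (simp add: UEx_mult_sum_Z[OF h])
  finally have hm: "UEx (\<lambda>n x. h n x * Z m n x) = 0" .
  define c' where "c' i = (if i = m then t else c i - t * b i)" for i
  have "(\<Sum>i<Suc m. c' i * Z i n x) = (\<Sum>i<m. c i * Z i n x) - t * (\<Sum>i<m. b i * Z i n x) + t * Z m n x" for n x
  proof -
    have "(\<Sum>i<m. c' i * Z i n x) = (\<Sum>i<m. c i * Z i n x - t * (b i * Z i n x))"
      by (intro sum.cong) (auto simp: c'_def algebra_simps)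
    then show ?thesis by (simp add: c'_def sum_subtractf sum_distrib_left)
  qed
  then have "(\<lambda>n x. s n x - (\<Sum>i<Suc m. c' i * Z i n x)) = h"
    by (simp add: h_def f_def g_def algebra_simps fun_eq_iff)
  then have "\<forall>j<Suc m. UEx (\<lambda>n x. (s n x - (\<Sum>i<Suc m. c' i * Z i n x)) * Z j n x) = 0"
    using hj hm by (auto simp: less_Suc_eq fun_eq_iff)
  then show ?case by blast
qed simp

definition pcoeff :: "nat \<Rightarrow> nat \<Rightarrow> real" where
  "pcoeff m = (SOME c. \<forall>j<m. UEx (\<lambda>n x. (Z m n x - (\<Sum>i<m. c i * Z i n x)) * Z j n x) = 0)"

definition resid :: "nat \<Rightarrow> nat \<Rightarrow> (nat \<Rightarrow> real) \<Rightarrow> real" where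
  "resid m n x = Z m n x - (\<Sum>i<m. pcoeff m i * Z i n x)"

lemma resid_orth: "j < m \<Longrightarrow> UEx (\<lambda>n x. resid m n x * Z j n x) = 0"
  using someI_ex[OF ex_projection_coeffs[OF Z_bseq[of m], of m]] unfolding pcoeff_def resid_def by blast

definition gram :: "nat \<Rightarrow> nat \<Rightarrow> real" where
  "gram i j = UEx (\<lambda>n x. Z i n x * Z j n x)"

lemma gram_commute: "gram i j = gram j i"
  by (simp add: gram_def mult.commute)

lemma resid_bseq: "\<exists>D. bseq D (resid m)"
proof -
  obtain D where D: "bseq D (\<lambda>n x. \<Sum>i<m. pcoeff m i * Z i n x)"
    using bseq_sum_Z[of "pcoeff m" m] by (elim exE)
  have "bseq (q m + D) (\<lambda>n x. Z m n x - (\<Sum>i<m. pcoeff m i * Z i n x))"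
    by (rule bseq_diff[OF bseq_mono[OF Z_bseq] bseq_mono[OF D]]) auto
  then show ?thesis unfolding resid_def[abs_def] by blast
qed

text \<open>The counterpart of \<open>Ex_lgauss_mult\<close>: both Gram matrices satisfy the same
  recursion.\<close>

lemma gram_resid:
  "gram m j = UEx (\<lambda>n x. resid m n x * Z j n x) + (\<Sum>i<m. pcoeff m i * gram i j)"
proof -
  obtain D where D: "bseq D (resid m)" using resid_bseq by blast
  obtain D' where D': "bseq D' (\<lambda>n x. \<Sum>i<m. pcoeff m i * Z i n x)"
    using bseq_sum_Z[of "pcoeff m" m] by (elim exE)
  have "gram m j = UEx (\<lambda>n x. resid m n x * Z j n x + Z j n x * (\<Sum>i<m. pcoeff m i * Z i n x))"
    unfolding gram_def resid_def by (simp add: algebra_simps)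
  also have "\<dots> = UEx (\<lambda>n x. resid m n x * Z j n x) + UEx (\<lambda>n x. Z j n x * (\<Sum>i<m. pcoeff m i * Z i n x))"
    by (rule UEx_add[OF bseq_mult[OF D Z_bseq] bseq_mult[OF Z_bseq D']])
  also have "UEx (\<lambda>n x. Z j n x * (\<Sum>i<m. pcoeff m i * Z i n x)) = (\<Sum>i<m. pcoeff m i * gram i j)"
    unfolding UEx_mult_sum_Z[OF Z_bseq] gram_def by (simp add: mult.commute[of "Z j _ _"])
  finally show ?thesis .
qed

lemma UEx_resid_self: "UEx (\<lambda>n x. resid m n x * Z m n x) = UEx (\<lambda>n x. (resid m n x)\<^sup>2)"
proof -
  obtain D where D: "bseq D (resid m)" using resid_bseq by blast
  obtain D' where D': "bseq D' (\<lambda>n x. \<Sum>i<m. pcoeff m i * Z i n x)"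
    using bseq_sum_Z[of "pcoeff m" m] by (elim exE)
  have "UEx (\<lambda>n x. resid m n x * Z m n x) =
      UEx (\<lambda>n x. (resid m n x)\<^sup>2 + resid m n x * (\<Sum>i<m. pcoeff m i * Z i n x))"
    unfolding resid_def by (simp add: algebra_simps power2_eq_square)
  also have "\<dots> = UEx (\<lambda>n x. (resid m n x)\<^sup>2) + UEx (\<lambda>n x. resid m n x * (\<Sum>i<m. pcoeff m i * Z i n x))"
    by (rule UEx_add[OF bseq_square[OF D] bseq_mult[OF D D']])
  finally show ?thesis using resid_orth by (simp add: UEx_mult_sum_Z[OF D])
qed

text \<open>Gram--Schmidt in reverse: linear combinations of the independent Gaussian coordinates
  whose Gram matrix is that of the family \<open>Z\<close> along the ultrafilter.\<close>

fun lgauss :: "nat \<Rightarrow> (nat \<Rightarrow> real) \<Rightarrow> real" where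
  "lgauss m x = sqrt (UEx (\<lambda>n x. (resid m n x)\<^sup>2)) * x m + (\<Sum>i<m. pcoeff m i * lgauss i x)"

declare lgauss.simps [simp del]

lemma polyfun_lgauss: "polyfun (Suc m) 1 (lgauss m)"
proof (induction m rule: less_induct)
  case (less m)
  have "polyfun (Suc m) 1 (\<lambda>x. sqrt (UEx (\<lambda>n x. (resid m n x)\<^sup>2)) * x m + (\<Sum>i<m. pcoeff m i * lgauss i x))"
  proof (intro polyfun.add polyfun_cmult polyfun_sum)
    show "polyfun (Suc m) 1 (\<lambda>x. x m)" by (rule polyfun_var) simp
    show "polyfun (Suc m) 1 (lgauss i)" if "i \<in> {..<m}" for i
      using less.IH[of i] that by (auto elim!: polyfun_mono_vars)
  qed
  then show ?case by (subst lgauss.simps[abs_def]) simp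
qed

lemma polyfun_lgauss': "m < K \<Longrightarrow> polyfun K 1 (lgauss m)"
  by (rule polyfun_mono_vars[OF polyfun_lgauss]) auto

lemma pfun_lgauss: "m < K \<Longrightarrow> pfun K (lgauss m)"
  by (rule polyfun_imp_pfun[OF polyfun_lgauss'])

lemma Ex_lgauss: "Ex (lgauss m) = 0"
proof (induction m rule: less_induct)
  case (less m)
  have "Ex (\<lambda>x. x m) = 0"
    using Ex_pibp[of m "Suc m" "\<lambda>x. 1"] by (simp add: pfun_const)
  have "Ex (lgauss m) = Ex (\<lambda>x. sqrt (UEx (\<lambda>n x. (resid m n x)\<^sup>2)) * x m + (\<Sum>i<m. pcoeff m i * lgauss i x))"
    by (subst lgauss.simps[abs_def]) simp
  also have "\<dots> = Ex (\<lambda>x. sqrt (UEx (\<lambda>n x. (resid m n x)\<^sup>2)) * x m) + Ex (\<lambda>x. \<Sum>i<m. pcoeff m i * lgauss i x)"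
    by (intro Ex_padd[of "Suc m"] pfun_cmult pfun_sum pfun_var pfun_lgauss) auto
  also have "Ex (\<lambda>x. \<Sum>i<m. pcoeff m i * lgauss i x) = (\<Sum>i<m. Ex (\<lambda>x. pcoeff m i * lgauss i x))"
    by (intro Ex_psum[of _ "Suc m"] pfun_cmult pfun_lgauss) auto
  finally show ?case using less.IH \<open>Ex (\<lambda>x. x m) = 0\<close> by (simp add: Ex_cmult)
qed

lemma Ex_var_lgauss: "j < m \<Longrightarrow> Ex (\<lambda>x. x m * lgauss j x) = 0"
  using Ex_pibp[of m "Suc m" "lgauss j"] pfun_lgauss[of j "Suc m"] pdiff_unused[OF polyfun_lgauss[of j], of m]
  by simp

lemma Ex_lgauss_mult:
  assumes "pfun K f" "m < K"
  shows "Ex (\<lambda>x. lgauss m x * f x) =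
    sqrt (UEx (\<lambda>n x. (resid m n x)\<^sup>2)) * Ex (\<lambda>x. x m * f x) + (\<Sum>i<m. pcoeff m i * Ex (\<lambda>x. lgauss i x * f x))"
proof -
  let ?r = "sqrt (UEx (\<lambda>n x. (resid m n x)\<^sup>2))"
  have "Ex (\<lambda>x. lgauss m x * f x) =
      Ex (\<lambda>x. ?r * (x m * f x) + (\<Sum>i<m. pcoeff m i * (lgauss i x * f x)))"
    by (subst lgauss.simps) (simp add: distrib_right sum_distrib_right mult.assoc)
  also have "\<dots> = Ex (\<lambda>x. ?r * (x m * f x)) + Ex (\<lambda>x. \<Sum>i<m. pcoeff m i * (lgauss i x * f x))"
    using assms by (intro Ex_padd[of K] pfun_cmult pfun_sum pfun_mult pfun_var pfun_lgauss) auto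
  also have "Ex (\<lambda>x. \<Sum>i<m. pcoeff m i * (lgauss i x * f x)) = (\<Sum>i<m. Ex (\<lambda>x. pcoeff m i * (lgauss i x * f x)))"
    using assms by (intro Ex_psum[of _ K] pfun_cmult pfun_mult pfun_lgauss) auto
  finally show ?thesis by (simp only: Ex_cmult)
qed

text \<open>Induction on the larger index. The new coordinate \<open>x m\<close> is orthogonal to
  all earlier variables, as \<open>resid m\<close> is on the other side; on the diagonal both
  contribute the squared norm of the residual.\<close>

lemma Ex_lgauss_lgauss: "Ex (\<lambda>x. lgauss i x * lgauss j x) = gram i j"
proof -
  have main: "\<forall>j\<le>m. Ex (\<lambda>x. lgauss m x * lgauss j x) = gram m j" for m
  proof (induction m rule: less_induct)
    case (less m)
    have IH: "Ex (\<lambda>x. lgauss i x * lgauss j x) = gram i j" if "i < m" "j < m" for i j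
      using less.IH[OF that(1)] less.IH[OF that(2)] gram_commute[of i j]
      by (cases "j \<le> i") (auto simp: mult.commute)
    have lt: "Ex (\<lambda>x. lgauss m x * lgauss j x) = gram m j" if "j < m" for j
      using Ex_lgauss_mult[of "Suc m" "lgauss j" m] pfun_lgauss[of j "Suc m"] Ex_var_lgauss[OF that] IH that
        gram_resid[of m j] resid_orth[OF that] by simp
    let ?r = "sqrt (UEx (\<lambda>n x. (resid m n x)\<^sup>2))"
    have r0: "0 \<le> UEx (\<lambda>n x. (resid m n x)\<^sup>2)"
      using resid_bseq[of m] bseq_square UEx_nonneg by (metis zero_le_power2)
    have "Ex (\<lambda>x. x m * x m) = 1"
      using Ex_pibp[of m "Suc m" "\<lambda>x. x m"] by (simp add: pfun_var pdiff_var)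
    then have "Ex (\<lambda>x. lgauss m x * x m) = ?r"
      using Ex_lgauss_mult[of "Suc m" "\<lambda>x. x m" m] pfun_var[of m "Suc m"] Ex_var_lgauss[of _ m]
      by (simp add: mult.commute)
    then have "Ex (\<lambda>x. lgauss m x * lgauss m x) = ?r * ?r + (\<Sum>i<m. pcoeff m i * gram i m)"
      using Ex_lgauss_mult[of "Suc m" "lgauss m" m] pfun_lgauss[of m "Suc m"] lt gram_commute
      by (simp add: mult.commute)
    also have "\<dots> = gram m m"
      using gram_resid[of m m] UEx_resid_self[of m] r0 by simp
    finally show ?case using lt le_neq_implies_less by blast
  qed
  show ?thesis
    using main[of i] main[of j] gram_commute[of i j] by (cases "j \<le> i") (auto simp: mult.commute)
qed

lemma chaos_lgauss: "m < K \<Longrightarrow> chaos K 1 (lgauss m)"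
  unfolding chaos_def
proof (intro conjI allI impI)
  fix k h assume m: "m < K" and "k < 1" "polyfun K k h"
  then obtain c where "h = (\<lambda>x. c)" using polyfun_0 by auto
  then have "Ex (\<lambda>x. lgauss m x * h x) = Ex (\<lambda>x. c * lgauss m x)" by (simp add: mult.commute)
  then show "Ex (\<lambda>x. lgauss m x * h x) = 0" by (simp add: Ex_cmult Ex_lgauss)
qed (rule polyfun_lgauss')

text \<open>In order 1 irreducibility is vacuous, so the approximate recursion applies with defect 0
  and becomes exact.\<close>

lemma isserlis_lgauss:
  "Ex (\<lambda>x. lgauss j x * (\<Prod>i\<leftarrow>js. lgauss i x)) =
    (\<Sum>i<length js. gram j (js ! i) * Ex (\<lambda>x. \<Prod>k\<leftarrow>remove_nth i js. lgauss k x))"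
proof -
  define K where "K = Suc (Max (set (j # js)))"
  have K: "i < K" if "i \<in> set (j # js)" for i
    using that unfolding K_def by (metis List.finite_set Max_ge less_Suc_eq_le)
  define B where "B = (\<Sum>i\<in>set js. gram i i)"
  have g0: "0 \<le> gram i i" for i
    unfolding Ex_lgauss_lgauss[symmetric] by (rule Ex_nonneg) simp
  have B: "gram i i \<le> B" if "i \<in> set js" for i
    unfolding B_def using that g0 by (intro member_le_sum) auto
  have B0: "0 \<le> B" unfolding B_def by (intro sum_nonneg g0)
  obtain C where "0 \<le> C" and C: "\<forall>N Z e Ys. chaos N 1 Z \<longrightarrow> irreducible N 1 e Z \<longrightarrow> 0 \<le> e \<longrightarrow> length Ys = length js \<longrightarrow>
    (\<forall>Y\<in>set Ys. polyfun N 1 Y \<and> Ex (\<lambda>x. (Y x)\<^sup>2) \<le> B) \<longrightarrow>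
    (Ex (\<lambda>x. Z x * (\<Prod>Y\<leftarrow>Ys. Y x)) -
      (\<Sum>i<length js. Ex (\<lambda>x. Z x * (Ys ! i) x) * Ex (\<lambda>x. \<Prod>Y\<leftarrow>remove_nth i Ys. Y x)))\<^sup>2 \<le> C * e"
    using approx_isserlis[OF order_refl B0, of "length js"] by (elim exE conjE) (erule (1) that)
  let ?Ys = "map lgauss js"
  have "(Ex (\<lambda>x. lgauss j x * (\<Prod>Y\<leftarrow>?Ys. Y x)) -
      (\<Sum>i<length js. Ex (\<lambda>x. lgauss j x * (?Ys ! i) x) * Ex (\<lambda>x. \<Prod>Y\<leftarrow>remove_nth i ?Ys. Y x)))\<^sup>2 \<le> C * 0"
  proof (rule C[rule_format])
    show "chaos K 1 (lgauss j)" using K by (intro chaos_lgauss) auto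
    show "irreducible K 1 0 (lgauss j)" by (auto simp: irreducible_def)
    show "polyfun K 1 Y \<and> Ex (\<lambda>x. (Y x)\<^sup>2) \<le> B" if "Y \<in> set ?Ys" for Y
      using that K B Ex_lgauss_lgauss by (auto simp: power2_eq_square simp del: One_nat_def intro!: polyfun_lgauss')
  qed auto
  then have "Ex (\<lambda>x. lgauss j x * (\<Prod>Y\<leftarrow>?Ys. Y x)) =
      (\<Sum>i<length js. Ex (\<lambda>x. lgauss j x * (?Ys ! i) x) * Ex (\<lambda>x. \<Prod>Y\<leftarrow>remove_nth i ?Ys. Y x))" by simp
  also have "\<dots> = (\<Sum>i<length js. gram j (js ! i) * Ex (\<lambda>x. \<Prod>k\<leftarrow>remove_nth i js. lgauss k x))"
    by (intro sum.cong refl) (simp add: Ex_lgauss_lgauss remove_nth_def take_map drop_map comp_def)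
  finally show ?thesis by (simp add: comp_def)
qed

section \<open>Joint moments along the ultrafilter\<close>

lemma bseq_prod_Z: "\<exists>D. bseq D (\<lambda>n x. \<Prod>j\<leftarrow>js. Z j n x)"
  using bseq_prod_list[of "map Z js"] Z_bseq by (auto simp: comp_def)

lemma Z_bounds:
  obtains B where "\<forall>i. 0 \<le> B i" "\<forall>i n. Ex (\<lambda>x. (Z i n x)\<^sup>2) \<le> B i"
proof -
  define B where "B i = (SOME B. \<forall>n. Ex (\<lambda>x. (Z i n x)\<^sup>2) \<le> B)" for i
  have "\<forall>n. Ex (\<lambda>x. (Z i n x)\<^sup>2) \<le> B i" for i
    unfolding B_def by (rule someI_ex) (use Z_bseq[of i] in \<open>simp add: bseq_def\<close>)
  then have B: "Ex (\<lambda>x. (Z i n x)\<^sup>2) \<le> B i" for i n by simp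
  show ?thesis
  proof (rule that[of B])
    show "\<forall>i. 0 \<le> B i"
    proof
      show "0 \<le> B i" for i using B[of i 0] Ex_square_nonneg[of "Z i 0"] by linarith
    qed
  qed (use B in simp)
qed

text \<open>The factor of index \<open>j\<close> must have maximal order: its contraction with a
  factor of higher degree would not be a constant.\<close>

lemma isserlis_Z:
  assumes "\<And>i. i \<in> set js \<Longrightarrow> q i \<le> q j"
  shows "UEx (\<lambda>n x. Z j n x * (\<Prod>i\<leftarrow>js. Z i n x)) =
    (\<Sum>i<length js. gram j (js ! i) * UEx (\<lambda>n x. \<Prod>k\<leftarrow>remove_nth i js. Z k n x))"
proof -
  obtain B' where "\<forall>i. 0 \<le> B' i" "\<forall>i n. Ex (\<lambda>x. (Z i n x)\<^sup>2) \<le> B' i"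
    using Z_bounds .
  then have B': "0 \<le> B' i" "Ex (\<lambda>x. (Z i n x)\<^sup>2) \<le> B' i" for i n by auto
  define B where "B = (\<Sum>i\<in>set js. B' i)"
  have B: "Ex (\<lambda>x. (Z i n x)\<^sup>2) \<le> B" if "i \<in> set js" for i n
    using B'(2)[of i n] member_le_sum[of i "set js" B'] that B'(1) unfolding B_def by fastforce
  have B0: "0 \<le> B" unfolding B_def using B' by (intro sum_nonneg) auto
  obtain C where C: "0 \<le> C" "\<forall>N Z e Ys. chaos N (q j) Z \<longrightarrow> irreducible N (q j) e Z \<longrightarrow> 0 \<le> e \<longrightarrow> length Ys = length js \<longrightarrow>
    (\<forall>Y\<in>set Ys. polyfun N (q j) Y \<and> Ex (\<lambda>x. (Y x)\<^sup>2) \<le> B) \<longrightarrow>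
    (Ex (\<lambda>x. Z x * (\<Prod>Y\<leftarrow>Ys. Y x)) -
      (\<Sum>i<length js. Ex (\<lambda>x. Z x * (Ys ! i) x) * Ex (\<lambda>x. \<Prod>Y\<leftarrow>remove_nth i Ys. Y x)))\<^sup>2 \<le> C * e"
    using approx_isserlis[OF q_ge B0, of j "length js"] by (elim exE conjE) (erule (1) that)
  define r where "r n = (\<Sum>i<length js. Ex (\<lambda>x. Z j n x * Z (js ! i) n x) * Ex (\<lambda>x. \<Prod>k\<leftarrow>remove_nth i js. Z k n x))" for n
  define l where "l n = Ex (\<lambda>x. Z j n x * (\<Prod>i\<leftarrow>js. Z i n x))" for n
  have le: "(l n - r n)\<^sup>2 \<le> C * e" if "irreducible (Nv n) (q j) e (Z j n)" "0 \<le> e" for n e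
  proof -
    let ?Ys = "map (\<lambda>i. Z i n) js"
    have "(Ex (\<lambda>x. Z j n x * (\<Prod>Y\<leftarrow>?Ys. Y x)) -
      (\<Sum>i<length js. Ex (\<lambda>x. Z j n x * (?Ys ! i) x) * Ex (\<lambda>x. \<Prod>Y\<leftarrow>remove_nth i ?Ys. Y x)))\<^sup>2 \<le> C * e"
    proof (rule C(2)[rule_format, of "Nv n"])
      show "polyfun (Nv n) (q j) Y \<and> Ex (\<lambda>x. (Y x)\<^sup>2) \<le> B" if "Y \<in> set ?Ys" for Y
        using that B assms polyfun_mono[OF bseq_polyfun[OF Z_bseq]] by auto
    qed (use that Z_chaos in auto)
    also have "(\<Sum>i<length js. Ex (\<lambda>x. Z j n x * (?Ys ! i) x) * Ex (\<lambda>x. \<Prod>Y\<leftarrow>remove_nth i ?Ys. Y x)) = r n"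
      unfolding r_def by (intro sum.cong refl) (simp add: remove_nth_def take_map drop_map comp_def)
    finally show ?thesis by (simp add: l_def comp_def)
  qed
  have "((\<lambda>n. (l n - r n)\<^sup>2) \<longlongrightarrow> 0) U"
  proof (rule order_tendstoI)
    fix a :: real assume a: "0 < a"
    have "\<forall>\<^sub>F n in U. irreducible (Nv n) (q j) (a / (C + 1)) (Z j n)" using a C(1) by (intro Z_irr) auto
    then show "\<forall>\<^sub>F n in U. (l n - r n)\<^sup>2 < a"
    proof eventually_elim
      case (elim n)
      then have "(l n - r n)\<^sup>2 \<le> C * (a / (C + 1))" using a C(1) by (intro le) auto
      also have "\<dots> < a" using a C(1) by (simp add: field_simps)
      finally show ?case .
    qed
  next
    fix a :: real assume "a < 0"
    then show "\<forall>\<^sub>F n in U. a < (l n - r n)\<^sup>2" 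
      by (intro always_eventually allI) (rule less_le_trans[OF _ zero_le_power2])
  qed
  then have "((\<lambda>n. sqrt ((l n - r n)\<^sup>2)) \<longlongrightarrow> sqrt 0) U" by (rule tendsto_real_sqrt)
  then have "((\<lambda>n. l n - r n) \<longlongrightarrow> 0) U" by (simp add: tendsto_rabs_zero_iff)
  moreover have "(r \<longlongrightarrow> (\<Sum>i<length js. gram j (js ! i) * UEx (\<lambda>n x. \<Prod>k\<leftarrow>remove_nth i js. Z k n x))) U"
    unfolding r_def gram_def
  proof (intro tendsto_sum tendsto_mult)
    fix i
    obtain D where D: "bseq D (\<lambda>n x. \<Prod>k\<leftarrow>remove_nth i js. Z k n x)"
      using bseq_prod_Z[of "remove_nth i js"] by (elim exE)
    show "((\<lambda>n. Ex (\<lambda>x. Z j n x * Z (js ! i) n x)) \<longlongrightarrow> UEx (\<lambda>n x. Z j n x * Z (js ! i) n x)) U"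
      by (rule UEx_tendsto[OF bseq_mult[OF Z_bseq Z_bseq]])
    show "((\<lambda>n. Ex (\<lambda>x. \<Prod>k\<leftarrow>remove_nth i js. Z k n x)) \<longlongrightarrow> UEx (\<lambda>n x. \<Prod>k\<leftarrow>remove_nth i js. Z k n x)) U"
      by (rule UEx_tendsto[OF D])
  qed
  ultimately have "((\<lambda>n. (l n - r n) + r n) \<longlongrightarrow>
      0 + (\<Sum>i<length js. gram j (js ! i) * UEx (\<lambda>n x. \<Prod>k\<leftarrow>remove_nth i js. Z k n x))) U"
    by (rule tendsto_add)
  then show ?thesis by (intro UEx_eqI) (simp add: l_def)
qed

text \<open>Induction on the number of factors, always removing one of maximal order; both sides
  then obey the same recursion with the same Gram matrix.\<close>

theorem UEx_prod_Z: "UEx (\<lambda>n x. \<Prod>j\<leftarrow>js. Z j n x) = Ex (\<lambda>x. \<Prod>j\<leftarrow>js. lgauss j x)"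
proof (induction "length js" arbitrary: js rule: less_induct)
  case less
  show ?case
  proof (cases "js = []")
    case True
    then show ?thesis by (auto intro!: UEx_eqI)
  next
    case False
    have "Max (q ` set js) \<in> q ` set js" using False by (intro Max_in) auto
    then obtain j where j: "j \<in> set js" "q j = Max (q ` set js)" by auto
    have mx: "q i \<le> q j" if "i \<in> set js" for i using that j by auto
    let ?js = "remove1 j js"
    have len: "length ?js < length js" using j False by (simp add: length_remove1)
    have "UEx (\<lambda>n x. \<Prod>i\<leftarrow>js. Z i n x) = UEx (\<lambda>n x. Z j n x * (\<Prod>i\<leftarrow>?js. Z i n x))"
      by (simp only: prod_list_map_remove1[OF j(1)])
    also have "\<dots> = (\<Sum>i<length ?js. gram j (?js ! i) * UEx (\<lambda>n x. \<Prod>k\<leftarrow>remove_nth i ?js. Z k n x))"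
      using mx by (intro isserlis_Z) (auto dest: notin_set_remove1)
    also have "\<dots> = (\<Sum>i<length ?js. gram j (?js ! i) * Ex (\<lambda>x. \<Prod>k\<leftarrow>remove_nth i ?js. lgauss k x))"
      using len by (intro sum.cong refl arg_cong2[of _ _ _ _ "(*)"] less) (auto simp: remove_nth_def)
    also have "\<dots> = Ex (\<lambda>x. lgauss j x * (\<Prod>i\<leftarrow>?js. lgauss i x))" by (rule isserlis_lgauss[symmetric])
    also have "\<dots> = Ex (\<lambda>x. \<Prod>i\<leftarrow>js. lgauss i x)"
      by (simp only: prod_list_map_remove1[OF j(1)])
    finally show ?thesis .
  qed
qed

lemma bseq_polyfun_Z: "polyfun K d p \<Longrightarrow> \<exists>D. bseq D (\<lambda>n x. p (\<lambda>j. Z j n x))"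
proof (induction rule: polyfun.induct)
  case (const d c)
  then show ?case using bseq_const by blast
next
  case (add d f g)
  then obtain D1 D2 where "bseq D1 (\<lambda>n x. f (\<lambda>j. Z j n x))" "bseq D2 (\<lambda>n x. g (\<lambda>j. Z j n x))" by blast
  then have "bseq (D1 + D2) (\<lambda>n x. f (\<lambda>j. Z j n x) + g (\<lambda>j. Z j n x))"
    by (intro bseq_add) (auto elim!: bseq_mono)
  then show ?case by blast
next
  case (var_mult i d f)
  then show ?case using bseq_mult[OF Z_bseq] by blast
qed

lemma pfun_polyfun_lgauss: "polyfun K d p \<Longrightarrow> pfun K (\<lambda>x. p (\<lambda>j. lgauss j x))"
  by (rule polyfun_imp_pfun[OF polyfun_comp]) (auto intro: polyfun_lgauss')

lemma pfun_prod_lgauss: "\<exists>K. \<forall>K'\<ge>K. pfun K' (\<lambda>x. \<Prod>j\<leftarrow>js. lgauss j x)"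
proof (intro exI allI impI)
  fix K' assume K': "Suc (sum_list js) \<le> K'"
  have "pfun K' (\<lambda>x. \<Prod>f\<leftarrow>map lgauss js. f x)"
  proof (rule pfun_prod_list)
    fix f assume "f \<in> set (map lgauss js)"
    then obtain j where j: "j \<in> set js" "f = lgauss j" by auto
    then have "j < K'" using member_le_sum_list[of j js] K' by simp
    then show "pfun K' f" using j pfun_lgauss by simp
  qed
  then show "pfun K' (\<lambda>x. \<Prod>j\<leftarrow>js. lgauss j x)" by (simp add: comp_def)
qed

text \<open>The product over \<open>js\<close> is a prefix that absorbs the coordinates, reducing
  polynomials to the products already treated.\<close>

theorem UEx_polyfun_Z:
  assumes "polyfun K d p"
  shows "UEx (\<lambda>n x. p (\<lambda>j. Z j n x)) = Ex (\<lambda>x. p (\<lambda>j. lgauss j x))"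
proof -
  have "UEx (\<lambda>n x. (\<Prod>j\<leftarrow>js. Z j n x) * p (\<lambda>j. Z j n x)) = Ex (\<lambda>x. (\<Prod>j\<leftarrow>js. lgauss j x) * p (\<lambda>j. lgauss j x))" for js
    using assms
  proof (induction arbitrary: js rule: polyfun.induct)
    case (const d c)
    obtain D where "bseq D (\<lambda>n x. \<Prod>j\<leftarrow>js. Z j n x)" using bseq_prod_Z by blast
    from UEx_cmult[OF this, of c] show ?case
      by (simp add: mult.commute[of _ c] Ex_cmult UEx_prod_Z)
  next
    case (add d f g)
    obtain D where D: "bseq D (\<lambda>n x. \<Prod>j\<leftarrow>js. Z j n x)" using bseq_prod_Z by blast
    obtain D1 D2 where D12: "bseq D1 (\<lambda>n x. f (\<lambda>j. Z j n x))" "bseq D2 (\<lambda>n x. g (\<lambda>j. Z j n x))"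
      using bseq_polyfun_Z add.hyps by metis
    obtain K0 where K0: "\<And>K'. K' \<ge> K0 \<Longrightarrow> pfun K' (\<lambda>x. \<Prod>j\<leftarrow>js. lgauss j x)" using pfun_prod_lgauss by blast
    have fg: "pfun (K + K0) (\<lambda>x. f (\<lambda>j. lgauss j x))" "pfun (K + K0) (\<lambda>x. g (\<lambda>j. lgauss j x))"
      using add.hyps by (auto intro!: pfun_polyfun_lgauss elim!: polyfun_mono_vars)
    have "UEx (\<lambda>n x. (\<Prod>j\<leftarrow>js. Z j n x) * (f (\<lambda>j. Z j n x) + g (\<lambda>j. Z j n x))) =
      UEx (\<lambda>n x. (\<Prod>j\<leftarrow>js. Z j n x) * f (\<lambda>j. Z j n x)) + UEx (\<lambda>n x. (\<Prod>j\<leftarrow>js. Z j n x) * g (\<lambda>j. Z j n x))"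
      unfolding distrib_left by (rule UEx_add[OF bseq_mult[OF D D12(1)] bseq_mult[OF D D12(2)]])
    also have "\<dots> = Ex (\<lambda>x. (\<Prod>j\<leftarrow>js. lgauss j x) * f (\<lambda>j. lgauss j x)) + Ex (\<lambda>x. (\<Prod>j\<leftarrow>js. lgauss j x) * g (\<lambda>j. lgauss j x))"
      by (simp add: add.IH)
    also have "\<dots> = Ex (\<lambda>x. (\<Prod>j\<leftarrow>js. lgauss j x) * (f (\<lambda>j. lgauss j x) + g (\<lambda>j. lgauss j x)))"
      unfolding distrib_left using fg K0
      by (intro Ex_padd[symmetric, of "K + K0"] pfun_mult) auto
    finally show ?case .
  next
    case (var_mult i d f)
    from var_mult.IH[of "js @ [i]"] show ?case by (simp add: mult.assoc)
  qed
  from this[of "[]"] show ?thesis by simp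
qed

end

section \<open>Convergence in law\<close>

text \<open>The remainder has an even power, hence no absolute value: the error bound is itself a
  polynomial and passes to the limit by moments.\<close>

lemma cos_taylor:
  fixes c :: real
  assumes "1 \<le> m"
  shows "\<exists>\<alpha>. \<forall>x. \<bar>cos (c + x) - (\<Sum>k<2 * m. \<alpha> k * x ^ k)\<bar> \<le> x ^ (2 * m) / fact (2 * m)"
proof (intro exI allI)
  fix x :: real
  define n where "n = 2 * m - 1"
  have n: "Suc n = 2 * m" using assms by (simp add: n_def)
  define S where "S = (\<Sum>k\<le>n. (\<i> * complex_of_real x) ^ k / fact k)"
  have "Re (iexp c * S) = (\<Sum>k\<le>n. Re (iexp c * \<i> ^ k / fact k) * x ^ k)"
    unfolding S_def sum_distrib_left Re_sum
  proof (intro sum.cong refl)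
    fix k
    have "iexp c * ((\<i> * complex_of_real x) ^ k / fact k) = (iexp c * \<i> ^ k / fact k) * complex_of_real (x ^ k)"
      by (simp add: power_mult_distrib)
    then show "Re (iexp c * ((\<i> * complex_of_real x) ^ k / fact k)) = Re (iexp c * \<i> ^ k / fact k) * x ^ k"
      by (simp only: times_complex.sel Re_complex_of_real Im_complex_of_real)
  qed
  moreover have "cos (c + x) = Re (iexp c * iexp x)"
    by (simp add: exp_add[symmetric] distrib_left[symmetric] Re_exp)
  ultimately have "cos (c + x) - (\<Sum>k\<le>n. Re (iexp c * \<i> ^ k / fact k) * x ^ k) = Re (iexp c * (iexp x - S))"
    by (simp add: right_diff_distrib)
  also have "\<bar>\<dots>\<bar> \<le> cmod (iexp c * (iexp x - S))" by (rule abs_Re_le_cmod)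
  also have "\<dots> = cmod (iexp x - S)" by (simp add: norm_mult)
  also have "\<dots> \<le> \<bar>x\<bar> ^ Suc n / fact (Suc n)" unfolding S_def by (rule iexp_approx1)
  also have "\<bar>x\<bar> ^ Suc n = x ^ (2 * m)" unfolding n by (simp add: power_mult)
  finally show "\<bar>cos (c + x) - (\<Sum>k<2 * m. Re (iexp c * \<i> ^ k / fact k) * x ^ k)\<bar> \<le> x ^ (2 * m) / fact (2 * m)"
    by (simp add: n[symmetric] lessThan_Suc_atMost del: power_Suc fact_Suc sum.lessThan_Suc)
qed

lemma polyfun_bounded_on_cube:
  "polyfun N d r \<Longrightarrow> \<exists>B. \<forall>w. (\<forall>j. \<bar>w j\<bar> \<le> 1) \<longrightarrow> \<bar>r w\<bar> \<le> B"
proof (induction rule: polyfun.induct)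
  case (add d f g)
  then obtain B C where "\<forall>w. (\<forall>j. \<bar>w j\<bar> \<le> 1) \<longrightarrow> \<bar>f w\<bar> \<le> B" "\<forall>w. (\<forall>j. \<bar>w j\<bar> \<le> 1) \<longrightarrow> \<bar>g w\<bar> \<le> C" by blast
  then show ?case by (intro exI[of _ "B + C"]) (meson abs_triangle_ineq add_mono order_trans)
next
  case (var_mult i d f)
  then obtain B where B: "\<forall>w. (\<forall>j. \<bar>w j\<bar> \<le> 1) \<longrightarrow> \<bar>f w\<bar> \<le> B" by blast
  have "\<bar>w i * f w\<bar> \<le> B" if "\<forall>j. \<bar>w j\<bar> \<le> 1" for w
  proof -
    have "\<bar>w i * f w\<bar> \<le> 1 * B" unfolding abs_mult using B that by (intro mult_mono) auto
    then show ?thesis by simp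
  qed
  then show ?case by blast
qed auto

text \<open>The full cube over all coordinates is compact by Tychonoff, and coordinates separate its
  points, so Stone--Weierstrass applies.\<close>

lemma polyfun_dense_on_cube:
  fixes h :: "(nat \<Rightarrow> real) \<Rightarrow> real"
  assumes "continuous_on {w. \<forall>j. \<bar>w j\<bar> \<le> 1} h" "0 < e"
  obtains N d r where "polyfun N d r" "\<forall>w. (\<forall>j. \<bar>w j\<bar> \<le> 1) \<longrightarrow> \<bar>h w - r w\<bar> < e"
proof -
  define S where "S = {w :: nat \<Rightarrow> real. \<forall>j. \<bar>w j\<bar> \<le> 1}"
  define R where "R = {f. \<exists>N d. polyfun N d f}"
  have S: "S = PiE UNIV (\<lambda>_. {-1..1})" by (auto simp: S_def PiE_def abs_le_iff minus_le_iff)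
  have "compactin (product_topology (\<lambda>i. euclidean) UNIV) S"
    unfolding S compactin_PiE by simp
  then have "compact S" by (simp add: euclidean_product_topology)
  interpret function_ring_on R S
  proof
    show "compact S" by fact
    show "continuous_on S f" if f: "f \<in> R" for f
    proof -
      obtain N d where "polyfun N d f" using f by (auto simp: R_def)
      then show ?thesis
        by (rule continuous_on_polyfun) (rule continuous_on_subset[OF continuous_on_product_coordinates], simp)
    qed
    show "(\<lambda>x. f x + g x) \<in> R" if fg: "f \<in> R" "g \<in> R" for f g
    proof -
      obtain N d N' d' where "polyfun N d f" "polyfun N' d' g" using fg by (auto simp: R_def)
      then have "polyfun (N + N') (d + d') f" "polyfun (N + N') (d + d') g"
        by (auto intro: polyfun_mono[OF polyfun_mono_vars])
      then show ?thesis unfolding R_def using polyfun.add by blast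
    qed
    show "(\<lambda>x. f x * g x) \<in> R" if fg: "f \<in> R" "g \<in> R" for f g
    proof -
      obtain N d N' d' where "polyfun N d f" "polyfun N' d' g" using fg by (auto simp: R_def)
      then have "polyfun (N + N') d f" "polyfun (N + N') d' g"
        by (auto intro: polyfun_mono_vars)
      then show ?thesis unfolding R_def using polyfun_mult by blast
    qed
    show "(\<lambda>_. c) \<in> R" for c unfolding R_def using polyfun.const by blast
    show "\<exists>f\<in>R. f x \<noteq> f y" if xy: "x \<noteq> y" for x y
    proof -
      obtain i where "x i \<noteq> y i" using xy by auto
      moreover have "(\<lambda>x. x i) \<in> R" unfolding R_def mem_Collect_eq by (intro exI, rule polyfun_var[OF lessI])
      ultimately show ?thesis by (intro bexI[of _ "\<lambda>x. x i"])
    qed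
  qed
  have "continuous_on S h" using assms(1) by (simp add: S_def)
  from Stone_Weierstrass_basic[OF this assms(2)]
  obtain r where r: "r \<in> R" "\<forall>w\<in>S. \<bar>h w - r w\<bar> < e" by (elim bexE)
  from r(1) obtain N d where "polyfun N d r" unfolding R_def mem_Collect_eq by (elim exE)
  then show ?thesis using r(2) by (intro that[of N d r]) (auto simp: S_def)
qed

definition lin_form :: "nat \<Rightarrow> (nat \<Rightarrow> real) \<Rightarrow> (nat \<Rightarrow> real) \<Rightarrow> real" where
  "lin_form K t y = (\<Sum>j<K. t j * y j)"

lemma polyfun_lin_form: "polyfun K 1 (lin_form K t)"
  unfolding lin_form_def[abs_def] by (intro polyfun_sum polyfun_cmult polyfun_var) auto

lemma lin_form_update:
  assumes "i < K"
  shows "lin_form K (t(i := t i + a)) y = lin_form K t y + a * y i"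
proof -
  have "lin_form K (t(i := t i + a)) y = (\<Sum>j<K. t j * y j + (if j = i then a * y i else 0))"
    unfolding lin_form_def by (intro sum.cong) (auto simp: algebra_simps)
  then show ?thesis using assms by (simp add: sum.distrib lin_form_def)
qed

section \<open>Moments of elements of the first chaos\<close>

context gaussian_seq
begin

definition Gint :: "((nat \<Rightarrow> real) \<Rightarrow> real) \<Rightarrow> bool" where
  "Gint f \<longleftrightarrow> integrable M (\<lambda>\<omega>. f (\<lambda>i. G i \<omega>))"

definition Gmeas :: "((nat \<Rightarrow> real) \<Rightarrow> real) \<Rightarrow> bool" where
  "Gmeas f \<longleftrightarrow> (\<lambda>\<omega>. f (\<lambda>i. G i \<omega>)) \<in> borel_measurable M"

lemma pfun_Gint: "pfun N f \<Longrightarrow> Gint f"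
  unfolding pfun_def Gint_def using integrable_polyfun by blast

lemma pfun_Gmeas: "pfun N f \<Longrightarrow> Gmeas f"
  unfolding pfun_def Gmeas_def using polyfun_G_measurable by blast

lemma Gint_bounded: "Gmeas f \<Longrightarrow> (\<And>x. \<bar>f x\<bar> \<le> B) \<Longrightarrow> Gint f"
  unfolding Gmeas_def Gint_def by (rule integrable_const_bound[where B = B]) auto

lemma Ex_abs_diff_le:
  assumes "Gint f" "Gint g" "Gint h" "\<And>x. \<bar>f x - g x\<bar> \<le> h x"
  shows "\<bar>Ex f - Ex g\<bar> \<le> Ex h"
proof -
  have "Ex f - Ex g = (\<integral>\<omega>. f (\<lambda>i. G i \<omega>) - g (\<lambda>i. G i \<omega>) \<partial>M)"
    using assms(1,2) unfolding Ex_def Gint_def by simp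
  also have "\<bar>\<dots>\<bar> \<le> (\<integral>\<omega>. \<bar>f (\<lambda>i. G i \<omega>) - g (\<lambda>i. G i \<omega>)\<bar> \<partial>M)" by (rule integral_abs_bound)
  also have "\<dots> \<le> Ex h"
    unfolding Ex_def using assms unfolding Gint_def by (intro integral_mono) auto
  finally show ?thesis .
qed

text \<open>Isserlis' recursion with equal factors, exact because irreducibility is vacuous in order
  1.\<close>

lemma Ex_chaos_1_power:
  assumes X: "chaos K 1 X"
  shows "Ex (\<lambda>x. X x ^ (k + 2)) = real (k + 1) * Ex (\<lambda>x. (X x)\<^sup>2) * Ex (\<lambda>x. X x ^ k)"
proof -
  define B where "B = Ex (\<lambda>x. (X x)\<^sup>2)"
  have B: "0 \<le> B" by (simp add: B_def)
  let ?Ys = "replicate (Suc k) X"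
  obtain C where "0 \<le> C" and C: "\<forall>N Z e Ys. chaos N 1 Z \<longrightarrow> irreducible N 1 e Z \<longrightarrow> 0 \<le> e \<longrightarrow> length Ys = Suc k \<longrightarrow>
    (\<forall>Y\<in>set Ys. polyfun N 1 Y \<and> Ex (\<lambda>x. (Y x)\<^sup>2) \<le> B) \<longrightarrow>
    (Ex (\<lambda>x. Z x * (\<Prod>Y\<leftarrow>Ys. Y x)) -
      (\<Sum>i<Suc k. Ex (\<lambda>x. Z x * (Ys ! i) x) * Ex (\<lambda>x. \<Prod>Y\<leftarrow>remove_nth i Ys. Y x)))\<^sup>2 \<le> C * e"
    using approx_isserlis[OF order_refl B, of "Suc k"] by (elim exE conjE) (erule (1) that)
  have "(Ex (\<lambda>x. X x * (\<Prod>Y\<leftarrow>?Ys. Y x)) -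
      (\<Sum>i<Suc k. Ex (\<lambda>x. X x * (?Ys ! i) x) * Ex (\<lambda>x. \<Prod>Y\<leftarrow>remove_nth i ?Ys. Y x)))\<^sup>2 \<le> C * 0"
  proof (rule C[rule_format, OF X])
    show "irreducible K 1 0 X" by (auto simp: irreducible_def)
    show "polyfun K 1 Y \<and> Ex (\<lambda>x. (Y x)\<^sup>2) \<le> B" if "Y \<in> set ?Ys" for Y
    proof -
      have "Y = X" using that by (metis in_set_replicate)
      then show ?thesis using chaos_polyfun[OF X] by (simp add: B_def)
    qed
  qed auto
  then have "Ex (\<lambda>x. X x * (\<Prod>Y\<leftarrow>?Ys. Y x)) =
      (\<Sum>i<Suc k. Ex (\<lambda>x. X x * (?Ys ! i) x) * Ex (\<lambda>x. \<Prod>Y\<leftarrow>remove_nth i ?Ys. Y x))" by simp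
  also have "\<dots> = (\<Sum>i<Suc k. B * Ex (\<lambda>x. X x ^ k))"
  proof (intro sum.cong refl)
    fix i assume i: "i \<in> {..<Suc k}"
    have "remove_nth i ?Ys = replicate k X"
      using i by (simp add: remove_nth_def take_replicate drop_replicate replicate_add[symmetric] del: replicate_Suc)
    moreover have "?Ys ! i = X" using i by (simp del: replicate_Suc)
    ultimately show "Ex (\<lambda>x. X x * (?Ys ! i) x) * Ex (\<lambda>x. \<Prod>Y\<leftarrow>remove_nth i ?Ys. Y x) = B * Ex (\<lambda>x. X x ^ k)"
      by (simp add: B_def power2_eq_square map_replicate_const prod_list_replicate del: replicate_Suc)
  qed
  finally show ?thesis
    by (simp add: B_def map_replicate_const prod_list_replicate mult_ac)
qed

text \<open>Normalised this way, even Gaussian moments are the terms of an exponential series. So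
  they tend to 0, and with them the Taylor remainders of the cosine.\<close>

lemma Ex_chaos_1_even_power:
  assumes X: "chaos K 1 X"
  shows "Ex (\<lambda>x. X x ^ (2 * m)) / fact (2 * m) = (Ex (\<lambda>x. (X x)\<^sup>2) / 2) ^ m / fact m"
proof (induction m)
  case (Suc m)
  have "Ex (\<lambda>x. X x ^ (2 * Suc m)) = real (2 * m + 1) * Ex (\<lambda>x. (X x)\<^sup>2) * Ex (\<lambda>x. X x ^ (2 * m))"
    using Ex_chaos_1_power[OF X, of "2 * m"] by simp
  moreover have "(fact (2 * Suc m) :: real) = real (2 * m + 1) * (2 * real (Suc m)) * fact (2 * m)"
    by (simp add: algebra_simps)
  ultimately have "Ex (\<lambda>x. X x ^ (2 * Suc m)) / fact (2 * Suc m) =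
      (real (2 * m + 1) * (Ex (\<lambda>x. (X x)\<^sup>2) * Ex (\<lambda>x. X x ^ (2 * m)))) /
      (real (2 * m + 1) * (2 * real (Suc m) * fact (2 * m)))" by (simp only: mult.assoc)
  also have "\<dots> = (Ex (\<lambda>x. (X x)\<^sup>2) * Ex (\<lambda>x. X x ^ (2 * m))) / (2 * real (Suc m) * fact (2 * m))"
    by (rule mult_divide_mult_cancel_left) simp
  also have "\<dots> = (Ex (\<lambda>x. (X x)\<^sup>2) / 2) / real (Suc m) * (Ex (\<lambda>x. X x ^ (2 * m)) / fact (2 * m))"
    by simp
  finally show ?case unfolding Suc.IH by simp
qed simp

lemma Ex_chaos_1_even_power_tendsto:
  assumes X: "chaos K 1 X"
  shows "(\<lambda>m. Ex (\<lambda>x. X x ^ (2 * m)) / fact (2 * m)) \<longlonglongrightarrow> 0"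
  unfolding Ex_chaos_1_even_power[OF X]
  using summable_LIMSEQ_zero[OF summable_exp[of "Ex (\<lambda>x. (X x)\<^sup>2) / 2"]] by (simp add: field_simps)

end

section \<open>From polynomial to trigonometric and bounded continuous test functions\<close>

context irreducible_family
begin

lemma polyfun_Z_tendsto:
  assumes "polyfun K d p"
  shows "((\<lambda>n. Ex (\<lambda>x. p (\<lambda>j. Z j n x))) \<longlongrightarrow> Ex (\<lambda>x. p (\<lambda>j. lgauss j x))) U"
proof -
  obtain D where "bseq D (\<lambda>n x. p (\<lambda>j. Z j n x))" using bseq_polyfun_Z[OF assms] by (elim exE)
  from UEx_tendsto[OF this] show ?thesis unfolding UEx_polyfun_Z[OF assms] .
qed

lemma chaos_lin_form_lgauss: "chaos K 1 (\<lambda>x. lin_form K t (\<lambda>j. lgauss j x))"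
  unfolding chaos_def
proof (intro conjI allI impI)
  have p: "polyfun K (1 * 1) (\<lambda>x. lin_form K t (\<lambda>j. lgauss j x))"
    by (rule polyfun_comp[OF polyfun_lin_form polyfun_lgauss'])
  then show "polyfun K 1 (\<lambda>x. lin_form K t (\<lambda>j. lgauss j x))" by simp
  fix k h assume "k < 1" "polyfun K k h"
  then obtain c where c: "h = (\<lambda>x. c)" using polyfun_0 by auto
  have "Ex (\<lambda>x. lin_form K t (\<lambda>j. lgauss j x) * h x) = Ex (\<lambda>x. \<Sum>j<K. (c * t j) * lgauss j x)"
    by (simp add: c lin_form_def sum_distrib_left sum_distrib_right mult_ac)
  also have "\<dots> = (\<Sum>j<K. Ex (\<lambda>x. (c * t j) * lgauss j x))"
    by (intro Ex_psum[of _ K] pfun_cmult pfun_lgauss) auto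
  also have "\<dots> = 0" by (simp only: Ex_cmult Ex_lgauss) simp
  finally show "Ex (\<lambda>x. lin_form K t (\<lambda>j. lgauss j x) * h x) = 0" .
qed

text \<open>The Taylor order is fixed by the Gaussian side. The Taylor polynomial and its polynomial
  error bound both converge along \<open>U\<close>, so the remainder on the \<open>Z\<close> side is
  eventually small as well.\<close>

lemma cos_lin_form_tendsto:
  "((\<lambda>n. Ex (\<lambda>x. cos (c + lin_form K t (\<lambda>j. Z j n x)))) \<longlongrightarrow> Ex (\<lambda>x. cos (c + lin_form K t (\<lambda>j. lgauss j x)))) U"
proof (rule tendstoI)
  fix e :: real assume e: "0 < e"
  let ?X = "\<lambda>x. lin_form K t (\<lambda>j. lgauss j x)"
  have "\<forall>\<^sub>F m in sequentially. Ex (\<lambda>x. ?X x ^ (2 * m)) / fact (2 * m) < e / 4"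
    using order_tendstoD(2)[OF Ex_chaos_1_even_power_tendsto[OF chaos_lin_form_lgauss[of K t]], of "e / 4"] e by simp
  then have "\<forall>\<^sub>F m in sequentially. 1 \<le> m \<and> Ex (\<lambda>x. ?X x ^ (2 * m)) / fact (2 * m) < e / 4"
    using eventually_ge_at_top[of 1] by eventually_elim auto
  then obtain m where m: "1 \<le> m" "Ex (\<lambda>x. ?X x ^ (2 * m)) / fact (2 * m) < e / 4"
    by (auto simp: eventually_sequentially)
  obtain \<alpha> where \<alpha>: "\<And>x. \<bar>cos (c + x) - (\<Sum>k<2 * m. \<alpha> k * x ^ k)\<bar> \<le> x ^ (2 * m) / fact (2 * m)"
    using cos_taylor[OF m(1), of c] by blast
  define P where "P y = (\<Sum>k<2 * m. \<alpha> k * lin_form K t y ^ k)" for y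
  define Q where "Q y = (1 / fact (2 * m)) * lin_form K t y ^ (2 * m)" for y
  have "pfun K P" "pfun K Q" unfolding P_def Q_def
    using polyfun_imp_pfun[OF polyfun_lin_form[of K t]]
    by (auto intro!: pfun_sum pfun_cmult pfun_power simp del: times_divide_eq_left)
  then obtain d1 d2 where P: "polyfun K d1 P" and Q: "polyfun K d2 Q" by (auto simp: pfun_def)
  have bnd: "\<bar>Ex (\<lambda>x. cos (c + lin_form K t (\<lambda>j. Y j x))) - Ex (\<lambda>x. P (\<lambda>j. Y j x))\<bar> \<le> Ex (\<lambda>x. Q (\<lambda>j. Y j x))"
    if Y: "\<And>j. j < K \<Longrightarrow> \<exists>D. polyfun N D (Y j)" for Y N
  proof -
    obtain D' where D': "\<And>j. j < K \<Longrightarrow> polyfun N (D' j) (Y j)" using Y by metis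
    define D where "D = (\<Sum>j<K. D' j)"
    have D: "polyfun N D (Y j)" if "j < K" for j
      using polyfun_mono[OF D'[OF that]] member_le_sum[of j "{..<K}" D'] that by (simp add: D_def)
    have lin: "pfun N (\<lambda>x. lin_form K t (\<lambda>j. Y j x))"
      by (rule polyfun_imp_pfun[OF polyfun_comp[OF polyfun_lin_form D]])
    then have [measurable]: "(\<lambda>\<omega>. lin_form K t (\<lambda>j. Y j (\<lambda>i. G i \<omega>))) \<in> borel_measurable M"
      using pfun_Gmeas unfolding Gmeas_def by blast
    show ?thesis
    proof (rule Ex_abs_diff_le)
      show "Gint (\<lambda>x. cos (c + lin_form K t (\<lambda>j. Y j x)))"
        by (rule Gint_bounded[of _ 1]) (auto simp: Gmeas_def)
      show "Gint (\<lambda>x. P (\<lambda>j. Y j x))" by (rule pfun_Gint[OF polyfun_imp_pfun[OF polyfun_comp[OF P D]]])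
      show "Gint (\<lambda>x. Q (\<lambda>j. Y j x))" by (rule pfun_Gint[OF polyfun_imp_pfun[OF polyfun_comp[OF Q D]]])
      show "\<bar>cos (c + lin_form K t (\<lambda>j. Y j x)) - P (\<lambda>j. Y j x)\<bar> \<le> Q (\<lambda>j. Y j x)" for x
        using \<alpha>[of "lin_form K t (\<lambda>j. Y j x)"] by (simp add: P_def Q_def)
    qed
  qed
  have QX: "Ex (\<lambda>x. Q (\<lambda>j. lgauss j x)) < e / 4"
    unfolding Q_def Ex_cmult using m(2) by simp
  have lim: "\<bar>Ex (\<lambda>x. cos (c + ?X x)) - Ex (\<lambda>x. P (\<lambda>j. lgauss j x))\<bar> \<le> Ex (\<lambda>x. Q (\<lambda>j. lgauss j x))"
    using polyfun_lgauss' by (intro bnd[of K]) blast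
  have "\<forall>\<^sub>F n in U. dist (Ex (\<lambda>x. P (\<lambda>j. Z j n x))) (Ex (\<lambda>x. P (\<lambda>j. lgauss j x))) < e / 4"
    using e by (intro tendstoD[OF polyfun_Z_tendsto[OF P]]) auto
  moreover have "\<forall>\<^sub>F n in U. Ex (\<lambda>x. Q (\<lambda>j. Z j n x)) < e / 4"
    using order_tendstoD(2)[OF polyfun_Z_tendsto[OF Q] QX] .
  ultimately show "\<forall>\<^sub>F n in U. dist (Ex (\<lambda>x. cos (c + lin_form K t (\<lambda>j. Z j n x)))) (Ex (\<lambda>x. cos (c + ?X x))) < e"
  proof eventually_elim
    case (elim n)
    have "\<bar>Ex (\<lambda>x. cos (c + lin_form K t (\<lambda>j. Z j n x))) - Ex (\<lambda>x. P (\<lambda>j. Z j n x))\<bar> \<le> Ex (\<lambda>x. Q (\<lambda>j. Z j n x))"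
      using bseq_polyfun[OF Z_bseq] by (intro bnd[of "Nv n" "\<lambda>j. Z j n"]) blast
    then show ?case using elim lim QX e unfolding dist_real_def by linarith
  qed
qed

text \<open>Sine factors are absorbed one at a time by product-to-sum formulas; each changes the
  phase \<open>c\<close> and one frequency in \<open>t\<close>, so both are generalised in the
  induction.\<close>

lemma trig_lin_form_tendsto:
  assumes "polyfun K d r"
  shows "((\<lambda>n. Ex (\<lambda>x. cos (c + lin_form K t (\<lambda>j. Z j n x)) * r (\<lambda>j. sin (Z j n x / L)))) \<longlongrightarrow>
    Ex (\<lambda>x. cos (c + lin_form K t (\<lambda>j. lgauss j x)) * r (\<lambda>j. sin (lgauss j x / L)))) U"
proof -
  define T where "T Y c t r = Ex (\<lambda>x. cos (c + lin_form K t (\<lambda>j. Y j x)) * r (\<lambda>j. sin (Y j x / L)))"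
    for Y :: "nat \<Rightarrow> (nat \<Rightarrow> real) \<Rightarrow> real" and c t r
  have Tint: "Gint (\<lambda>x. cos (c + lin_form K t (\<lambda>j. Y j x)) * r (\<lambda>j. sin (Y j x / L)))"
    if r: "polyfun K d r" and Y: "\<And>j. Gmeas (Y j)" for Y c t r d
  proof -
    obtain B where B: "\<And>w. (\<forall>j. \<bar>w j\<bar> \<le> 1) \<Longrightarrow> \<bar>r w\<bar> \<le> B" using polyfun_bounded_on_cube[OF r] by blast
    have [measurable]: "(\<lambda>\<omega>. Y j (\<lambda>i. G i \<omega>)) \<in> borel_measurable M" for j using Y by (simp add: Gmeas_def)
    have [measurable]: "(\<lambda>\<omega>. r (\<lambda>j. sin (Y j (\<lambda>i. G i \<omega>) / L))) \<in> borel_measurable M"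
      by (rule measurable_polyfun[OF r]) simp
    have [measurable]: "(\<lambda>\<omega>. lin_form K t (\<lambda>j. Y j (\<lambda>i. G i \<omega>))) \<in> borel_measurable M"
      unfolding lin_form_def by simp
    show ?thesis
    proof (rule Gint_bounded)
      show "Gmeas (\<lambda>x. cos (c + lin_form K t (\<lambda>j. Y j x)) * r (\<lambda>j. sin (Y j x / L)))" by (simp add: Gmeas_def)
      fix x
      have "\<bar>cos (c + lin_form K t (\<lambda>j. Y j x)) * r (\<lambda>j. sin (Y j x / L))\<bar> \<le> 1 * B"
        unfolding abs_mult using B by (intro mult_mono) auto
      then show "\<bar>cos (c + lin_form K t (\<lambda>j. Y j x)) * r (\<lambda>j. sin (Y j x / L))\<bar> \<le> B" by simp
    qed
  qed
  have Tadd: "T Y c t (\<lambda>w. f w + g w) = T Y c t f + T Y c t g"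
    if "polyfun K d f" "polyfun K d g" "\<And>j. Gmeas (Y j)" for Y c t f g d
    using Tint[OF that(1,3), of c t] Tint[OF that(2,3), of c t] unfolding T_def Ex_def Gint_def
    by (simp add: distrib_left)
  have Tvar: "T Y c t (\<lambda>w. w i * f w) =
      (1/2) * T Y (c - pi / 2) (t(i := t i + 1 / L)) f - (1/2) * T Y (c - pi / 2) (t(i := t i + (- 1 / L))) f"
    if "polyfun K d f" "\<And>j. Gmeas (Y j)" "i < K" for Y c t f d i
  proof -
    \<comment> \<open>A difference of sines, rewritten as cosines by a shift of the phase so that
      the form of the integrand is preserved.\<close>
    have trig: "cos A * (sin u * R) = (1/2) * (cos (A + u - pi / 2) * R) - (1/2) * (cos (A - u - pi / 2) * R)" for A u R :: real
    proof -
      have "cos (y - pi / 2) = sin y" for y :: real by (simp add: cos_diff)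
      then show ?thesis by (simp only: sin_add sin_diff) (simp add: algebra_simps)
    qed
    have eqn: "cos (c + lin_form K t y) * (sin (y i / L) * R) =
       (1/2) * (cos (c - pi / 2 + lin_form K (t(i := t i + 1 / L)) y) * R) -
       (1/2) * (cos (c - pi / 2 + lin_form K (t(i := t i + (- 1 / L))) y) * R)" for y R
    proof -
      have "c - pi / 2 + (lin_form K t y + 1 / L * y i) = c + lin_form K t y + y i / L - pi / 2"
        "c - pi / 2 + (lin_form K t y + (- 1 / L) * y i) = c + lin_form K t y - y i / L - pi / 2" by simp_all
      then show ?thesis unfolding lin_form_update[OF that(3)] by (simp only: trig)
    qed
    have int: "integrable M (\<lambda>\<omega>. cos (c' + lin_form K t' (\<lambda>j. Y j (\<lambda>i. G i \<omega>))) *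
        f (\<lambda>j. sin (Y j (\<lambda>i. G i \<omega>) / L)))" for c' t'
    proof -
      have "Gint (\<lambda>x. cos (c' + lin_form K t' (\<lambda>j. Y j x)) * f (\<lambda>j. sin (Y j x / L)))"
        by (rule Tint[OF that(1)]) (rule that(2))
      then show ?thesis unfolding Gint_def .
    qed
    have "T Y c t (\<lambda>w. w i * f w) = (\<integral>\<omega>.
       (1/2) * (cos (c - pi / 2 + lin_form K (t(i := t i + 1 / L)) (\<lambda>j. Y j (\<lambda>i. G i \<omega>))) *
          f (\<lambda>j. sin (Y j (\<lambda>i. G i \<omega>) / L))) -
       (1/2) * (cos (c - pi / 2 + lin_form K (t(i := t i + (- 1 / L))) (\<lambda>j. Y j (\<lambda>i. G i \<omega>))) *
          f (\<lambda>j. sin (Y j (\<lambda>i. G i \<omega>) / L))) \<partial>M)"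
      unfolding T_def Ex_def
      by (intro Bochner_Integration.integral_cong refl eqn[of "\<lambda>j. Y j (\<lambda>i. G i _)"])
    also have "\<dots> = (1/2) * T Y (c - pi / 2) (t(i := t i + 1 / L)) f - (1/2) * T Y (c - pi / 2) (t(i := t i + (- 1 / L))) f"
      unfolding T_def Ex_def integral_mult_right_zero[symmetric]
      by (intro Bochner_Integration.integral_diff integrable_mult_right int)
    finally show ?thesis .
  qed
  have Zm: "Gmeas (Z j n)" for j n by (rule pfun_Gmeas[OF bseq_pfun[OF Z_bseq]])
  have lm: "Gmeas (lgauss j)" for j by (rule pfun_Gmeas[OF pfun_lgauss[of j "Suc j"]]) simp
  have "((\<lambda>n. T (\<lambda>j. Z j n) c t r) \<longlongrightarrow> T lgauss c t r) U"
    using assms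
  proof (induction arbitrary: c t rule: polyfun.induct)
    case (const d a)
    have "T Y c t (\<lambda>w. a) = a * Ex (\<lambda>x. cos (c + lin_form K t (\<lambda>j. Y j x)))" for Y
      unfolding T_def Ex_cmult[symmetric] by (simp add: mult.commute)
    then show ?case by (simp only:) (intro tendsto_intros cos_lin_form_tendsto)
  next
    case (add d f g)
    then show ?case by (simp add: Tadd[OF add.hyps] Zm lm tendsto_add)
  next
    case (var_mult i d f)
    show ?case
      unfolding Tvar[OF var_mult.hyps(2) Zm var_mult.hyps(1)] Tvar[OF var_mult.hyps(2) lm var_mult.hyps(1)]
      by (intro tendsto_intros var_mult.IH)
  qed
  then show ?thesis unfolding T_def .
qed

text \<open>The limit law need not be determined by its moments, so moment convergence is used only
  for the Gaussian family itself. With \<open>w = sin (y / L)\<close>, a bounded continuous function of \<open>y\<close>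
  in a large box becomes a continuous function on the cube, which Stone--Weierstrass approximates
  by polynomials in \<open>w\<close>; these are trigonometric polynomials in \<open>y\<close>, hence globally bounded.\<close>

theorem polyfun_Z_weak_conv:
  assumes p: "polyfun K d p" and \<phi>: "continuous_on UNIV \<phi>" "\<And>y :: real. \<bar>\<phi> y\<bar> \<le> (1 :: real)"
  shows "((\<lambda>n. Ex (\<lambda>x. \<phi> (p (\<lambda>j. Z j n x)))) \<longlongrightarrow> Ex (\<lambda>x. \<phi> (p (\<lambda>j. lgauss j x)))) U"
proof (rule tendstoI)
  fix e :: real assume e: "0 < e"
  obtain B' where B0: "\<forall>i. 0 \<le> B' i" and B': "\<forall>i n. Ex (\<lambda>x. (Z i n x)\<^sup>2) \<le> B' i"
    using Z_bounds .
  have Blg: "Ex (\<lambda>x. (lgauss i x)\<^sup>2) \<le> B' i" for i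
  proof -
    have "Ex (\<lambda>x. (lgauss i x)\<^sup>2) = UEx (\<lambda>n x. (Z i n x)\<^sup>2)"
      using Ex_lgauss_lgauss[of i i] by (simp add: gram_def power2_eq_square)
    also have "\<dots> \<le> B' i"
      by (rule tendsto_upperbound[OF UEx_tendsto[OF bseq_square[OF Z_bseq]] _ U_not_bot])
        (use B' in auto)
    finally show ?thesis .
  qed
  define B where "B = (\<Sum>i<K. B' i)"
  have B: "0 \<le> B" unfolding B_def using B0 by (intro sum_nonneg) auto
  \<comment> \<open>Makes the second moment cost of leaving the box smaller than
    \<open>e / 8\<close>.\<close>
  define L where "L = 1 + 16 * B / e"
  have L: "1 \<le> L" using B e by (simp add: L_def)
  have LB: "2 * B / L\<^sup>2 < e / 8"
  proof -
    have "16 * B / e < L" by (simp add: L_def)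
    then have "16 * B < L * e" using e by (simp add: field_simps)
    also have "\<dots> \<le> L\<^sup>2 * e" using L e by (simp add: power2_eq_square)
    finally show ?thesis using L by (simp add: field_simps)
  qed
  define h where "h w = \<phi> (p (\<lambda>j. L * arcsin (w j)))" for w
  have "continuous_on {w. \<forall>j. \<bar>w j\<bar> \<le> 1} (\<lambda>w. p (\<lambda>j. L * arcsin (w j)))"
  proof (rule continuous_on_polyfun[OF p])
    fix j
    have "continuous_on {w :: nat \<Rightarrow> real. \<forall>j. \<bar>w j\<bar> \<le> 1} (\<lambda>w. w j)"
      by (rule continuous_on_subset[OF continuous_on_product_coordinates]) simp
    then show "continuous_on {w. \<forall>j. \<bar>w j\<bar> \<le> 1} (\<lambda>w. L * arcsin (w j))"
      by (intro continuous_intros) (auto simp: abs_le_iff minus_le_iff)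
  qed
  then have hc: "continuous_on {w. \<forall>j. \<bar>w j\<bar> \<le> 1} h"
    unfolding h_def by (intro continuous_on_compose2[OF \<phi>(1)]) auto
  have e8: "0 < e / 8" using e by simp
  obtain N d' r where r: "polyfun N d' r" "\<forall>w. (\<forall>j. \<bar>w j\<bar> \<le> 1) \<longrightarrow> \<bar>h w - r w\<bar> < e / 8"
    using polyfun_dense_on_cube[OF hc e8] .
  \<comment> \<open>In the box \<open>arcsin\<close> inverts the sine, since 1 is below half of pi.
    Outside it, \<open>\<phi>\<close> and \<open>h\<close> are bounded by 1 and the quadratic term
    is at least 2.\<close>
  have pt: "\<bar>\<phi> (p y) - r (\<lambda>j. sin (y j / L))\<bar> \<le> e / 8 + (2 / L\<^sup>2) * (\<Sum>j<K. (y j)\<^sup>2)" for y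
  proof -
    have hr: "\<bar>h (\<lambda>j. sin (y j / L)) - r (\<lambda>j. sin (y j / L))\<bar> < e / 8" using r(2) by simp
    have S0: "0 \<le> (2 / L\<^sup>2) * (\<Sum>j<K. (y j)\<^sup>2)" by (intro mult_nonneg_nonneg sum_nonneg) auto
    show ?thesis
    proof (cases "\<forall>j<K. \<bar>y j\<bar> \<le> L")
      case True
      have "h (\<lambda>j. sin (y j / L)) = \<phi> (p y)"
        unfolding h_def
      proof (rule arg_cong[of _ _ \<phi>], rule polyfun_cong[OF p])
        fix j assume "j < K"
        then have "\<bar>y j\<bar> \<le> L" using True by simp
        then have "\<bar>y j / L\<bar> \<le> 1" using L by (simp add: abs_divide field_simps)
        then have "arcsin (sin (y j / L)) = y j / L"
          using pi_ge_two by (intro arcsin_sin) linarith+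
        then show "L * arcsin (sin (y j / L)) = y j" using L by simp
      qed
      then show ?thesis using hr S0 by linarith
    next
      case False
      then obtain j where j: "j < K" "\<not> \<bar>y j\<bar> \<le> L" by blast
      have "L\<^sup>2 \<le> (y j)\<^sup>2" using j L by (intro abs_le_square_iff[THEN iffD1]) auto
      also have "\<dots> \<le> (\<Sum>j<K. (y j)\<^sup>2)" using j by (intro member_le_sum) auto
      finally have "2 \<le> (2 / L\<^sup>2) * (\<Sum>j<K. (y j)\<^sup>2)" using L by (simp add: field_simps)
      moreover have "\<bar>h (\<lambda>j. sin (y j / L))\<bar> \<le> 1" "\<bar>\<phi> (p y)\<bar> \<le> 1" using \<phi>(2) by (auto simp: h_def)
      ultimately show ?thesis using hr by linarith
    qed
  qed
  have bnd: "\<bar>Ex (\<lambda>x. \<phi> (p (\<lambda>j. Y j x))) - Ex (\<lambda>x. r (\<lambda>j. sin (Y j x / L)))\<bar> < e / 4"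
    if Y: "\<And>j. j < K \<Longrightarrow> pfun N' (Y j)" "\<And>j. Gmeas (Y j)" "\<And>j. j < K \<Longrightarrow> Ex (\<lambda>x. (Y j x)\<^sup>2) \<le> B' j" for Y N'
  proof -
    have [measurable]: "(\<lambda>\<omega>. Y j (\<lambda>i. G i \<omega>)) \<in> borel_measurable M" for j using Y(2) by (simp add: Gmeas_def)
    have [measurable]: "\<phi> \<in> borel_measurable borel" using \<phi>(1) by (rule borel_measurable_continuous_onI)
    have [measurable]: "(\<lambda>\<omega>. p (\<lambda>j. Y j (\<lambda>i. G i \<omega>))) \<in> borel_measurable M"
      by (rule measurable_polyfun[OF p]) simp
    have [measurable]: "(\<lambda>\<omega>. r (\<lambda>j. sin (Y j (\<lambda>i. G i \<omega>) / L))) \<in> borel_measurable M"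
      by (rule measurable_polyfun[OF r(1)]) simp
    obtain C where C: "\<And>w. (\<forall>j. \<bar>w j\<bar> \<le> 1) \<Longrightarrow> \<bar>r w\<bar> \<le> C" using polyfun_bounded_on_cube[OF r(1)] by blast
    have sp: "pfun N' (\<lambda>x. \<Sum>j<K. (Y j x)\<^sup>2)" using Y(1) by (intro pfun_intros) auto
    have "\<bar>Ex (\<lambda>x. \<phi> (p (\<lambda>j. Y j x))) - Ex (\<lambda>x. r (\<lambda>j. sin (Y j x / L)))\<bar> \<le>
        Ex (\<lambda>x. e / 8 + (2 / L\<^sup>2) * (\<Sum>j<K. (Y j x)\<^sup>2))"
    proof (rule Ex_abs_diff_le)
      show "Gint (\<lambda>x. \<phi> (p (\<lambda>j. Y j x)))" using \<phi>(2) by (intro Gint_bounded[of _ 1]) (simp_all add: Gmeas_def)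
      show "Gint (\<lambda>x. r (\<lambda>j. sin (Y j x / L)))" using C by (intro Gint_bounded[of _ C]) (simp_all add: Gmeas_def)
      show "Gint (\<lambda>x. e / 8 + (2 / L\<^sup>2) * (\<Sum>j<K. (Y j x)\<^sup>2))"
        by (rule pfun_Gint[OF pfun_add[OF pfun_const pfun_cmult[OF sp]]])
    qed (rule pt)
    also have "\<dots> = e / 8 + (2 / L\<^sup>2) * Ex (\<lambda>x. \<Sum>j<K. (Y j x)\<^sup>2)"
      using Ex_padd[OF pfun_const pfun_cmult[OF sp], of "e / 8" "2 / L\<^sup>2"] by (simp only: Ex_cmult Ex_const)
    also have "Ex (\<lambda>x. \<Sum>j<K. (Y j x)\<^sup>2) = (\<Sum>j<K. Ex (\<lambda>x. (Y j x)\<^sup>2))"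
      using Y(1) by (intro Ex_psum[of _ N'] pfun_power) auto
    also have "(2 / L\<^sup>2) * (\<Sum>j<K. Ex (\<lambda>x. (Y j x)\<^sup>2)) \<le> (2 / L\<^sup>2) * B"
      unfolding B_def using Y(3) by (intro mult_left_mono sum_mono) auto
    also have "(2 / L\<^sup>2) * B < e / 8" using LB by simp
    finally show ?thesis by simp
  qed
  have lim: "\<bar>Ex (\<lambda>x. \<phi> (p (\<lambda>j. lgauss j x))) - Ex (\<lambda>x. r (\<lambda>j. sin (lgauss j x / L)))\<bar> < e / 4"
    using Blg pfun_lgauss pfun_Gmeas[OF pfun_lgauss[OF lessI]] by (intro bnd[of K]) auto
  have "((\<lambda>n. Ex (\<lambda>x. r (\<lambda>j. sin (Z j n x / L)))) \<longlongrightarrow> Ex (\<lambda>x. r (\<lambda>j. sin (lgauss j x / L)))) U"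
    using trig_lin_form_tendsto[OF r(1), of 0 "\<lambda>_. 0" L] by (simp add: lin_form_def)
  then have "\<forall>\<^sub>F n in U. dist (Ex (\<lambda>x. r (\<lambda>j. sin (Z j n x / L)))) (Ex (\<lambda>x. r (\<lambda>j. sin (lgauss j x / L)))) < e / 4"
    using e by (intro tendstoD) auto
  then show "\<forall>\<^sub>F n in U. dist (Ex (\<lambda>x. \<phi> (p (\<lambda>j. Z j n x)))) (Ex (\<lambda>x. \<phi> (p (\<lambda>j. lgauss j x)))) < e"
  proof eventually_elim
    case (elim n)
    have "\<bar>Ex (\<lambda>x. \<phi> (p (\<lambda>j. Z j n x))) - Ex (\<lambda>x. r (\<lambda>j. sin (Z j n x / L)))\<bar> < e / 4"
      using B' bseq_pfun[OF Z_bseq] pfun_Gmeas[OF bseq_pfun[OF Z_bseq]]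
      by (intro bnd[of "Nv n" "\<lambda>j. Z j n"]) auto
    then show ?case using elim lim e unfolding dist_real_def by linarith
  qed
qed

end

section \<open>Closedness\<close>

abbreviation monom_eval :: "(nat \<Rightarrow>\<^sub>0 nat) \<Rightarrow> (nat \<Rightarrow> real) \<Rightarrow> real" where
  "monom_eval m x \<equiv> (\<Prod>i\<in>Poly_Mapping.keys m. x i ^ Poly_Mapping.lookup m i)"

lemma total_degree_le_iff: "total_degree p \<le> d \<longleftrightarrow> (\<forall>m\<in>Poly_Mapping.keys p. monom_degree m \<le> d)"
  unfolding total_degree_def by (subst Max_le_iff) auto

lemma monom_eval_superset:
  assumes "finite S" "Poly_Mapping.keys m \<subseteq> S"
  shows "monom_eval m x = (\<Prod>i\<in>S. x i ^ Poly_Mapping.lookup m i)"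
  by (rule prod.mono_neutral_left) (use assms in \<open>auto simp: in_keys_iff\<close>)

lemma monom_degree_superset:
  assumes "finite S" "Poly_Mapping.keys m \<subseteq> S"
  shows "monom_degree m = (\<Sum>i\<in>S. Poly_Mapping.lookup m i)"
  unfolding monom_degree_def by (rule sum.mono_neutral_left) (use assms in \<open>auto simp: in_keys_iff\<close>)

lemma eval_mpoly_superset:
  assumes "finite S" "Poly_Mapping.keys p \<subseteq> S"
  shows "eval_mpoly p x = (\<Sum>m\<in>S. Poly_Mapping.lookup p m * monom_eval m x)"
  unfolding eval_mpoly_def by (rule sum.mono_neutral_left) (use assms in \<open>auto simp: in_keys_iff\<close>)

lemma eval_mpoly_add: "eval_mpoly (p + r) x = eval_mpoly p x + eval_mpoly r x"
proof -
  let ?S = "Poly_Mapping.keys p \<union> Poly_Mapping.keys r"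
  have "Poly_Mapping.keys (p + r) \<subseteq> ?S" by (rule Poly_Mapping.keys_add)
  then show ?thesis
    by (subst (1 2 3) eval_mpoly_superset[of ?S]) (auto simp: lookup_add distrib_right sum.distrib)
qed

lemma total_degree_add: "total_degree p \<le> d \<Longrightarrow> total_degree r \<le> d \<Longrightarrow> total_degree (p + r) \<le> d"
  unfolding total_degree_le_iff using Poly_Mapping.keys_add[of p r] by blast

lemma eval_mpoly_single: "eval_mpoly (Poly_Mapping.single m c) x = c * monom_eval m x"
  by (subst eval_mpoly_superset[of "{m}"]) auto

lemma total_degree_single: "monom_degree m \<le> d \<Longrightarrow> total_degree (Poly_Mapping.single m c) \<le> d"
  unfolding total_degree_le_iff by (auto split: if_splits)

lemma ex_mpoly_sum:
  assumes "finite A" "\<And>a. a \<in> A \<Longrightarrow> \<exists>p. total_degree p \<le> d \<and> eval_mpoly p = f a"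
  shows "\<exists>p. total_degree p \<le> d \<and> eval_mpoly p = (\<lambda>x. \<Sum>a\<in>A. f a x)"
  using assms
proof (induction rule: finite_induct)
  case empty
  then show ?case
    by (intro exI[of _ 0]) (auto simp: total_degree_le_iff eval_mpoly_def)
next
  case (insert a A)
  obtain p where p: "total_degree p \<le> d" "eval_mpoly p = (\<lambda>x. \<Sum>a\<in>A. f a x)" using insert by blast
  obtain r where r: "total_degree r \<le> d" "eval_mpoly r = f a" using insert.prems by blast
  show ?case
    using insert.hyps p r
    by (intro exI[of _ "r + p"]) (auto simp: total_degree_add eval_mpoly_add fun_eq_iff)
qed

lemma polyfun_ex_mpoly: "polyfun N d f \<Longrightarrow> \<exists>p. total_degree p \<le> d \<and> eval_mpoly p = f"
proof (induction rule: polyfun.induct)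
  case (const d c)
  show ?case
    by (intro exI[of _ "Poly_Mapping.single 0 c"] conjI total_degree_single)
      (auto simp: monom_degree_def eval_mpoly_single fun_eq_iff)
next
  case (add d f g)
  then obtain p r where "total_degree p \<le> d" "eval_mpoly p = f" "total_degree r \<le> d" "eval_mpoly r = g" by blast
  then show ?case by (intro exI[of _ "p + r"]) (auto simp: total_degree_add eval_mpoly_add fun_eq_iff)
next
  case (var_mult i d f)
  then obtain p where p: "total_degree p \<le> d" "eval_mpoly p = f" by blast
  have "\<exists>r. total_degree r \<le> Suc d \<and> eval_mpoly r = (\<lambda>x. Poly_Mapping.lookup p m * (x i * monom_eval m x))"
    if m: "m \<in> Poly_Mapping.keys p" for m
  proof -
    define m' where "m' = m + Poly_Mapping.single i 1"
    define S where "S = insert i (Poly_Mapping.keys m)"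
    have S: "finite S" "Poly_Mapping.keys m \<subseteq> S" "Poly_Mapping.keys m' \<subseteq> S"
      using Poly_Mapping.keys_add[of m "Poly_Mapping.single i 1"] by (auto simp: S_def m'_def)
    have lk: "Poly_Mapping.lookup m' j = Poly_Mapping.lookup m j + (if j = i then 1 else 0)" for j
      by (auto simp: m'_def lookup_add lookup_single)
    have "monom_degree m' = monom_degree m + 1"
      unfolding monom_degree_superset[OF S(1,3)] monom_degree_superset[OF S(1,2)] lk
      using S(1) by (simp add: sum.distrib S_def)
    moreover have "monom_degree m \<le> d" using p(1) m by (simp add: total_degree_le_iff)
    ultimately have "monom_degree m' \<le> Suc d" by simp
    moreover have "monom_eval m' x = x i * monom_eval m x" for x
    proof -
      have "monom_eval m' x = (\<Prod>j\<in>S. x j ^ Poly_Mapping.lookup m j * (if j = i then x i else 1))"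
        unfolding monom_eval_superset[OF S(1,3)] by (intro prod.cong) (auto simp: lk)
      also have "\<dots> = monom_eval m x * (\<Prod>j\<in>S. if j = i then x i else 1)"
        unfolding prod.distrib monom_eval_superset[OF S(1,2)] ..
      also have "(\<Prod>j\<in>S. if j = i then x i else 1) = x i"
        using S(1) by (subst prod.delta) (auto simp: S_def)
      finally show ?thesis by simp
    qed
    ultimately show ?thesis
      by (intro exI[of _ "Poly_Mapping.single m' (Poly_Mapping.lookup p m)"] conjI total_degree_single)
        (auto simp: eval_mpoly_single fun_eq_iff)
  qed
  then have "\<exists>r. total_degree r \<le> Suc d \<and>
      eval_mpoly r = (\<lambda>x. \<Sum>m\<in>Poly_Mapping.keys p. Poly_Mapping.lookup p m * (x i * monom_eval m x))"
    by (intro ex_mpoly_sum) auto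
  moreover have "(\<lambda>x. \<Sum>m\<in>Poly_Mapping.keys p. Poly_Mapping.lookup p m * (x i * monom_eval m x)) = (\<lambda>x. x i * f x)"
    unfolding p(2)[symmetric] eval_mpoly_def sum_distrib_left by (simp add: mult.left_commute)
  ultimately show ?case by simp
qed

lemma ex_polyfun_eval_mpoly:
  assumes "total_degree p \<le> d"
  shows "\<exists>N. polyfun N d (eval_mpoly p)"
proof -
  define A where "A = (\<Union>m\<in>Poly_Mapping.keys p. Poly_Mapping.keys m)"
  define N where "N = Suc (Max (insert 0 A))"
  have "finite A" by (simp add: A_def)
  then have N: "i < N" if "i \<in> A" for i unfolding N_def using that by (intro le_imp_less_Suc Max_ge) auto
  have mono: "polyfun N (\<Sum>i\<in>I. e i) (\<lambda>x. \<Prod>i\<in>I. x i ^ e i)" if "finite I" "I \<subseteq> A" for I e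
    using that
  proof (induction rule: finite_induct)
    case (insert i I)
    then have "polyfun N (e i * 1) (\<lambda>x. x i ^ e i)" by (intro polyfun_power polyfun_var N) auto
    then show ?case using insert polyfun_mult[of N "e i * 1"] by simp
  qed (auto intro: polyfun.const)
  have "polyfun N d (monom_eval m)" if "m \<in> Poly_Mapping.keys p" for m
  proof (rule polyfun_mono)
    show "polyfun N (monom_degree m) (monom_eval m)"
      unfolding monom_degree_def using that by (intro mono) (auto simp: A_def)
    show "monom_degree m \<le> d" using assms that by (simp add: total_degree_le_iff)
  qed
  then have "polyfun N d (eval_mpoly p)"
    unfolding eval_mpoly_def[abs_def] by (intro polyfun_sum polyfun_cmult)
  then show ?thesis by blast
qed

section \<open>Comparison of expectations and completeness in L2\<close>

context prob_space
begin

lemma expectation_abs_le: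
  fixes W :: "'a \<Rightarrow> real" and a :: real
  assumes "random_variable borel W" "integrable M (\<lambda>\<omega>. (W \<omega>)\<^sup>2)" "(\<integral>\<omega>. (W \<omega>)\<^sup>2 \<partial>M) \<le> a\<^sup>2" "0 < a"
  shows "integrable M W" "(\<integral>\<omega>. \<bar>W \<omega>\<bar> \<partial>M) \<le> a"
proof -
  show int: "integrable M W" by (rule square_integrable_imp_integrable[OF assms(1,2)])
  have "(\<integral>\<omega>. \<bar>W \<omega>\<bar> \<partial>M) \<le> (\<integral>\<omega>. (W \<omega>)\<^sup>2 / (2 * a) + a / 2 \<partial>M)"
  proof (intro integral_mono)
    show "\<bar>W \<omega>\<bar> \<le> (W \<omega>)\<^sup>2 / (2 * a) + a / 2" for \<omega>
      using sum_squares_bound[of "\<bar>W \<omega>\<bar>" a] assms(4) by (simp add: field_simps power2_eq_square)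
  qed (use int assms in auto)
  also have "\<dots> = (\<integral>\<omega>. (W \<omega>)\<^sup>2 \<partial>M) / (2 * a) + a / 2"
    using assms by (simp add: prob_space)
  also have "\<dots> \<le> a\<^sup>2 / (2 * a) + a / 2"
    using assms by (intro add_right_mono divide_right_mono) auto
  also have "\<dots> = a" using assms(4) by (simp add: power2_eq_square)
  finally show "(\<integral>\<omega>. \<bar>W \<omega>\<bar> \<partial>M) \<le> a" .
qed

text \<open>Used for all three L2 comparisons: the given variables with polynomials, these with
  approximants, and the Gaussian approximants with their limit.\<close>

lemma expectation_lipschitz_diff:
  fixes \<phi> :: "real \<Rightarrow> real"
  assumes [measurable]: "random_variable borel X" "random_variable borel Y" "\<phi> \<in> borel_measurable borel"
    and \<phi>: "\<And>x. \<bar>\<phi> x\<bar> \<le> 1" "\<And>x y. \<bar>\<phi> x - \<phi> y\<bar> \<le> c * \<bar>x - y\<bar>" "0 \<le> c"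
    and XY: "integrable M (\<lambda>\<omega>. (X \<omega> - Y \<omega>)\<^sup>2)" "(\<integral>\<omega>. (X \<omega> - Y \<omega>)\<^sup>2 \<partial>M) \<le> a\<^sup>2" "0 < a"
  shows "\<bar>(\<integral>\<omega>. \<phi> (X \<omega>) \<partial>M) - (\<integral>\<omega>. \<phi> (Y \<omega>) \<partial>M)\<bar> \<le> c * a"
proof -
  note W = expectation_abs_le[OF _ XY, simplified]
  have i: "integrable M (\<lambda>\<omega>. \<phi> (X \<omega>))" "integrable M (\<lambda>\<omega>. \<phi> (Y \<omega>))"
    using \<phi>(1) by (auto intro!: integrable_const_bound[where B = 1])
  have "\<bar>(\<integral>\<omega>. \<phi> (X \<omega>) \<partial>M) - (\<integral>\<omega>. \<phi> (Y \<omega>) \<partial>M)\<bar> = \<bar>\<integral>\<omega>. \<phi> (X \<omega>) - \<phi> (Y \<omega>) \<partial>M\<bar>" using i by simp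
  also have "\<dots> \<le> (\<integral>\<omega>. \<bar>\<phi> (X \<omega>) - \<phi> (Y \<omega>)\<bar> \<partial>M)" by (rule integral_abs_bound)
  also have "\<dots> \<le> (\<integral>\<omega>. c * \<bar>X \<omega> - Y \<omega>\<bar> \<partial>M)"
    using i W(1) \<phi>(2) by (intro integral_mono) auto
  also have "\<dots> = c * (\<integral>\<omega>. \<bar>X \<omega> - Y \<omega>\<bar> \<partial>M)" by simp
  also have "\<dots> \<le> c * a" using W(2) \<phi>(3) by (intro mult_left_mono) auto
  finally show ?thesis .
qed

text \<open>Riesz--Fischer for a geometric rate: the increments are summable in L1, so the sequence
  converges almost surely, and Fatou carries the rate to the limit.\<close>

lemma L2_complete:
  fixes g :: "nat \<Rightarrow> 'a \<Rightarrow> real"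
  assumes [measurable]: "\<And>j. random_variable borel (g j)"
    and int: "\<And>j. integrable M (\<lambda>\<omega>. (g j \<omega>)\<^sup>2)"
    and intd: "\<And>i j. integrable M (\<lambda>\<omega>. (g i \<omega> - g j \<omega>)\<^sup>2)"
    and cauchy: "\<And>i j. i \<le> j \<Longrightarrow> (\<integral>\<omega>. (g i \<omega> - g j \<omega>)\<^sup>2 \<partial>M) \<le> (2 * (1/2) ^ i)\<^sup>2"
  obtains H where "random_variable borel H" "integrable M (\<lambda>\<omega>. (H \<omega>)\<^sup>2)"
    "\<forall>j. integrable M (\<lambda>\<omega>. (H \<omega> - g j \<omega>)\<^sup>2)" "\<forall>j. (\<integral>\<omega>. (H \<omega> - g j \<omega>)\<^sup>2 \<partial>M) \<le> (2 * (1/2) ^ j)\<^sup>2"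
proof -
  define D where "D j \<omega> = \<bar>g j \<omega> - g (Suc j) \<omega>\<bar>" for j \<omega>
  have [measurable]: "random_variable borel (D j)" for j unfolding D_def by measurable
  have D: "integrable M (D j)" "(\<integral>\<omega>. D j \<omega> \<partial>M) \<le> 2 * (1/2) ^ j" for j
    unfolding D_def using expectation_abs_le[OF _ intd cauchy[of j "Suc j"]] by auto
  have sm: "summable (\<lambda>j. 2 * (1/2::real) ^ j)" by (intro summable_mult summable_geometric) auto
  have "(\<integral>\<^sup>+\<omega>. suminf (\<lambda>j. ennreal (D j \<omega>)) \<partial>M) = suminf (\<lambda>j. \<integral>\<^sup>+\<omega>. ennreal (D j \<omega>) \<partial>M)"
    by (rule nn_integral_suminf) simp
  also have "\<dots> \<le> suminf (\<lambda>j. ennreal (2 * (1/2) ^ j))"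
  proof (intro suminf_le summableI)
    fix j
    have "(\<integral>\<^sup>+\<omega>. ennreal (D j \<omega>) \<partial>M) = ennreal (\<integral>\<omega>. D j \<omega> \<partial>M)"
      by (rule nn_integral_eq_integral[OF D(1)]) (simp add: D_def)
    then show "(\<integral>\<^sup>+\<omega>. ennreal (D j \<omega>) \<partial>M) \<le> ennreal (2 * (1/2) ^ j)" using D(2)[of j] by (simp add: ennreal_leI)
  qed
  also have "\<dots> = ennreal (suminf (\<lambda>j. 2 * (1/2) ^ j))" by (rule suminf_ennreal2[OF _ sm]) simp
  finally have "(\<integral>\<^sup>+\<omega>. suminf (\<lambda>j. ennreal (D j \<omega>)) \<partial>M) \<noteq> \<infinity>"
    unfolding infinity_ennreal_def by (rule neq_top_trans[OF ennreal_neq_top])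
  then have "AE \<omega> in M. suminf (\<lambda>j. ennreal (D j \<omega>)) \<noteq> \<infinity>" by (intro nn_integral_PInf_AE) simp_all
  then have conv: "AE \<omega> in M. convergent (\<lambda>j. g j \<omega>)"
  proof eventually_elim
    case (elim \<omega>)
    then have "summable (\<lambda>j. D j \<omega>)" by (intro summable_suminf_not_top) (auto simp: D_def)
    then have "summable (\<lambda>j. g j \<omega> - g (Suc j) \<omega>)" unfolding D_def by (rule summable_rabs_cancel)
    then have "convergent (\<lambda>n. \<Sum>j<n. g j \<omega> - g (Suc j) \<omega>)" by (simp add: summable_iff_convergent)
    moreover have "(\<Sum>j<n. g j \<omega> - g (Suc j) \<omega>) = g 0 \<omega> - g n \<omega>" for n by (induction n) auto
    ultimately have "convergent (\<lambda>n. g 0 \<omega> - g n \<omega>)" by simp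
    from convergent_diff[OF convergent_const[of "g 0 \<omega>"] this] show ?case by simp
  qed
  define H where "H \<omega> = lim (\<lambda>j. g j \<omega>)" for \<omega>
  have [measurable]: "random_variable borel H" unfolding H_def by (rule borel_measurable_lim_metric) simp
  have lim: "AE \<omega> in M. (\<lambda>j. g j \<omega>) \<longlonglongrightarrow> H \<omega>"
    using conv by eventually_elim (simp add: H_def convergent_LIMSEQ_iff)
  have nn: "(\<integral>\<^sup>+\<omega>. ennreal ((H \<omega> - g j \<omega>)\<^sup>2) \<partial>M) \<le> ennreal ((2 * (1/2) ^ j)\<^sup>2)" for j
  proof -
    have "(\<integral>\<^sup>+\<omega>. ennreal ((H \<omega> - g j \<omega>)\<^sup>2) \<partial>M) = (\<integral>\<^sup>+\<omega>. liminf (\<lambda>k. ennreal ((g k \<omega> - g j \<omega>)\<^sup>2)) \<partial>M)"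
    proof (rule nn_integral_cong_AE)
      show "AE \<omega> in M. ennreal ((H \<omega> - g j \<omega>)\<^sup>2) = liminf (\<lambda>k. ennreal ((g k \<omega> - g j \<omega>)\<^sup>2))"
        using lim
      proof eventually_elim
        case (elim \<omega>)
        then have "(\<lambda>k. ennreal ((g k \<omega> - g j \<omega>)\<^sup>2)) \<longlonglongrightarrow> ennreal ((H \<omega> - g j \<omega>)\<^sup>2)"
          by (intro tendsto_ennrealI tendsto_intros)
        then show ?case by (intro lim_imp_Liminf[symmetric] sequentially_bot)
      qed
    qed
    also have "\<dots> \<le> liminf (\<lambda>k. \<integral>\<^sup>+\<omega>. ennreal ((g k \<omega> - g j \<omega>)\<^sup>2) \<partial>M)"
      by (rule nn_integral_liminf) simp
    also have "\<dots> \<le> ennreal ((2 * (1/2) ^ j)\<^sup>2)"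
    proof -
      have "\<forall>\<^sub>F k in sequentially. (\<integral>\<^sup>+\<omega>. ennreal ((g k \<omega> - g j \<omega>)\<^sup>2) \<partial>M) \<le> ennreal ((2 * (1/2) ^ j)\<^sup>2)"
        using eventually_ge_at_top[of j]
      proof eventually_elim
        case (elim k)
        have "(\<integral>\<^sup>+\<omega>. ennreal ((g k \<omega> - g j \<omega>)\<^sup>2) \<partial>M) = ennreal (\<integral>\<omega>. (g k \<omega> - g j \<omega>)\<^sup>2 \<partial>M)"
          by (rule nn_integral_eq_integral[OF intd]) simp
        also have "\<dots> \<le> ennreal ((2 * (1/2) ^ j)\<^sup>2)"
          using cauchy[OF elim] by (intro ennreal_leI) (simp add: power2_commute)
        finally show ?case .
      qed
      then have "liminf (\<lambda>k. \<integral>\<^sup>+\<omega>. ennreal ((g k \<omega> - g j \<omega>)\<^sup>2) \<partial>M) \<le> liminf (\<lambda>k. ennreal ((2 * (1/2) ^ j)\<^sup>2))"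
        by (rule Liminf_mono)
      then show ?thesis by (simp add: Liminf_const)
    qed
    finally show ?thesis .
  qed
  have i: "integrable M (\<lambda>\<omega>. (H \<omega> - g j \<omega>)\<^sup>2)" for j
    using nn[of j] by (intro integrableI_nonneg) (auto intro: le_less_trans)
  have b: "(\<integral>\<omega>. (H \<omega> - g j \<omega>)\<^sup>2 \<partial>M) \<le> (2 * (1/2) ^ j)\<^sup>2" for j
    by (rule integral_real_bounded[OF _ nn]) simp
  have "integrable M (\<lambda>\<omega>. (H \<omega>)\<^sup>2)"
  proof (rule Bochner_Integration.integrable_bound)
    show "integrable M (\<lambda>\<omega>. 2 * (H \<omega> - g 0 \<omega>)\<^sup>2 + 2 * (g 0 \<omega>)\<^sup>2)" using i[of 0] int[of 0] by simp
    have sq: "(x + y)\<^sup>2 \<le> 2 * x\<^sup>2 + 2 * y\<^sup>2" for x y :: real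
      using sum_squares_bound[of x y] by (simp add: power2_sum)
    show "AE \<omega> in M. norm ((H \<omega>)\<^sup>2) \<le> norm (2 * (H \<omega> - g 0 \<omega>)\<^sup>2 + 2 * (g 0 \<omega>)\<^sup>2)"
    proof (rule AE_I2)
      show "norm ((H \<omega>)\<^sup>2) \<le> norm (2 * (H \<omega> - g 0 \<omega>)\<^sup>2 + 2 * (g 0 \<omega>)\<^sup>2)" for \<omega>
        using sq[of "H \<omega> - g 0 \<omega>" "g 0 \<omega>"] by simp
    qed
  qed simp
  then show ?thesis using i b by (intro that[of H]) auto
qed

end

text \<open>Tightness of one law, stated through bounded Lipschitz functions so that weak
  convergence passes it on to the sequence.\<close>

lemma integral_clamp_tendsto_0:
  assumes "real_distribution \<mu>"
  shows "(\<lambda>k. \<integral>x. min 1 (\<bar>x\<bar> / real (Suc k)) \<partial>\<mu>) \<longlonglongrightarrow> 0"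
proof -
  interpret real_distribution \<mu> by fact
  have "(\<lambda>k. \<integral>x. min 1 (\<bar>x\<bar> / real (Suc k)) \<partial>\<mu>) \<longlonglongrightarrow> (\<integral>x. 0 \<partial>\<mu>)"
  proof (rule integral_dominated_convergence[where w = "\<lambda>_. 1"])
    have "(\<lambda>k. \<bar>x\<bar> / real (Suc k)) \<longlonglongrightarrow> 0" for x :: real
      by (rule LIMSEQ_Suc[of "\<lambda>k. \<bar>x\<bar> / real k"]) (rule lim_const_over_n)
    then have "(\<lambda>k. min 1 (\<bar>x\<bar> / real (Suc k))) \<longlonglongrightarrow> min 1 0" for x :: real
      by (intro tendsto_min tendsto_const)
    then show "AE x in \<mu>. (\<lambda>k. min 1 (\<bar>x\<bar> / real (Suc k))) \<longlonglongrightarrow> 0" by simp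
  qed auto
  then show ?thesis by simp
qed

context gaussian_seq
begin

text \<open>A Paley--Zygmund argument: by hypercontractivity a large second moment cannot be carried
  by an event of small probability.\<close>

lemma second_moment_le_of_clamp:
  assumes f: "polyfun N d f" and k: "0 < k"
    and small: "72 ^ d * Ex (\<lambda>x. min 1 (\<bar>f x\<bar> / k)) \<le> 1 / 4"
  shows "Ex (\<lambda>x. (f x)\<^sup>2) \<le> 2 * k\<^sup>2"
proof (cases "Ex (\<lambda>x. (f x)\<^sup>2) = 0")
  case True
  then show ?thesis by simp
next
  case False
  note fp = polyfun_imp_pfun[OF f]
  define s where "s = Ex (\<lambda>x. (f x)\<^sup>2)"
  have s: "s > 0" using False Ex_square_nonneg[of f] unfolding s_def by linarith
  define \<psi> where "\<psi> x = min 1 (\<bar>f x\<bar> / k)" for x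
  have \<psi>: "0 \<le> \<psi> x" "\<psi> x \<le> 1" for x using k by (auto simp: \<psi>_def)
  have [measurable]: "(\<lambda>\<omega>. f (\<lambda>i. G i \<omega>)) \<in> borel_measurable M" using f by (rule polyfun_G_measurable)
  have \<psi>i: "integrable M (\<lambda>\<omega>. \<psi> (\<lambda>i. G i \<omega>))"
  proof (rule integrable_const_bound[where B = 1])
    show "(\<lambda>\<omega>. \<psi> (\<lambda>i. G i \<omega>)) \<in> borel_measurable M" unfolding \<psi>_def by measurable
  qed (use \<psi> in auto)
  \<comment> \<open>Hypercontractivity then bounds the fourth moment term by \<open>s / 4\<close>,
    and the smallness assumption the clamp term by another \<open>s / 4\<close>.\<close>
  define a where "a = 1 / (2 * 72 ^ d * s)"
  have a: "a > 0" using s by (simp add: a_def)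
  have fi: "integrable M (\<lambda>\<omega>. f (\<lambda>i. G i \<omega>) ^ 4)" "integrable M (\<lambda>\<omega>. (f (\<lambda>i. G i \<omega>))\<^sup>2)"
    using pfun_Gint[OF pfun_power[OF fp]] unfolding Gint_def by auto
  have pt: "(f x)\<^sup>2 \<le> k\<^sup>2 + (a / 2 * f x ^ 4 + 1 / (2 * a) * \<psi> x)" for x
  proof (cases "\<bar>f x\<bar> \<le> k")
    case True
    then have "(f x)\<^sup>2 \<le> k\<^sup>2" using k abs_le_square_iff[of "f x" k] by simp
    moreover have "0 \<le> a / 2 * f x ^ 4 + 1 / (2 * a) * \<psi> x" using a \<psi> by (intro add_nonneg_nonneg mult_nonneg_nonneg) auto
    ultimately show ?thesis by linarith
  next
    case False
    then have "\<psi> x = 1" using k by (simp add: \<psi>_def)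
    have "0 \<le> (a * (f x)\<^sup>2 - 1)\<^sup>2" by simp
    also have "\<dots> = a\<^sup>2 * f x ^ 4 - 2 * a * (f x)\<^sup>2 + 1"
      by (simp add: power2_diff power_mult_distrib power_mult[symmetric])
    finally have "2 * a * (f x)\<^sup>2 \<le> a\<^sup>2 * f x ^ 4 + 1" by simp
    then have "(f x)\<^sup>2 \<le> a / 2 * f x ^ 4 + 1 / (2 * a)"
      using a by (simp add: field_simps power2_eq_square)
    then show ?thesis using \<open>\<psi> x = 1\<close> by (simp add: add_increasing)
  qed
  have "s \<le> (\<integral>\<omega>. k\<^sup>2 + (a / 2 * f (\<lambda>i. G i \<omega>) ^ 4 + 1 / (2 * a) * \<psi> (\<lambda>i. G i \<omega>)) \<partial>M)"
    unfolding s_def Ex_def by (rule integral_mono[OF fi(2) _ pt]) (use fi \<psi>i in auto)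
  also have "\<dots> = k\<^sup>2 + (a / 2 * Ex (\<lambda>x. f x ^ 4) + 1 / (2 * a) * Ex \<psi>)"
    unfolding Ex_def using fi \<psi>i by (simp add: prob_space)
  also have "\<dots> \<le> k\<^sup>2 + (a / 2 * (72 ^ d * s\<^sup>2) + 1 / (2 * a) * Ex \<psi>)"
    using hypercontractivity[OF f] a by (intro add_left_mono add_right_mono mult_left_mono) (auto simp: s_def)
  also have "a / 2 * (72 ^ d * s\<^sup>2) = s / 4" using s by (simp add: a_def field_simps power2_eq_square)
  also have "1 / (2 * a) * Ex \<psi> = s * (72 ^ d * Ex \<psi>)" using s by (simp add: a_def)
  also have "\<dots> \<le> s * (1 / 4)" using small s unfolding \<psi>_def[abs_def] by (intro mult_left_mono) auto
  finally show ?thesis unfolding s_def[symmetric] by simp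
qed

theorem polynomials_in_closed:
  assumes F: "\<And>n. F n \<in> polynomials_in M G d" and \<mu>: "real_distribution \<mu>"
    and conv: "weak_conv_m (\<lambda>n. distr M borel (F n)) \<mu>"
  shows "\<exists>H \<in> polynomials_in M G d. distr M borel H = \<mu>"
proof -
  have F_sq: "square_integrable M (F n)" for n using F[of n] by (simp add: polynomials_in_def L2_closure_def)
  have Fm [measurable]: "F n \<in> borel_measurable M" for n using F_sq[of n] by (simp add: square_integrable_def)
  \<comment> \<open>Members of the closure are replaced by genuine polynomials at vanishing L2
    distance, which does not change the limit law.\<close>
  have "\<exists>f N. polyfun N d f \<and> sqrt (\<integral>\<omega>. (F n \<omega> - f (\<lambda>i. G i \<omega>))\<^sup>2 \<partial>M) < 1 / real (Suc n)" for n
  proof -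
    obtain p where p: "total_degree p \<le> d" "sqrt (\<integral>\<omega>. (F n \<omega> - eval_mpoly p (\<lambda>i. G i \<omega>))\<^sup>2 \<partial>M) < 1 / real (Suc n)"
      using F[of n] unfolding polynomials_in_def L2_closure_def
      by (auto dest!: spec[of _ "1 / real (Suc n)"] simp del: of_nat_Suc)
    then show ?thesis using ex_polyfun_eval_mpoly[OF p(1)] by blast
  qed
  then obtain f Nv where f: "\<And>n. polyfun (Nv n) d (f n)"
    and Ff: "\<And>n. sqrt (\<integral>\<omega>. (F n \<omega> - f n (\<lambda>i. G i \<omega>))\<^sup>2 \<partial>M) < 1 / real (Suc n)" by metis
  have fm [measurable]: "(\<lambda>\<omega>. f n (\<lambda>i. G i \<omega>)) \<in> borel_measurable M" for n by (rule polyfun_G_measurable[OF f])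
  have Ffi: "integrable M (\<lambda>\<omega>. (F n \<omega> - f n (\<lambda>i. G i \<omega>))\<^sup>2)" for n
  proof (rule Bochner_Integration.integrable_bound)
    show "integrable M (\<lambda>\<omega>. 2 * (F n \<omega>)\<^sup>2 + 2 * (f n (\<lambda>i. G i \<omega>))\<^sup>2)"
      using F_sq[of n] pfun_Gint[OF pfun_power[OF polyfun_imp_pfun[OF f]], of n 2]
      by (auto simp: square_integrable_def Gint_def)
    have "(x - y)\<^sup>2 \<le> 2 * x\<^sup>2 + 2 * y\<^sup>2" for x y :: real
      using sum_squares_bound[of x "- y"] by (simp add: power2_diff)
    from this[of "F n _" "f n (\<lambda>i. G i _)"]
    show "AE \<omega> in M. norm ((F n \<omega> - f n (\<lambda>i. G i \<omega>))\<^sup>2) \<le> norm (2 * (F n \<omega>)\<^sup>2 + 2 * (f n (\<lambda>i. G i \<omega>))\<^sup>2)" by simp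
  qed simp
  have Ff2: "(\<integral>\<omega>. (F n \<omega> - f n (\<lambda>i. G i \<omega>))\<^sup>2 \<partial>M) \<le> (1 / real (Suc n))\<^sup>2" for n
    using Ff[of n] by (intro sqrt_le_D) simp
  \<comment> \<open>Bounded Lipschitz functions tolerate L2 errors and include the clamp, the
    cosines and the sines tested below.\<close>
  have test: "(\<lambda>n. Ex (\<lambda>x. \<phi> (f n x))) \<longlonglongrightarrow> (\<integral>x. \<phi> x \<partial>\<mu>)"
    if \<phi>: "continuous_on UNIV \<phi>" "\<And>x. \<bar>\<phi> x\<bar> \<le> 1" "\<And>x y. \<bar>\<phi> x - \<phi> y\<bar> \<le> c * \<bar>x - y\<bar>" "0 \<le> c" for \<phi> :: "real \<Rightarrow> real" and c
  proof -
    have [measurable]: "\<phi> \<in> borel_measurable borel" using \<phi>(1) by (rule borel_measurable_continuous_onI)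
    have "(\<lambda>n. \<integral>x. \<phi> x \<partial>(distr M borel (F n))) \<longlonglongrightarrow> (\<integral>x. \<phi> x \<partial>\<mu>)"
      using \<phi>(1,2) by (intro weak_conv_imp_integral_bdd_continuous_conv[OF _ \<mu> conv])
        (auto simp: continuous_on_eq_continuous_at)
    then have lim1: "(\<lambda>n. \<integral>\<omega>. \<phi> (F n \<omega>) \<partial>M) \<longlonglongrightarrow> (\<integral>x. \<phi> x \<partial>\<mu>)" by (simp add: integral_distr)
    have "(\<lambda>n. Ex (\<lambda>x. \<phi> (f n x)) - (\<integral>\<omega>. \<phi> (F n \<omega>) \<partial>M)) \<longlonglongrightarrow> 0"
    proof (rule Lim_null_comparison[where g = "\<lambda>n. c * (1 / real (Suc n))"])
      show "\<forall>\<^sub>F n in sequentially. norm (Ex (\<lambda>x. \<phi> (f n x)) - (\<integral>\<omega>. \<phi> (F n \<omega>) \<partial>M)) \<le> c * (1 / real (Suc n))"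
      proof (intro always_eventually allI)
        fix n
        have "\<bar>(\<integral>\<omega>. \<phi> (F n \<omega>) \<partial>M) - (\<integral>\<omega>. \<phi> (f n (\<lambda>i. G i \<omega>)) \<partial>M)\<bar> \<le> c * (1 / real (Suc n))"
          by (rule expectation_lipschitz_diff[OF _ _ _ \<phi>(2,3,4) Ffi Ff2]) auto
        then show "norm (Ex (\<lambda>x. \<phi> (f n x)) - (\<integral>\<omega>. \<phi> (F n \<omega>) \<partial>M)) \<le> c * (1 / real (Suc n))"
          by (simp add: Ex_def abs_minus_commute)
      qed
      have "(\<lambda>n. c * (1 / real (Suc n))) \<longlonglongrightarrow> c * 0"
        by (intro tendsto_mult tendsto_const LIMSEQ_Suc[OF lim_const_over_n])
      then show "(\<lambda>n. c * (1 / real (Suc n))) \<longlonglongrightarrow> 0" by simp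
    qed
    from tendsto_add[OF this lim1] show ?thesis by simp
  qed
  obtain B where B: "\<And>n. Ex (\<lambda>x. (f n x)\<^sup>2) \<le> B"
  proof -
    have "\<forall>\<^sub>F k in sequentially. (\<integral>x. min 1 (\<bar>x\<bar> / real (Suc k)) \<partial>\<mu>) < 1 / (4 * 72 ^ d)"
      by (rule order_tendstoD(2)[OF integral_clamp_tendsto_0[OF \<mu>]]) simp
    then obtain k' where k': "(\<integral>x. min 1 (\<bar>x\<bar> / real (Suc k')) \<partial>\<mu>) < 1 / (4 * 72 ^ d)"
      by (auto simp: eventually_sequentially)
    define k where "k = real (Suc k')"
    have k: "1 \<le> k" by (simp add: k_def)
    have "(\<lambda>n. Ex (\<lambda>x. min 1 (\<bar>f n x\<bar> / k))) \<longlonglongrightarrow> (\<integral>x. min 1 (\<bar>x\<bar> / k) \<partial>\<mu>)"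
    proof (rule test[of "\<lambda>y. min 1 (\<bar>y\<bar> / k)" 1])
      show "continuous_on UNIV (\<lambda>y. min 1 (\<bar>y\<bar> / k))" using k by (intro continuous_intros) auto
      show "\<bar>min 1 (\<bar>x\<bar> / k) - min 1 (\<bar>y\<bar> / k)\<bar> \<le> 1 * \<bar>x - y\<bar>" for x y
      proof -
        have "\<bar>\<bar>x\<bar> / k - \<bar>y\<bar> / k\<bar> = \<bar>\<bar>x\<bar> - \<bar>y\<bar>\<bar> / k" using k by (simp add: diff_divide_distrib[symmetric] abs_divide)
        also have "\<dots> \<le> \<bar>x - y\<bar> / 1" using k by (intro frac_le) auto
        finally show ?thesis by (simp add: min_def) linarith
      qed
    qed (use k in auto)
    from order_tendstoD(2)[OF this, of "1 / (4 * 72 ^ d)"] k'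
    have "\<forall>\<^sub>F n in sequentially. Ex (\<lambda>x. min 1 (\<bar>f n x\<bar> / k)) < 1 / (4 * 72 ^ d)" by (simp add: k_def)
    then obtain n0 where n0: "\<And>n. n \<ge> n0 \<Longrightarrow> Ex (\<lambda>x. min 1 (\<bar>f n x\<bar> / k)) < 1 / (4 * 72 ^ d)"
      by (auto simp: eventually_sequentially)
    have big: "Ex (\<lambda>x. (f n x)\<^sup>2) \<le> 2 * k\<^sup>2" if "n \<ge> n0" for n
    proof (rule second_moment_le_of_clamp[OF f])
      show "72 ^ d * Ex (\<lambda>x. min 1 (\<bar>f n x\<bar> / k)) \<le> 1 / 4"
        using n0[OF that] by (simp add: field_simps)
    qed (use k in auto)
    \<comment> \<open>The clamp bound holds from \<open>n0\<close> on; the finitely many earlier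
      second moments are added.\<close>
    define B where "B = 2 * k\<^sup>2 + (\<Sum>n<n0. Ex (\<lambda>x. (f n x)\<^sup>2))"
    have "Ex (\<lambda>x. (f n x)\<^sup>2) \<le> B" for n
    proof (cases "n < n0")
      case True
      then have "Ex (\<lambda>x. (f n x)\<^sup>2) \<le> (\<Sum>n<n0. Ex (\<lambda>x. (f n x)\<^sup>2))"
        by (intro member_le_sum) auto
      then show ?thesis unfolding B_def by (smt (verit) zero_le_power2)
    next
      case False
      moreover have "0 \<le> (\<Sum>n<n0. Ex (\<lambda>x. (f n x)\<^sup>2))" by (intro sum_nonneg) auto
      ultimately show ?thesis using big[of n] unfolding B_def by linarith
    qed
    then show thesis by (rule that)
  qed
  obtain U :: "nat filter" where U: "ultrafilter U" "U \<le> sequentially"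
    using ex_ultrafilter[of "sequentially :: nat filter"] by auto
  interpret gaussian_ultra M G U Nv by unfold_locales (rule U)+
  have "bseq d f" using f B by (rule bseqI)
  then have ap: "appr d f" by (rule bseq_appr)
  define good where "good j = (\<lambda>(K, p, Zj, qj). polyfun K d p \<and> (\<forall>i<K. irr_seq (qj i) (Zj i)) \<and>
      (\<forall>\<^sub>F n in U. Ex (\<lambda>x. (f n x - p (\<lambda>i. Zj i n x))\<^sup>2) < (1/4) ^ j))" for j :: nat
  have ex_good: "\<exists>T. good j T" for j
  proof -
    obtain S where S: "gen d S" "\<forall>\<^sub>F n in U. Ex (\<lambda>x. (f n x - S n x)\<^sup>2) < (1/4) ^ j"
      using apprD[OF ap, of "(1/4) ^ j"] by auto
    obtain K p Zj qj where "polyfun K d p" "\<forall>i<K. irr_seq (qj i) (Zj i)" "S = (\<lambda>n x. p (\<lambda>i. Zj i n x))"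
      using gen_extract[OF S(1)] by (elim exE conjE)
    then show ?thesis using S(2) by (intro exI[of _ "(K, p, Zj, qj)"]) (simp add: good_def)
  qed
  define T where "T j = (SOME T. good j T)" for j
  have T: "good j (T j)" for j unfolding T_def by (rule someI_ex[OF ex_good])
  define K where "K j = fst (T j)" for j
  define p where "p j = fst (snd (T j))" for j
  define Zj where "Zj j = fst (snd (snd (T j)))" for j
  define qj where "qj j = snd (snd (snd (T j)))" for j
  have p: "polyfun (K j) d (p j)" and irr: "i < K j \<Longrightarrow> irr_seq (qj j i) (Zj j i)"
    and ev: "\<forall>\<^sub>F n in U. Ex (\<lambda>x. (f n x - p j (\<lambda>i. Zj j i n x))\<^sup>2) < (1/4) ^ j" for i j
    using T[of j] by (auto simp: good_def K_def p_def Zj_def qj_def case_prod_beta)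
  \<comment> \<open>The finite families of all levels \<open>j\<close> are merged by pairing
    indices, so one Gaussian family serves every level. Free slots hold the zero sequence, of order
    1.\<close>
  define Z where "Z m = (case prod_decode m of (j, i) \<Rightarrow> if i < K j then Zj j i else (\<lambda>n x. 0))" for m
  define q where "q m = (case prod_decode m of (j, i) \<Rightarrow> if i < K j then qj j i else 1)" for m
  interpret irreducible_family M G U Nv Z q
  proof
    show "irr_seq (q m) (Z m)" for m
      using irr irr_seq_zero by (auto simp: Z_def q_def split: prod.split)
  qed
  define P where "P j y = p j (\<lambda>i. y (prod_encode (j, i)))" for j and y :: "nat \<Rightarrow> real"
  define N where "N j = Suc (\<Sum>i<K j. prod_encode (j, i))" for j
  have P: "polyfun (N j) d (P j)" for j
  proof -
    have "polyfun (N j) (d * 1) (P j)"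
      unfolding P_def
    proof (rule polyfun_comp[OF p])
      fix i assume "i < K j"
      then have "prod_encode (j, i) \<le> (\<Sum>i<K j. prod_encode (j, i))" by (intro member_le_sum) auto
      then show "polyfun (N j) 1 (\<lambda>y. y (prod_encode (j, i)))" by (intro polyfun_var) (simp add: N_def)
    qed
    then show ?thesis by simp
  qed
  have PZ: "P j (\<lambda>m. Z m n x) = p j (\<lambda>i. Zj j i n x)" for j n x
    unfolding P_def by (rule polyfun_cong[OF p]) (simp add: Z_def)
  have evP: "\<forall>\<^sub>F n in U. Ex (\<lambda>x. (f n x - P j (\<lambda>m. Z m n x))\<^sup>2) < ((1/2) ^ j)\<^sup>2" for j
  proof -
    have "((1/2::real) ^ j)\<^sup>2 = (1/4) ^ j" by (simp add: power2_eq_square power_mult_distrib[symmetric])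
    then show ?thesis using ev[of j] by (simp add: PZ)
  qed
  define h where "h j x = P j (\<lambda>m. lgauss m x)" for j x
  have h: "polyfun (N j) d (h j)" for j
  proof -
    have "polyfun (N j) (d * 1) (h j)" unfolding h_def by (rule polyfun_comp[OF P polyfun_lgauss'])
    then show ?thesis by simp
  qed
  have hm [measurable]: "(\<lambda>\<omega>. h j (\<lambda>i. G i \<omega>)) \<in> borel_measurable M" for j by (rule polyfun_G_measurable[OF h])
  have hp: "pfun (N i + N j) (h i)" "pfun (N i + N j) (h j)" for i j
    using polyfun_imp_pfun[OF polyfun_mono_vars[OF h]] by auto
  \<comment> \<open>The squared difference of two approximants is a polynomial in the merged family,
    so its Gaussian expectation is the limit of that on the \<open>Z\<close> side, where both
    approximants are close to \<open>f n\<close>.\<close>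
  have cauchy: "Ex (\<lambda>x. (h i x - h j x)\<^sup>2) \<le> (2 * (1/2) ^ i)\<^sup>2" if "i \<le> j" for i j
  proof -
    have "polyfun (N i + N j) (d + d) (\<lambda>y. (P i y - P j y)\<^sup>2)"
      by (intro polyfun_power2 polyfun_diff polyfun_mono_vars[OF P]) auto
    from polyfun_Z_tendsto[OF this]
    have lim: "((\<lambda>n. Ex (\<lambda>x. (P i (\<lambda>m. Z m n x) - P j (\<lambda>m. Z m n x))\<^sup>2)) \<longlongrightarrow> Ex (\<lambda>x. (h i x - h j x)\<^sup>2)) U"
      by (simp add: h_def)
    have "\<forall>\<^sub>F n in U. Ex (\<lambda>x. (P i (\<lambda>m. Z m n x) - P j (\<lambda>m. Z m n x))\<^sup>2) \<le> (2 * (1/2) ^ i)\<^sup>2"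
      using evP[of i] evP[of j]
    proof eventually_elim
      case (elim n)
      have pf: "pfun (Nv n) (\<lambda>x. P l (\<lambda>m. Z m n x))" for l
      proof -
        obtain D where "bseq D (\<lambda>n x. P l (\<lambda>m. Z m n x))" using bseq_polyfun_Z[OF P[of l]] by (elim exE)
        then show ?thesis by (rule bseq_pfun)
      qed
      have "Ex (\<lambda>x. (P i (\<lambda>m. Z m n x) - P j (\<lambda>m. Z m n x))\<^sup>2) =
          Ex (\<lambda>x. ((P i (\<lambda>m. Z m n x) - f n x) + (f n x - P j (\<lambda>m. Z m n x)))\<^sup>2)" by simp
      also have "\<dots> \<le> 2 * Ex (\<lambda>x. (P i (\<lambda>m. Z m n x) - f n x)\<^sup>2) + 2 * Ex (\<lambda>x. (f n x - P j (\<lambda>m. Z m n x))\<^sup>2)"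
        by (intro Ex_square_add_le[of "Nv n"] pfun_diff pf polyfun_imp_pfun[OF f])
      also have "\<dots> \<le> 2 * ((1/2) ^ i)\<^sup>2 + 2 * ((1/2) ^ j)\<^sup>2" using elim by (simp add: power2_commute)
      also have "((1/2::real) ^ j)\<^sup>2 \<le> ((1/2) ^ i)\<^sup>2" using that by (intro power_mono power_decreasing) auto
      finally show ?case by (simp add: power_mult_distrib)
    qed
    then show ?thesis by (rule tendsto_upperbound[OF lim _ U_not_bot])
  qed
  define g where "g j \<omega> = h j (\<lambda>i. G i \<omega>)" for j \<omega>
  have gm [measurable]: "g j \<in> borel_measurable M" for j unfolding g_def by (rule hm)
  have gi: "integrable M (\<lambda>\<omega>. (g j \<omega>)\<^sup>2)" for j
    using pfun_Gint[OF pfun_power[OF polyfun_imp_pfun[OF h]], of j 2] by (simp add: Gint_def g_def)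
  have gd: "integrable M (\<lambda>\<omega>. (g i \<omega> - g j \<omega>)\<^sup>2)" for i j
    using pfun_Gint[OF pfun_power[OF pfun_diff[OF hp]], of i j 2] by (simp add: Gint_def g_def)
  have gc: "(\<integral>\<omega>. (g i \<omega> - g j \<omega>)\<^sup>2 \<partial>M) \<le> (2 * (1/2) ^ i)\<^sup>2" if "i \<le> j" for i j
    using cauchy[OF that] by (simp add: Ex_def g_def)
  obtain H where Hm [measurable]: "H \<in> borel_measurable M" and H: "integrable M (\<lambda>\<omega>. (H \<omega>)\<^sup>2)"
    and Hi: "\<forall>j. integrable M (\<lambda>\<omega>. (H \<omega> - g j \<omega>)\<^sup>2)" and Hc: "\<forall>j. (\<integral>\<omega>. (H \<omega> - g j \<omega>)\<^sup>2 \<partial>M) \<le> (2 * (1/2) ^ j)\<^sup>2"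
    using L2_complete[OF gm gi gd gc] .
  have half: "(\<lambda>j. c * (1/2::real) ^ j) \<longlonglongrightarrow> 0" for c
  proof -
    have "(\<lambda>j. c * (1/2::real) ^ j) \<longlonglongrightarrow> c * 0" by (intro tendsto_mult tendsto_const LIMSEQ_realpow_zero) auto
    then show ?thesis by simp
  qed
  have "H \<in> polynomials_in M G d"
    unfolding polynomials_in_def L2_closure_def mem_Collect_eq
  proof (intro conjI allI impI)
    show "square_integrable M H" using H by (simp add: square_integrable_def)
    fix \<epsilon> :: real assume "0 < \<epsilon>"
    then obtain j where j: "2 * (1/2) ^ j < \<epsilon>"
      using order_tendstoD(2)[OF half[of 2]] by (auto simp: eventually_sequentially)
    obtain r where r: "total_degree r \<le> d" "eval_mpoly r = h j" using polyfun_ex_mpoly[OF h] by blast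
    have "sqrt (\<integral>\<omega>. (H \<omega> - g j \<omega>)\<^sup>2 \<partial>M) \<le> 2 * (1/2) ^ j" using Hc by (intro real_le_lsqrt) auto
    moreover have "g j \<in> {\<lambda>\<omega>. eval_mpoly p (\<lambda>i. G i \<omega>) |p. total_degree p \<le> d}"
      using r by (auto simp: g_def[abs_def] intro!: exI[of _ r])
    ultimately show "\<exists>Ha\<in>{\<lambda>\<omega>. eval_mpoly p (\<lambda>i. G i \<omega>) |p. total_degree p \<le> d}.
        square_integrable M Ha \<and> sqrt (\<integral>\<omega>. (H \<omega> - Ha \<omega>)\<^sup>2 \<partial>M) < \<epsilon>"
      using j gi[of j] by (intro bexI[of _ "g j"]) (auto simp: square_integrable_def)
  qed
  moreover have "distr M borel H = \<mu>"
  proof -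
    \<comment> \<open>Three comparisons at level \<open>j\<close>: \<open>H\<close> with
      \<open>g j\<close>, then \<open>g j\<close> with the \<open>Z\<close> side in the limit, then
      the \<open>Z\<close> side with \<open>f n\<close>. The errors are
      \<open>2 * c * (1/2) ^ j\<close>, 0 and \<open>c * (1/2) ^ j\<close>.\<close>
    have key: "(\<integral>\<omega>. \<phi> (H \<omega>) \<partial>M) = (\<integral>x. \<phi> x \<partial>\<mu>)"
      if \<phi>: "continuous_on UNIV \<phi>" "\<And>x. \<bar>\<phi> x\<bar> \<le> 1" "\<And>x y. \<bar>\<phi> x - \<phi> y\<bar> \<le> c * \<bar>x - y\<bar>" "0 \<le> c" for \<phi> :: "real \<Rightarrow> real" and c
    proof -
      have \<phi>m [measurable]: "\<phi> \<in> borel_measurable borel" using \<phi>(1) by (rule borel_measurable_continuous_onI)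
      have "\<bar>(\<integral>x. \<phi> x \<partial>\<mu>) - (\<integral>\<omega>. \<phi> (H \<omega>) \<partial>M)\<bar> \<le> (3 * c) * (1/2) ^ j" for j
      proof -
        have 1: "\<bar>(\<integral>\<omega>. \<phi> (H \<omega>) \<partial>M) - (\<integral>\<omega>. \<phi> (g j \<omega>) \<partial>M)\<bar> \<le> c * (2 * (1/2) ^ j)"
          by (rule expectation_lipschitz_diff[OF _ _ _ \<phi>(2,3,4)]) (use Hi Hc in auto)
        have limU: "((\<lambda>n. Ex (\<lambda>x. \<phi> (f n x))) \<longlongrightarrow> (\<integral>x. \<phi> x \<partial>\<mu>)) U"
          by (rule tendsto_mono[OF U_le test[OF \<phi>]])
        have limP: "((\<lambda>n. Ex (\<lambda>x. \<phi> (P j (\<lambda>m. Z m n x)))) \<longlongrightarrow> Ex (\<lambda>x. \<phi> (h j x))) U"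
          unfolding h_def by (rule polyfun_Z_weak_conv[OF P \<phi>(1,2)])
        have "\<forall>\<^sub>F n in U. \<bar>Ex (\<lambda>x. \<phi> (f n x)) - Ex (\<lambda>x. \<phi> (P j (\<lambda>m. Z m n x)))\<bar> \<le> c * (1/2) ^ j"
          using evP[of j]
        proof eventually_elim
          case (elim n)
          obtain D where D: "bseq D (\<lambda>n x. P j (\<lambda>m. Z m n x))" using bseq_polyfun_Z[OF P[of j]] by (elim exE)
          note Pp = bseq_pfun[OF D, of n]
          show ?case
            unfolding Ex_def
          proof (rule expectation_lipschitz_diff[OF _ _ _ \<phi>(2,3,4)])
            show "(\<lambda>\<omega>. P j (\<lambda>m. Z m n (\<lambda>i. G i \<omega>))) \<in> borel_measurable M"
              using pfun_Gmeas[OF Pp] by (simp add: Gmeas_def)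
            show "integrable M (\<lambda>\<omega>. (f n (\<lambda>i. G i \<omega>) - P j (\<lambda>m. Z m n (\<lambda>i. G i \<omega>)))\<^sup>2)"
              using pfun_Gint[OF pfun_power[OF pfun_diff[OF polyfun_imp_pfun[OF f] Pp]], of 2] by (simp add: Gint_def)
            show "(\<integral>\<omega>. (f n (\<lambda>i. G i \<omega>) - P j (\<lambda>m. Z m n (\<lambda>i. G i \<omega>)))\<^sup>2 \<partial>M) \<le> ((1/2) ^ j)\<^sup>2"
              using elim by (simp add: Ex_def)
          qed auto
        qed
        then have 2: "\<bar>(\<integral>x. \<phi> x \<partial>\<mu>) - Ex (\<lambda>x. \<phi> (h j x))\<bar> \<le> c * (1/2) ^ j"
          by (rule tendsto_upperbound[OF tendsto_rabs[OF tendsto_diff[OF limU limP]] _ U_not_bot])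
        have 3: "Ex (\<lambda>x. \<phi> (h j x)) = (\<integral>\<omega>. \<phi> (g j \<omega>) \<partial>M)" by (simp add: Ex_def g_def)
        show ?thesis using 1 2 unfolding 3 by (simp add: algebra_simps)
      qed
      then have "\<bar>(\<integral>x. \<phi> x \<partial>\<mu>) - (\<integral>\<omega>. \<phi> (H \<omega>) \<partial>M)\<bar> \<le> 0"
        by (intro LIMSEQ_le_const[OF half[of "3 * c"]]) auto
      then show ?thesis by simp
    qed
    \<comment> \<open>With the sine below, this determines the characteristic function from bounded
      Lipschitz tests.\<close>
    have cos: "(\<integral>\<omega>. cos (t * H \<omega>) \<partial>M) = (\<integral>x. cos (t * x) \<partial>\<mu>)" for t :: real
    proof (rule key[of "\<lambda>x. cos (t * x)" "\<bar>t\<bar>"])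
      show "\<bar>cos (t * x) - cos (t * y)\<bar> \<le> \<bar>t\<bar> * \<bar>x - y\<bar>" for x y
      proof -
        have "cos (t * x) - cos (t * y) = 2 * (sin ((t * x + t * y) / 2) * sin ((t * y - t * x) / 2))"
          by (simp add: cos_diff_cos)
        then have "\<bar>cos (t * x) - cos (t * y)\<bar> = 2 * (\<bar>sin ((t * x + t * y) / 2)\<bar> * \<bar>sin ((t * y - t * x) / 2)\<bar>)"
          by (simp add: abs_mult)
        also have "\<dots> \<le> 2 * (1 * \<bar>(t * y - t * x) / 2\<bar>)"
          by (intro mult_left_mono mult_mono abs_sin_le_one abs_sin_x_le_abs_x) auto
        also have "\<dots> = \<bar>t * (y - x)\<bar>" by (simp add: right_diff_distrib)
        also have "\<dots> = \<bar>t\<bar> * \<bar>x - y\<bar>" by (simp add: abs_mult abs_minus_commute)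
        finally show ?thesis .
      qed
    qed (auto intro!: continuous_intros)
    have sin: "(\<integral>\<omega>. sin (t * H \<omega>) \<partial>M) = (\<integral>x. sin (t * x) \<partial>\<mu>)" for t :: real
    proof (rule key[of "\<lambda>x. sin (t * x)" "\<bar>t\<bar>"])
      show "\<bar>sin (t * x) - sin (t * y)\<bar> \<le> \<bar>t\<bar> * \<bar>x - y\<bar>" for x y
      proof -
        have "sin (t * x) - sin (t * y) = 2 * (sin ((t * x - t * y) / 2) * cos ((t * x + t * y) / 2))"
          by (simp add: sin_diff_sin)
        then have "\<bar>sin (t * x) - sin (t * y)\<bar> = 2 * (\<bar>sin ((t * x - t * y) / 2)\<bar> * \<bar>cos ((t * x + t * y) / 2)\<bar>)"
          by (simp add: abs_mult)
        also have "\<dots> \<le> 2 * (\<bar>(t * x - t * y) / 2\<bar> * 1)"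
          by (intro mult_left_mono mult_mono abs_cos_le_one abs_sin_x_le_abs_x) auto
        also have "\<dots> = \<bar>t * (x - y)\<bar>" by (simp add: right_diff_distrib)
        also have "\<dots> = \<bar>t\<bar> * \<bar>x - y\<bar>" by (simp add: abs_mult)
        finally show ?thesis .
      qed
    qed (auto intro!: continuous_intros)
    have HD: "real_distribution (distr M borel H)" by simp
    have char_eq: "char \<nu> t = Complex (\<integral>x. cos (t * x) \<partial>\<nu>) (\<integral>x. sin (t * x) \<partial>\<nu>)"
      if "real_distribution \<nu>" for \<nu> t
    proof -
      interpret \<nu>: real_distribution \<nu> by fact
      have int: "integrable \<nu> (\<lambda>x. iexp (t * x))"
        by (rule \<nu>.integrable_const_bound[where B = 1]) auto
      show ?thesis
        unfolding char_def
        using integral_Re[OF int] integral_Im[OF int]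
        by (intro complex_eqI) (simp_all add: Re_exp Im_exp)
    qed
    have "char (distr M borel H) = char \<mu>"
    proof
      fix t
      show "char (distr M borel H) t = char \<mu> t"
        unfolding char_eq[OF HD] char_eq[OF \<mu>] using cos[of t] sin[of t] by (simp add: integral_distr)
    qed
    then show ?thesis by (rule Levy_uniqueness[OF HD \<mu>])
  qed
  ultimately show ?thesis by blast
qed

end

theorem theorem1p2:
  fixes M :: "'a measure"
    and G :: "nat \<Rightarrow> 'a \<Rightarrow> real"
    and d :: nat
    and F :: "nat \<Rightarrow> 'a \<Rightarrow> real"
    and \<mu> :: "real measure"
  assumes "prob_space M"
    and "prob_space.indep_vars M (\<lambda>_. borel) G UNIV"
    and "\<And>i. distributed M lborel (G i) std_normal_density"
    and "d \<ge> 1"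
    and "\<And>n. F n \<in> polynomials_in M G d"
    and "real_distribution \<mu>"
    and "weak_conv_m (\<lambda>n. distr M borel (F n)) \<mu>"
  shows "\<exists>H \<in> polynomials_in M G d. distr M borel H = \<mu>"
proof -
  interpret prob_space M by fact
  interpret gaussian_seq M G using assms(2,3) by unfold_locales
  show ?thesis by (rule polynomials_in_closed[OF assms(5-7)])
qed

end
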